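(* Let $k$ be an algebraically closed field of characteristic zero, $n\ge2$, $V$ a finite-dimensional $k$-vector space, $g\in\mathrm{GL}(V)$ semisimple, $c\in k^\times$, $\lambda\in k^\times\setminus\{1\}$, and let $\rho=\rho_{g,c}$ be the representation of $F_n\rtimes B_n$ on $V$ with $\rho(x_j)=g$ for all $j$ and $\rho(\sigma_i)=cI$ for all $i$. Suppose $\mathrm{spec}(g)\setminus\{1\}\subseteq\{\mu\}$ with $\mu\in k^\times\setminus\{1,-1\}$, and put $T_i:=c^{-1}\rho^{\mathrm{KLM}}_\lambda(\sigma_i)$. Then $$(1-T_i)^2=(1+\mu)(1-T_i),\qquad(1-T_i)(1-T_{i\pm1})(1-T_i)=\mu(1-T_i),$$ and $(1-T_i)(1-T_j)=0$ for $|i-j|\ge2$ (for all indices for which the terms are defined). Consequently, choosing $r\in k^\times$ with $r^2=\mu$ and putting $\delta=r+r^{-1}$, the operators $e_i:=r^{-1}(1-T_i)$ satisfy the Temperley--Lieb relations, so that the $H_n(\mu)$-module given by $T_1,\dots,T_{n-1}$ factors through $TL_n(r+r^{-1})$. The first two displayed identities also hold when instead $\mathrm{spec}(g)\setminus\{1\}\subseteq\{-1\}$ and $\mu=-1$; with $r^2=-1$ one has $\delta=0$, and the same formulas yield a $TL_n(0)$-module.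
   Context: $B_n$ is the Artin braid group with standard generators $\sigma_1,\dots,\sigma_{n-1}$; $F_n$ is the free group on $x_1,\dots,x_n$. The Artin action $\theta\colon B_n\to\mathrm{Aut}(F_n)$ is $\theta_{\sigma_i}(x_i)=x_{i+1}$, $\theta_{\sigma_i}(x_{i+1})=x_{i+1}^{-1}x_ix_{i+1}$, $\theta_{\sigma_i}(x_j)=x_j$ for $j\ne i,i+1$. $F_n\rtimes B_n$ is the corresponding semidirect product, in which $\sigma x\sigma^{-1}=\theta_\sigma(x)$. For a representation $\rho\colon F_n\rtimes B_n\to\mathrm{GL}(V)$, $N=\dim V$, write $g_i:=\rho(x_i)$, $s_i:=\rho(\sigma_i)$. Twisted Long--Moody construction: for $\lambda\in k^\times$, $\rho^{\mathrm{LM}}_\lambda\colon F_n\rtimes B_n\to\mathrm{GL}(V^{\oplus n})$ is the representation given on generators as follows, in $n\times n$ block form with $N\times N$ blocks. $\rho^{\mathrm{LM}}_\lambda(x_i)$ is the identity matrix except in the $i$-th block row, which equals $(\lambda(g_1-1),\dots,\lambda(g_{i-1}-1),\lambda g_i,g_{i+1}-1,\dots,g_n-1)$. $\rho^{\mathrm{LM}}_\lambda(\sigma_i)=s_i^{\oplus n}\cdot\mathrm{diag}(I_{N(i-1)},R_i,I_{N(n-i-1)})$ with $R_i=\begin{pmatrix}O&g_i\\ I_N&I_N-g_{i+1}\end{pmatrix}$ in block rows and columns $i,i+1$. Katz--Long--Moody (KLM) construction: let $K=\{(w_1,\dots,w_n)^T: w_j\in\mathrm{Ker}(g_j-1)\}$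 and $L=\bigcap_{j=1}^n\mathrm{Ker}(\rho^{\mathrm{LM}}_\lambda(x_j)-I)$. The subspace $K+L$ is $\rho^{\mathrm{LM}}_\lambda$-invariant, and $\rho^{\mathrm{KLM}}_\lambda$ is the induced representation of $F_n\rtimes B_n$ on $V^{\oplus n}/(K+L)$. For $q\in k^\times$, $H_n(q)$ is the $k$-algebra with generators $T_1,\dots,T_{n-1}$, the braid relations, and $(T_i-1)(T_i+q)=0$; under the stated hypotheses the operators $T_i$ define an $H_n(\mu)$-module. For $\delta\in k$, the Temperley--Lieb algebra $TL_n(\delta)$ is the $k$-algebra with generators $e_1,\dots,e_{n-1}$ and relations $e_i^2=\delta e_i$, $e_ie_{i\pm1}e_i=e_i$, $e_ie_j=e_je_i$ for $|i-j|\ge2$. $\mathrm{spec}$ denotes the set of eigenvalues. *)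

theory Defs
  imports
    "HOL-Algebra.Module"
    "HOL-Algebra.Bij"
    "HOL-Algebra.QuotRing"
    "HOL-Computational_Algebra.Polynomial"
begin

section \<open>Groups: free groups, braid groups, the Artin semidirect product\<close>

text \<open>A word is a list of letters; \<open>(a, True)\<close> stands for the generator \<open>a\<close>
  and \<open>(a, False)\<close> for its inverse.\<close>

type_synonym 'a word = "('a \<times> bool) list"

inductive pres_eq :: "'a set \<Rightarrow> ('a word \<times> 'a word) set \<Rightarrow> 'a word \<Rightarrow> 'a word \<Rightarrow> bool"
  for S R where
  refl: "pres_eq S R u u"
| sym: "pres_eq S R u v \<Longrightarrow> pres_eq S R v u"
| trans: "pres_eq S R u v \<Longrightarrow> pres_eq S R v w \<Longrightarrow> pres_eq S R u w"
| cong: "pres_eq S R u v \<Longrightarrow> pres_eq S R (p @ u @ q) (p @ v @ q)"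
| cancel: "a \<in> S \<Longrightarrow> pres_eq S R [(a, e), (a, \<not> e)] []"
| rel: "(u, v) \<in> R \<Longrightarrow> pres_eq S R u v"

definition pres_rel :: "'a set \<Rightarrow> ('a word \<times> 'a word) set \<Rightarrow> ('a word \<times> 'a word) set" where
  "pres_rel S R =
    {(u, v). u \<in> lists (S \<times> UNIV) \<and> v \<in> lists (S \<times> UNIV) \<and> pres_eq S R u v}"

definition pres_group :: "'a set \<Rightarrow> ('a word \<times> 'a word) set \<Rightarrow> 'a word set monoid" where
  "pres_group S R =
    \<lparr>carrier = lists (S \<times> UNIV) // pres_rel S R,
     monoid.mult = (\<lambda>X Y. \<Union>u\<in>X. \<Union>v\<in>Y. pres_rel S R `` {u @ v}),
     one = pres_rel S R `` {[]}\<rparr>"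

definition pres_gen :: "'a set \<Rightarrow> ('a word \<times> 'a word) set \<Rightarrow> 'a \<Rightarrow> 'a word set" where
  "pres_gen S R a = pres_rel S R `` {[(a, True)]}"

definition free_grp :: "nat \<Rightarrow> nat word set monoid" where
  "free_grp n = pres_group {1..n} {}"

definition free_gen :: "nat \<Rightarrow> nat \<Rightarrow> nat word set" where
  "free_gen n j = pres_gen {1..n} {} j"

definition braid_group_rels :: "nat \<Rightarrow> (nat word \<times> nat word) set" where
  "braid_group_rels n =
    {([(i, True), (i + 1, True), (i, True)], [(i + 1, True), (i, True), (i + 1, True)]) | i.
       i \<in> {1..<n} \<and> i + 1 \<in> {1..<n}} \<union>
    {([(i, True), (j, True)], [(j, True), (i, True)]) | i j.
       i \<in> {1..<n} \<and> j \<in> {1..<n} \<and> (i + 2 \<le> j \<or> j + 2 \<le> i)}"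

definition braid_grp :: "nat \<Rightarrow> nat word set monoid" where
  "braid_grp n = pres_group {1..<n} (braid_group_rels n)"

definition braid_gen :: "nat \<Rightarrow> nat \<Rightarrow> nat word set" where
  "braid_gen n i = pres_gen {1..<n} (braid_group_rels n) i"

text \<open>The choice is unique on the carrier of the braid group: a homomorphism is determined by its
  values on generators, and so is an automorphism of the free group.\<close>

definition artin_action :: "nat \<Rightarrow> nat word set \<Rightarrow> nat word set \<Rightarrow> nat word set" where
  "artin_action n = (SOME \<theta>. \<theta> \<in> hom (braid_grp n) (AutoGroup (free_grp n)) \<and>
     (\<forall>i\<in>{1..<n}.
        \<theta> (braid_gen n i) (free_gen n i) = free_gen n (i + 1) \<and>
        \<theta> (braid_gen n i) (free_gen n (i + 1)) =
          inv\<^bsub>free_grp n\<^esub> (free_gen n (i + 1)) \<otimes>\<^bsub>free_grp n\<^esub> free_gen n i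
            \<otimes>\<^bsub>free_grp n\<^esub> free_gen n (i + 1) \<and>
        (\<forall>j\<in>{1..n} - {i, i + 1}. \<theta> (braid_gen n i) (free_gen n j) = free_gen n j)))"

definition semidirect ::
  "'a monoid \<Rightarrow> 'b monoid \<Rightarrow> ('b \<Rightarrow> 'a \<Rightarrow> 'a) \<Rightarrow> ('a \<times> 'b) monoid" where
  "semidirect N H \<theta> =
    \<lparr>carrier = carrier N \<times> carrier H,
     monoid.mult = (\<lambda>(a, s) (b, t). (a \<otimes>\<^bsub>N\<^esub> \<theta> s b, s \<otimes>\<^bsub>H\<^esub> t)),
     one = (\<one>\<^bsub>N\<^esub>, \<one>\<^bsub>H\<^esub>)\<rparr>"

type_synonym fb = "nat word set \<times> nat word set"

definition FB :: "nat \<Rightarrow> fb monoid" where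
  "FB n = semidirect (free_grp n) (braid_grp n) (artin_action n)"

definition FB_x :: "nat \<Rightarrow> nat \<Rightarrow> fb" where
  "FB_x n j = (free_gen n j, \<one>\<^bsub>braid_grp n\<^esub>)"

definition FB_sigma :: "nat \<Rightarrow> nat \<Rightarrow> fb" where
  "FB_sigma n i = (\<one>\<^bsub>free_grp n\<^esub>, braid_gen n i)"


section \<open>Vector spaces and algebras as records\<close>

text \<open>Scalars come from a type \<open>'k\<close> of class \<^class>\<open>field\<close>. The record type \<open>('k, 'a) module\<close>
  carries vector spaces (whose ring multiplication and unit are dummies) as well as \<open>'k\<close>-algebras.\<close>

definition vspace :: "('k \<Rightarrow> 'v \<Rightarrow> 'v) \<Rightarrow> ('k, 'v::ab_group_add) module" where
  "vspace sc = \<lparr>carrier = UNIV, monoid.mult = (\<lambda>_ _. 0), one = 0,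
     zero = 0, add = (+), module.smult = sc\<rparr>"

text \<open>The space \<open>V\<^sup>\<oplus>\<^sup>n\<close>: families indexed by \<open>{1..n}\<close>, extended by zero.\<close>

definition vpower :: "nat \<Rightarrow> ('k \<Rightarrow> 'v \<Rightarrow> 'v) \<Rightarrow> ('k, nat \<Rightarrow> 'v::ab_group_add) module" where
  "vpower n sc = \<lparr>carrier = {w. \<forall>j. j \<notin> {1..n} \<longrightarrow> w j = 0},
     monoid.mult = (\<lambda>_ _ _. 0), one = (\<lambda>_. 0),
     zero = (\<lambda>_. 0), add = (\<lambda>u w j. u j + w j), module.smult = (\<lambda>a w j. sc a (w j))\<rparr>"

definition quot_smult :: "('k, 'a) module \<Rightarrow> 'a set \<Rightarrow> 'k \<Rightarrow> 'a set \<Rightarrow> 'a set" where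
  "quot_smult M U a X = (\<Union>x\<in>X. U +>\<^bsub>M\<^esub> (a \<odot>\<^bsub>M\<^esub> x))"

definition quot_space :: "('k, 'a) module \<Rightarrow> 'a set \<Rightarrow> ('k, 'a set) module" where
  "quot_space M U = \<lparr>carrier = a_rcosets\<^bsub>M\<^esub> U, monoid.mult = (\<lambda>_ _. U), one = U,
     zero = U, add = set_add M, module.smult = quot_smult M U\<rparr>"

text \<open>Linear endomorphisms are made extensional, so that equality in the carrier is equality of maps
  on the space.\<close>

definition End_alg :: "('k, 'a) module \<Rightarrow> ('k, 'a \<Rightarrow> 'a) module" where
  "End_alg M = \<lparr>carrier = {f \<in> carrier M \<rightarrow>\<^sub>E carrier M.
        (\<forall>u\<in>carrier M. \<forall>v\<in>carrier M. f (u \<oplus>\<^bsub>M\<^esub> v) = f u \<oplus>\<^bsub>M\<^esub> f v) \<and>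
        (\<forall>a. \<forall>v\<in>carrier M. f (a \<odot>\<^bsub>M\<^esub> v) = a \<odot>\<^bsub>M\<^esub> f v)},
     monoid.mult = (\<lambda>f h. compose (carrier M) f h),
     one = (\<lambda>v\<in>carrier M. v),
     zero = (\<lambda>v\<in>carrier M. \<zero>\<^bsub>M\<^esub>),
     add = (\<lambda>f h. \<lambda>v\<in>carrier M. f v \<oplus>\<^bsub>M\<^esub> h v),
     module.smult = (\<lambda>a f. \<lambda>v\<in>carrier M. a \<odot>\<^bsub>M\<^esub> f v)\<rparr>"

definition GL :: "('k, 'a) module \<Rightarrow> ('a \<Rightarrow> 'a) monoid" where
  "GL M = units_of (End_alg M)"

definition spec :: "('k \<Rightarrow> 'v \<Rightarrow> 'v) \<Rightarrow> ('v \<Rightarrow> 'v::ab_group_add) \<Rightarrow> 'k set" where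
  "spec sc g = {a. \<exists>v. v \<noteq> 0 \<and> g v = sc a v}"

definition semisimple_op ::
  "('k::field \<Rightarrow> 'v \<Rightarrow> 'v) \<Rightarrow> ('v \<Rightarrow> 'v::ab_group_add) \<Rightarrow> bool" where
  "semisimple_op sc g \<longleftrightarrow>
    (\<forall>U. module.subspace sc U \<and> g ` U \<subseteq> U \<longrightarrow>
      (\<exists>W. module.subspace sc W \<and> g ` W \<subseteq> W \<and> U \<inter> W = {0} \<and>
           {u + w | u w. u \<in> U \<and> w \<in> W} = UNIV))"


section \<open>The twisted Long--Moody and Katz--Long--Moody constructions\<close>

text \<open>The block matrices, with \<open>g j\<close> and \<open>s i\<close> the images of \<open>x\<^sub>j\<close> and \<open>\<sigma>\<^sub>i\<close>,
  acting on column vectors.\<close>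

definition LM_x_op ::
  "nat \<Rightarrow> ('k \<Rightarrow> 'v \<Rightarrow> 'v) \<Rightarrow> 'k \<Rightarrow> (nat \<Rightarrow> 'v \<Rightarrow> 'v) \<Rightarrow> nat
    \<Rightarrow> (nat \<Rightarrow> 'v) \<Rightarrow> (nat \<Rightarrow> 'v::ab_group_add)" where
  "LM_x_op n sc lam g i = (\<lambda>w\<in>carrier (vpower n sc). \<lambda>j.
     if j = i
     then (\<Sum>l\<in>{1..<i}. sc lam (g l (w l) - w l)) + sc lam (g i (w i))
            + (\<Sum>l\<in>{i + 1..n}. g l (w l) - w l)
     else w j)"

definition LM_sigma_op ::
  "nat \<Rightarrow> ('k \<Rightarrow> 'v \<Rightarrow> 'v) \<Rightarrow> (nat \<Rightarrow> 'v \<Rightarrow> 'v) \<Rightarrow> (nat \<Rightarrow> 'v \<Rightarrow> 'v) \<Rightarrow> nat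
    \<Rightarrow> (nat \<Rightarrow> 'v) \<Rightarrow> (nat \<Rightarrow> 'v::ab_group_add)" where
  "LM_sigma_op n sc g s i = (\<lambda>w\<in>carrier (vpower n sc). \<lambda>j.
     s i (if j = i then g i (w (i + 1))
          else if j = i + 1 then w i + (w (i + 1) - g (i + 1) (w (i + 1)))
          else w j))"

text \<open>Again the choice is unique on the carrier of the group.\<close>

definition LM_rep ::
  "nat \<Rightarrow> ('k \<Rightarrow> 'v \<Rightarrow> 'v) \<Rightarrow> 'k \<Rightarrow> (fb \<Rightarrow> 'v \<Rightarrow> 'v)
    \<Rightarrow> fb \<Rightarrow> (nat \<Rightarrow> 'v) \<Rightarrow> (nat \<Rightarrow> 'v::ab_group_add)" where
  "LM_rep n sc lam \<rho> = (SOME \<rho>'. \<rho>' \<in> hom (FB n) (GL (vpower n sc)) \<and>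
     (\<forall>j\<in>{1..n}. \<rho>' (FB_x n j) = LM_x_op n sc lam (\<lambda>l. \<rho> (FB_x n l)) j) \<and>
     (\<forall>i\<in>{1..<n}. \<rho>' (FB_sigma n i) =
        LM_sigma_op n sc (\<lambda>l. \<rho> (FB_x n l)) (\<lambda>l. \<rho> (FB_sigma n l)) i))"

definition KLM_K ::
  "nat \<Rightarrow> ('k \<Rightarrow> 'v \<Rightarrow> 'v) \<Rightarrow> (fb \<Rightarrow> 'v \<Rightarrow> 'v) \<Rightarrow> (nat \<Rightarrow> 'v::ab_group_add) set" where
  "KLM_K n sc \<rho> = {w \<in> carrier (vpower n sc). \<forall>j\<in>{1..n}. \<rho> (FB_x n j) (w j) = w j}"

definition KLM_L ::
  "nat \<Rightarrow> ('k \<Rightarrow> 'v \<Rightarrow> 'v) \<Rightarrow> 'k \<Rightarrow> (fb \<Rightarrow> 'v \<Rightarrow> 'v) \<Rightarrow> (nat \<Rightarrow> 'v::ab_group_add) set" where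
  "KLM_L n sc lam \<rho> =
    {w \<in> carrier (vpower n sc). \<forall>j\<in>{1..n}. LM_rep n sc lam \<rho> (FB_x n j) w = w}"

definition KLM_sub ::
  "nat \<Rightarrow> ('k \<Rightarrow> 'v \<Rightarrow> 'v) \<Rightarrow> 'k \<Rightarrow> (fb \<Rightarrow> 'v \<Rightarrow> 'v) \<Rightarrow> (nat \<Rightarrow> 'v::ab_group_add) set" where
  "KLM_sub n sc lam \<rho> = KLM_K n sc \<rho> <+>\<^bsub>vpower n sc\<^esub> KLM_L n sc lam \<rho>"

definition KLM_space ::
  "nat \<Rightarrow> ('k \<Rightarrow> 'v \<Rightarrow> 'v) \<Rightarrow> 'k \<Rightarrow> (fb \<Rightarrow> 'v \<Rightarrow> 'v)
    \<Rightarrow> ('k, (nat \<Rightarrow> 'v::ab_group_add) set) module" where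
  "KLM_space n sc lam \<rho> = quot_space (vpower n sc) (KLM_sub n sc lam \<rho>)"

definition KLM_rep ::
  "nat \<Rightarrow> ('k \<Rightarrow> 'v \<Rightarrow> 'v) \<Rightarrow> 'k \<Rightarrow> (fb \<Rightarrow> 'v \<Rightarrow> 'v)
    \<Rightarrow> fb \<Rightarrow> (nat \<Rightarrow> 'v) set \<Rightarrow> (nat \<Rightarrow> 'v::ab_group_add) set" where
  "KLM_rep n sc lam \<rho> h = (\<lambda>X\<in>carrier (KLM_space n sc lam \<rho>).
     \<Union>w\<in>X. KLM_sub n sc lam \<rho> +>\<^bsub>vpower n sc\<^esub> LM_rep n sc lam \<rho> h w)"


section \<open>Algebras given by generators and relations\<close>

text \<open>Noncommutative polynomials: finitely supported coefficient functions on words in \<open>S\<close>.\<close>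

definition free_alg :: "'a set \<Rightarrow> ('k::field, 'a list \<Rightarrow> 'k) module" where
  "free_alg S = \<lparr>carrier = {f. finite {w. f w \<noteq> 0} \<and> (\<forall>w. f w \<noteq> 0 \<longrightarrow> w \<in> lists S)},
     monoid.mult = (\<lambda>f h w. \<Sum>i\<le>length w. f (take i w) * h (drop i w)),
     one = (\<lambda>w. if w = [] then 1 else 0),
     zero = (\<lambda>_. 0), add = (\<lambda>f h w. f w + h w), module.smult = (\<lambda>a f w. a * f w)\<rparr>"

definition free_alg_gen :: "'a \<Rightarrow> 'a list \<Rightarrow> 'k::field" where
  "free_alg_gen a = (\<lambda>w. if w = [a] then 1 else 0)"

definition quot_alg :: "('k, 'a) module \<Rightarrow> 'a set \<Rightarrow> ('k, 'a set) module" where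
  "quot_alg A I = ring.extend (A Quot I) (module.fields (quot_smult A I))"

definition rel_ideal :: "('k, 'a) module \<Rightarrow> ('a \<times> 'a) set \<Rightarrow> 'a set" where
  "rel_ideal A R = Idl\<^bsub>A\<^esub> {u \<ominus>\<^bsub>A\<^esub> v | u v. (u, v) \<in> R}"

definition alg_hom ::
  "('k, 'a) module \<Rightarrow> ('k, 'b) module \<Rightarrow> ('a \<Rightarrow> 'b) set" where
  "alg_hom A B = {h \<in> ring_hom A B. \<forall>a. \<forall>x\<in>carrier A. h (a \<odot>\<^bsub>A\<^esub> x) = a \<odot>\<^bsub>B\<^esub> h x}"

text \<open>The defining relations, as pairs (left side, right side), for elements
  \<open>t 1, \<dots>, t (n - 1)\<close> of an arbitrary algebra \<open>A\<close>.\<close>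

definition hecke_rels ::
  "('k::field, 'a) module \<Rightarrow> nat \<Rightarrow> 'k \<Rightarrow> (nat \<Rightarrow> 'a) \<Rightarrow> ('a \<times> 'a) set" where
  "hecke_rels A n q t =
    {((t i \<ominus>\<^bsub>A\<^esub> \<one>\<^bsub>A\<^esub>) \<otimes>\<^bsub>A\<^esub> (t i \<oplus>\<^bsub>A\<^esub> q \<odot>\<^bsub>A\<^esub> \<one>\<^bsub>A\<^esub>), \<zero>\<^bsub>A\<^esub>) | i. i \<in> {1..<n}} \<union>
    {(t i \<otimes>\<^bsub>A\<^esub> t (i + 1) \<otimes>\<^bsub>A\<^esub> t i, t (i + 1) \<otimes>\<^bsub>A\<^esub> t i \<otimes>\<^bsub>A\<^esub> t (i + 1)) | i.
       i \<in> {1..<n} \<and> i + 1 \<in> {1..<n}} \<union>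
    {(t i \<otimes>\<^bsub>A\<^esub> t j, t j \<otimes>\<^bsub>A\<^esub> t i) | i j.
       i \<in> {1..<n} \<and> j \<in> {1..<n} \<and> (i + 2 \<le> j \<or> j + 2 \<le> i)}"

definition tl_rels ::
  "('k::field, 'a) module \<Rightarrow> nat \<Rightarrow> 'k \<Rightarrow> (nat \<Rightarrow> 'a) \<Rightarrow> ('a \<times> 'a) set" where
  "tl_rels A n \<delta> e =
    {(e i \<otimes>\<^bsub>A\<^esub> e i, \<delta> \<odot>\<^bsub>A\<^esub> e i) | i. i \<in> {1..<n}} \<union>
    {(e i \<otimes>\<^bsub>A\<^esub> e j \<otimes>\<^bsub>A\<^esub> e i, e i) | i j.
       i \<in> {1..<n} \<and> j \<in> {1..<n} \<and> (j = i + 1 \<or> i = j + 1)} \<union>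
    {(e i \<otimes>\<^bsub>A\<^esub> e j, e j \<otimes>\<^bsub>A\<^esub> e i) | i j.
       i \<in> {1..<n} \<and> j \<in> {1..<n} \<and> (i + 2 \<le> j \<or> j + 2 \<le> i)}"

definition hecke_ideal :: "nat \<Rightarrow> 'k::field \<Rightarrow> (nat list \<Rightarrow> 'k) set" where
  "hecke_ideal n q = rel_ideal (free_alg {1..<n}) (hecke_rels (free_alg {1..<n}) n q free_alg_gen)"

definition hecke_alg :: "nat \<Rightarrow> 'k::field \<Rightarrow> ('k, (nat list \<Rightarrow> 'k) set) module" where
  "hecke_alg n q = quot_alg (free_alg {1..<n}) (hecke_ideal n q)"

definition hecke_gen :: "nat \<Rightarrow> 'k::field \<Rightarrow> nat \<Rightarrow> (nat list \<Rightarrow> 'k) set" where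
  "hecke_gen n q i = hecke_ideal n q +>\<^bsub>free_alg {1..<n}\<^esub> free_alg_gen i"

definition tl_ideal :: "nat \<Rightarrow> 'k::field \<Rightarrow> (nat list \<Rightarrow> 'k) set" where
  "tl_ideal n \<delta> = rel_ideal (free_alg {1..<n}) (tl_rels (free_alg {1..<n}) n \<delta> free_alg_gen)"

definition tl_alg :: "nat \<Rightarrow> 'k::field \<Rightarrow> ('k, (nat list \<Rightarrow> 'k) set) module" where
  "tl_alg n \<delta> = quot_alg (free_alg {1..<n}) (tl_ideal n \<delta>)"

definition tl_gen :: "nat \<Rightarrow> 'k::field \<Rightarrow> nat \<Rightarrow> (nat list \<Rightarrow> 'k) set" where
  "tl_gen n \<delta> i = tl_ideal n \<delta> +>\<^bsub>free_alg {1..<n}\<^esub> free_alg_gen i"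

end

theory Submission
  imports Defs "HOL-Library.Function_Algebras"
begin

text \<open>
  Let \<open>single m v\<close> be the family whose only nonzero entry is \<open>v\<close> in
  position \<open>m\<close>, and put \<open>\<psi>\<^sub>i w = w\<^sub>i - g w\<^bsub>i+1\<^esub>\<close>. All the \<open>x\<^sub>j\<close> act on \<open>V\<close> by the
  same operator and every \<open>\<sigma>\<^sub>i\<close> acts by the scalar \<open>c\<close>, so that before passing to the quotient
  \<open>1 - c\<^sup>-\<^sup>1 \<sigma>\<^sub>i\<close> sends \<open>w\<close> to \<open>single i (\<psi>\<^sub>i w) - single (i + 1) (\<psi>\<^sub>i w)\<close>. It factors
  through a single copy of \<open>V\<close>, and products of these operators are read off from the values of one
  \<open>\<psi>\<close> on the image of another (\<open>psi_defect\<close>): the square replaces \<open>\<psi>\<^sub>i w\<close> by \<open>(1 + g) (\<psi>\<^sub>i w)\<close>, the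
  triple product of two neighbours replaces it by \<open>g (\<psi>\<^sub>i w)\<close>, and distant ones annihilate each other.
  These are the required identities with \<open>g\<close> in place of \<open>\<mu>\<close>. They become the required ones in the
  quotient: a semisimple \<open>g\<close> with no eigenvalue outside \<open>{1, \<mu>}\<close> satisfies \<open>(g - 1) (g - \<mu>) = 0\<close>
  (\<open>semisimple_two_eigenvalues\<close>), so \<open>g v - \<mu> v\<close> is always fixed by \<open>g\<close>, and families of fixed vectors
  lie in \<open>K\<close>.

  Both the Artin action and the Long--Moody representation are defined by choice from a description on
  generators, which says nothing until such an object is known to exist. Words are evaluated in a group to
  give the universal property of a presented group (\<open>pres_group_universal\<close>); this yields the Artin action
  (\<open>artin_action_exists\<close>), then a criterion for extending values on generators to the
  semidirect product (\<open>FB_universal\<close>), and finally the Long--Moody representation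
  (\<open>LM_rep_exists\<close>). For the latter, \<open>x\<^sub>j\<close> acts by \<open>w \<mapsto> w + single j (\<phi>\<^sub>j w)\<close> for a linear map
  \<open>\<phi>\<^sub>j\<close> from \<open>V\<^sup>n\<close> to \<open>V\<close>, and the computation rests on \<open>\<phi>\<^bsub>i+1\<^esub> (\<sigma>\<^sub>i w) = c \<phi>\<^sub>i w\<close> together with
  the fact that \<open>\<sigma>\<^sub>i\<close> commutes with \<open>x\<^sub>i x\<^bsub>i+1\<^esub>\<close>. Every \<open>\<phi>\<^sub>j (\<sigma>\<^sub>i w)\<close> is
  determined by the values \<open>\<phi>\<^sub>l w\<close> (\<open>phi_S\<close>), which also makes \<open>L\<close>, the common kernel of the \<open>\<phi>\<^sub>j\<close>,
  invariant.

  On the algebra side, free algebras and their quotients get the corresponding universal property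
  (\<open>presented_alg_universal\<close>). The Temperley--Lieb relations for \<open>e\<^sub>i\<close> imply the Hecke relations for
  \<open>1 - r e\<^sub>i\<close> with parameter \<open>r\<^sup>2\<close>; hence the Hecke algebra maps to the Temperley--Lieb algebra, and the
  action of the Hecke algebra is the composite of that map with the action of the Temperley--Lieb algebra
  (\<open>hecke_factors_through_tl\<close>).
\<close>

section \<open>Groups given by generators and relations\<close>

definition word_eval :: "('g, 'm) monoid_scheme \<Rightarrow> ('a \<Rightarrow> 'g) \<Rightarrow> 'a word \<Rightarrow> 'g" where
  "word_eval G t w =
    foldr (\<lambda>(a, e) y. (if e then t a else inv\<^bsub>G\<^esub> t a) \<otimes>\<^bsub>G\<^esub> y) w \<one>\<^bsub>G\<^esub>"

lemma word_eval_Nil [simp]: "word_eval G t [] = \<one>\<^bsub>G\<^esub>"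
  by (simp add: word_eval_def)

lemma word_eval_Cons [simp]:
  "word_eval G t ((a, e) # w) = (if e then t a else inv\<^bsub>G\<^esub> t a) \<otimes>\<^bsub>G\<^esub> word_eval G t w"
  by (simp add: word_eval_def)

context group
begin

lemma word_eval_closed: "\<forall>a. t a \<in> carrier G \<Longrightarrow> word_eval G t w \<in> carrier G"
  by (induction w) auto

lemma word_eval_append:
  "\<forall>a. t a \<in> carrier G \<Longrightarrow> word_eval G t (u @ v) = word_eval G t u \<otimes> word_eval G t v"
  by (induction u) (auto simp: word_eval_closed m_assoc)

lemma word_eval_pres_eq:
  assumes "pres_eq S R u v" "\<forall>a. t a \<in> carrier G"
    and "\<forall>(u, v)\<in>R. word_eval G t u = word_eval G t v"
  shows "word_eval G t u = word_eval G t v"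
  using assms(1)
proof induction
  case (cancel a e)
  then show ?case using assms(2) by (cases e) auto
next
  case (rel u v)
  then show ?case using assms(3) by blast
qed (use assms(2) in \<open>auto simp: word_eval_append\<close>)

end

text \<open>The carrier of a presented group consists of classes of these words. A separate constant keeps the
  simplifier from turning membership into a statement about the letters of the word.\<close>

definition words :: "'a set \<Rightarrow> 'a word set" where
  "words S = lists (S \<times> UNIV)"

lemma words_simps [simp]:
  "[] \<in> words S"
  "(a, e) # w \<in> words S \<longleftrightarrow> a \<in> S \<and> w \<in> words S"
  "u @ v \<in> words S \<longleftrightarrow> u \<in> words S \<and> v \<in> words S"
  by (auto simp: words_def)

definition word_inv :: "'a word \<Rightarrow> 'a word" where
  "word_inv w = rev (map (\<lambda>(a, e). (a, \<not> e)) w)"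

lemma word_inv_in_words [simp]: "word_inv w \<in> words S \<longleftrightarrow> w \<in> words S"
  by (auto simp: words_def word_inv_def in_lists_conv_set)

lemma pres_eq_append:
  assumes "pres_eq S R u u'" "pres_eq S R v v'"
  shows "pres_eq S R (u @ v) (u' @ v')"
proof (rule pres_eq.trans)
  show "pres_eq S R (u @ v) (u' @ v)" using pres_eq.cong[OF assms(1), of "[]" v] by simp
  show "pres_eq S R (u' @ v) (u' @ v')" using pres_eq.cong[OF assms(2), of u' "[]"] by simp
qed

lemma pres_eq_word_inv:
  assumes "w \<in> words S"
  shows "pres_eq S R (word_inv w @ w) []"
  using assms
proof (induction w)
  case (Cons x w)
  obtain a e where x: "x = (a, e)" by fastforce
  with Cons.prems have "pres_eq S R [(a, \<not> e), (a, e)] []"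
    using pres_eq.cancel[of a S R "\<not> e"] by auto
  from pres_eq.cong[OF this, of "word_inv w" w]
  have step: "pres_eq S R (word_inv (x # w) @ x # w) (word_inv w @ w)"
    by (simp add: x word_inv_def)
  have "pres_eq S R (word_inv w @ w) []" using Cons x by simp
  with step show ?case by (rule pres_eq.trans)
qed (simp add: word_inv_def pres_eq.refl)

lemma pres_rel_iff: "(u, v) \<in> pres_rel S R \<longleftrightarrow> u \<in> words S \<and> v \<in> words S \<and> pres_eq S R u v"
  by (simp add: pres_rel_def words_def)

lemma equiv_pres_rel: "equiv (words S) (pres_rel S R)"
proof (rule equivI)
  show "trans (pres_rel S R)"
    by (rule transI) (metis pres_rel_iff pres_eq.trans)
  show "sym (pres_rel S R)"
    by (rule symI) (metis pres_rel_iff pres_eq.sym)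
qed (auto simp: pres_rel_iff refl_on_def pres_eq.refl)

abbreviation pres_class :: "'a set \<Rightarrow> ('a word \<times> 'a word) set \<Rightarrow> 'a word \<Rightarrow> 'a word set" where
  "pres_class S R w \<equiv> pres_rel S R `` {w}"

lemma pres_class_eq:
  "u \<in> words S \<Longrightarrow> v \<in> words S \<Longrightarrow> pres_class S R u = pres_class S R v \<longleftrightarrow> pres_eq S R u v"
  using eq_equiv_class_iff[OF equiv_pres_rel, of u S v R] by (simp add: pres_rel_iff)

lemma pres_group_carrier: "carrier (pres_group S R) = pres_class S R ` words S"
  by (auto simp: pres_group_def quotient_def words_def)

lemma pres_class_closed [simp]: "w \<in> words S \<Longrightarrow> pres_class S R w \<in> carrier (pres_group S R)"
  unfolding pres_group_carrier by (rule imageI)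

lemma pres_group_cases:
  assumes "x \<in> carrier (pres_group S R)"
  obtains w where "w \<in> words S" "x = pres_class S R w"
  using assms unfolding pres_group_carrier by (elim imageE)

lemma pres_group_one: "\<one>\<^bsub>pres_group S R\<^esub> = pres_class S R []"
  by (simp add: pres_group_def)

lemma pres_group_mult:
  assumes "u \<in> words S" "v \<in> words S"
  shows "pres_class S R u \<otimes>\<^bsub>pres_group S R\<^esub> pres_class S R v = pres_class S R (u @ v)"
proof -
  have "pres_class S R (u' @ v') = pres_class S R (u @ v)"
    if "u' \<in> pres_class S R u" "v' \<in> pres_class S R v" for u' v'
  proof -
    have "pres_eq S R u u'" "pres_eq S R v v'" and w: "u' \<in> words S" "v' \<in> words S"
      using that by (auto simp: pres_rel_iff)
    then have "pres_eq S R (u' @ v') (u @ v)" by (intro pres_eq.sym[OF pres_eq_append])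
    then show ?thesis using assms w by (subst pres_class_eq) simp_all
  qed
  moreover have "u \<in> pres_class S R u" "v \<in> pres_class S R v"
    using assms by (auto simp: pres_rel_iff pres_eq.refl)
  ultimately have "(\<Union>u'\<in>pres_class S R u. \<Union>v'\<in>pres_class S R v. pres_class S R (u' @ v'))
      = pres_class S R (u @ v)"
    by blast
  then show ?thesis by (simp add: pres_group_def)
qed

lemma group_pres_group: "group (pres_group S R)"
proof (rule groupI)
  fix x assume "x \<in> carrier (pres_group S R)"
  then obtain w where w: "w \<in> words S" "x = pres_class S R w" by (rule pres_group_cases)
  then have "pres_class S R (word_inv w) \<otimes>\<^bsub>pres_group S R\<^esub> x = \<one>\<^bsub>pres_group S R\<^esub>"
    by (simp add: pres_group_mult pres_group_one pres_class_eq pres_eq_word_inv)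
  then show "\<exists>y\<in>carrier (pres_group S R). y \<otimes>\<^bsub>pres_group S R\<^esub> x = \<one>\<^bsub>pres_group S R\<^esub>"
    using w(1) by (intro bexI[of _ "pres_class S R (word_inv w)"]) simp_all
qed (auto elim!: pres_group_cases simp: pres_group_mult pres_group_one)

lemma pres_gen_closed [simp]: "a \<in> S \<Longrightarrow> pres_gen S R a \<in> carrier (pres_group S R)"
  by (simp add: pres_gen_def)

lemma pres_gen_inv:
  assumes "a \<in> S"
  shows "inv\<^bsub>pres_group S R\<^esub> (pres_gen S R a) = pres_class S R [(a, False)]"
proof (rule group.inv_equality[OF group_pres_group])
  show "pres_class S R [(a, False)] \<otimes>\<^bsub>pres_group S R\<^esub> pres_gen S R a = \<one>\<^bsub>pres_group S R\<^esub>"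
    using assms pres_eq.cancel[of a S R False]
    by (simp add: pres_gen_def pres_group_mult pres_group_one pres_class_eq)
qed (use assms in \<open>simp_all add: pres_gen_def\<close>)

lemma pres_group_induct [consumes 1, case_names one gen inv]:
  assumes "x \<in> carrier (pres_group S R)"
    and one: "P \<one>\<^bsub>pres_group S R\<^esub>"
    and gen: "\<And>a y. a \<in> S \<Longrightarrow> y \<in> carrier (pres_group S R) \<Longrightarrow> P y \<Longrightarrow>
      P (pres_gen S R a \<otimes>\<^bsub>pres_group S R\<^esub> y)"
    and inv: "\<And>a y. a \<in> S \<Longrightarrow> y \<in> carrier (pres_group S R) \<Longrightarrow> P y \<Longrightarrow>
      P (inv\<^bsub>pres_group S R\<^esub> (pres_gen S R a) \<otimes>\<^bsub>pres_group S R\<^esub> y)"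
  shows "P x"
proof -
  have "P (pres_class S R w)" if "w \<in> words S" for w
    using that
  proof (induction w)
    case Nil
    then show ?case using one by (simp add: pres_group_one)
  next
    case (Cons x w)
    obtain a e where x: "x = (a, e)" by fastforce
    with Cons have a: "a \<in> S" and w: "w \<in> words S" and P: "P (pres_class S R w)" by auto
    have eq: "pres_class S R (x # w) = pres_class S R [(a, e)] \<otimes>\<^bsub>pres_group S R\<^esub> pres_class S R w"
      using a w x by (subst pres_group_mult) simp_all
    show ?case
    proof (cases e)
      case True
      then show ?thesis using gen[OF a _ P] w eq by (simp add: pres_gen_def)
    next
      case False
      then show ?thesis using inv[OF a _ P] w eq a by (simp add: pres_gen_inv)
    qed
  qed
  then show ?thesis using assms(1) by (metis pres_group_cases)
qed

theorem pres_group_universal: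
  assumes "group G" and t: "\<And>a. a \<in> S \<Longrightarrow> t a \<in> carrier G"
    and R: "R \<subseteq> lists (S \<times> UNIV) \<times> lists (S \<times> UNIV)"
    and rels: "\<And>u v. (u, v) \<in> R \<Longrightarrow> word_eval G t u = word_eval G t v"
  shows "\<exists>h\<in>hom (pres_group S R) G. \<forall>a\<in>S. h (pres_gen S R a) = t a"
proof -
  interpret group G by fact
  \<comment> \<open>The congruence may insert arbitrary words around a relation, so every letter needs a value in \<open>G\<close>.\<close>
  define t' where "t' a = (if a \<in> S then t a else \<one>\<^bsub>G\<^esub>)" for a
  have t': "\<forall>a. t' a \<in> carrier G" using t by (auto simp: t'_def)
  have same: "word_eval G t' w = word_eval G t w" if "w \<in> words S" for w
    using that
  proof (induction w)
    case (Cons x w)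
    then show ?case by (cases x) (simp add: t'_def)
  qed simp
  have rels': "\<forall>(u, v)\<in>R. word_eval G t' u = word_eval G t' v"
  proof clarify
    fix u v assume uv: "(u, v) \<in> R"
    then have "u \<in> words S" "v \<in> words S" using R by (auto simp: words_def)
    then show "word_eval G t' u = word_eval G t' v" using rels[OF uv] by (simp add: same)
  qed
  define h where "h X = the_elem (word_eval G t' ` X)" for X
  have h: "h (pres_class S R w) = word_eval G t' w" if "w \<in> words S" for w
  proof -
    have "word_eval G t' v = word_eval G t' w" if "v \<in> pres_class S R w" for v
      using word_eval_pres_eq[OF _ t' rels', of S w v] that by (simp add: pres_rel_iff)
    moreover have "w \<in> pres_class S R w" using that by (simp add: pres_rel_iff pres_eq.refl)
    ultimately have "word_eval G t' ` pres_class S R w = {word_eval G t' w}" by blast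
    then show ?thesis by (simp add: h_def)
  qed
  have "h \<in> hom (pres_group S R) G"
    by (rule homI)
      (auto elim!: pres_group_cases
        simp: pres_group_mult h word_eval_closed[OF t'] word_eval_append[OF t'])
  moreover have "\<forall>a\<in>S. h (pres_gen S R a) = t a"
    using t by (simp add: pres_gen_def h t'_def)
  ultimately show ?thesis by blast
qed

lemma pres_group_hom_unique:
  assumes "group G" "h \<in> hom (pres_group S R) G" "h' \<in> hom (pres_group S R) G"
    and eq: "\<And>a. a \<in> S \<Longrightarrow> h (pres_gen S R a) = h' (pres_gen S R a)"
    and "x \<in> carrier (pres_group S R)"
  shows "h x = h' x"
proof -
  interpret h: group_hom "pres_group S R" G h
    using assms(1,2) group_pres_group by (simp add: group_hom_def group_hom_axioms_def)
  interpret h': group_hom "pres_group S R" G h'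
    using assms(1,3) group_pres_group by (simp add: group_hom_def group_hom_axioms_def)
  from assms(5) show ?thesis
    by (induction rule: pres_group_induct) (simp_all add: eq)
qed

section \<open>The Artin action\<close>

lemma group_free_grp: "group (free_grp n)"
  by (simp add: free_grp_def group_pres_group)

lemma group_braid_grp: "group (braid_grp n)"
  by (simp add: braid_grp_def group_pres_group)

lemma free_gen_closed [simp]: "j \<in> {1..n} \<Longrightarrow> free_gen n j \<in> carrier (free_grp n)"
  by (simp add: free_grp_def free_gen_def)

lemma braid_gen_closed [simp]: "i \<in> {1..<n} \<Longrightarrow> braid_gen n i \<in> carrier (braid_grp n)"
  by (simp add: braid_grp_def braid_gen_def)

lemma free_grp_universal:
  assumes "group G" "\<And>j. j \<in> {1..n} \<Longrightarrow> t j \<in> carrier G"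
  shows "\<exists>h\<in>hom (free_grp n) G. \<forall>j\<in>{1..n}. h (free_gen n j) = t j"
  unfolding free_grp_def free_gen_def
  by (rule pres_group_universal) (use assms in auto)

lemma free_grp_hom_unique:
  assumes "group G" "h \<in> hom (free_grp n) G" "h' \<in> hom (free_grp n) G"
    and "\<And>j. j \<in> {1..n} \<Longrightarrow> h (free_gen n j) = h' (free_gen n j)"
    and "x \<in> carrier (free_grp n)"
  shows "h x = h' x"
  using assms unfolding free_grp_def free_gen_def by (rule pres_group_hom_unique)

lemma braid_grp_universal:
  assumes "group G" and t: "\<And>i. i \<in> {1..<n} \<Longrightarrow> t i \<in> carrier G"
    and braid: "\<And>i. i \<in> {1..<n} \<Longrightarrow> i + 1 \<in> {1..<n} \<Longrightarrow>
      t i \<otimes>\<^bsub>G\<^esub> t (i + 1) \<otimes>\<^bsub>G\<^esub> t i = t (i + 1) \<otimes>\<^bsub>G\<^esub> t i \<otimes>\<^bsub>G\<^esub> t (i + 1)"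
    and comm: "\<And>i j. i \<in> {1..<n} \<Longrightarrow> j \<in> {1..<n} \<Longrightarrow> i + 2 \<le> j \<Longrightarrow>
      t i \<otimes>\<^bsub>G\<^esub> t j = t j \<otimes>\<^bsub>G\<^esub> t i"
  shows "\<exists>h\<in>hom (braid_grp n) G. \<forall>i\<in>{1..<n}. h (braid_gen n i) = t i"
  unfolding braid_grp_def braid_gen_def
proof (rule pres_group_universal[OF assms(1)])
  interpret group G by fact
  show "word_eval G t u = word_eval G t v" if "(u, v) \<in> braid_group_rels n" for u v
    using that unfolding braid_group_rels_def
  proof (elim UnE CollectE exE conjE)
    fix i assume "(u, v) = ([(i, True), (i + 1, True), (i, True)],
        [(i + 1, True), (i, True), (i + 1, True)])" "i \<in> {1..<n}" "i + 1 \<in> {1..<n}"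
    then show ?thesis using t braid[of i] by (simp add: m_assoc)
  next
    fix i j assume "(u, v) = ([(i, True), (j, True)], [(j, True), (i, True)])"
      "i \<in> {1..<n}" "j \<in> {1..<n}" "i + 2 \<le> j \<or> j + 2 \<le> i"
    then show ?thesis using t comm[of i j] comm[of j i] by auto
  qed
qed (use t in \<open>auto simp: braid_group_rels_def\<close>)

lemma (in group) AutoGroup_apply:
  "f \<in> auto G \<Longrightarrow> h \<in> auto G \<Longrightarrow> x \<in> carrier G \<Longrightarrow>
    (f \<otimes>\<^bsub>AutoGroup G\<^esub> h) x = f (h x)"
  by (simp add: AutoGroup_def BijGroup_def auto_def compose_eq)

lemma (in group) AutoGroup_carrier: "carrier (AutoGroup G) = auto G"
  by (simp add: AutoGroup_def)

lemma (in group) autoI: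
  assumes f: "f \<in> hom G G" and h: "h \<in> hom G G"
    and fh: "\<And>x. x \<in> carrier G \<Longrightarrow> f (h x) = x" and hf: "\<And>x. x \<in> carrier G \<Longrightarrow> h (f x) = x"
  shows "restrict f (carrier G) \<in> auto G"
proof -
  have "bij_betw f (carrier G) (carrier G)"
    by (rule bij_betw_byWitness[of _ h]) (use assms hom_carrier in fast)+
  then have "bij_betw (restrict f (carrier G)) (carrier G) (carrier G)"
    by (simp cong: bij_betw_cong)
  moreover have "restrict f (carrier G) \<in> hom G G"
    using f by (auto simp: hom_def Pi_iff)
  ultimately show ?thesis by (simp add: auto_def Bij_def)
qed

lemma auto_free_grp_eqI:
  assumes "f \<in> auto (free_grp n)" "h \<in> auto (free_grp n)"
    and "\<And>j. j \<in> {1..n} \<Longrightarrow> f (free_gen n j) = h (free_gen n j)"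
  shows "f = h"
proof (rule extensionalityI)
  have hom: "f \<in> hom (free_grp n) (free_grp n)" "h \<in> hom (free_grp n) (free_grp n)"
    using assms(1,2) by (simp_all add: auto_def)
  show "f x = h x" if "x \<in> carrier (free_grp n)" for x
    by (rule free_grp_hom_unique[OF group_free_grp hom _ that]) (rule assms(3))
  show "f \<in> extensional (carrier (free_grp n))" "h \<in> extensional (carrier (free_grp n))"
    using assms(1,2) by (simp_all add: auto_def Bij_def)
qed

lemma id_hom: "group G \<Longrightarrow> (\<lambda>x. x) \<in> hom G G"
  by (simp add: hom_def)

lemma (in group) inv_mult_cancel [simp]:
  "x \<in> carrier G \<Longrightarrow> y \<in> carrier G \<Longrightarrow> inv x \<otimes> (x \<otimes> y) = y"
  "x \<in> carrier G \<Longrightarrow> y \<in> carrier G \<Longrightarrow> x \<otimes> (inv x \<otimes> y) = y"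
  by (simp_all add: m_assoc[symmetric])

text \<open>The inverse sends \<open>x\<^bsub>i+1\<^esub>\<close> to \<open>x\<^sub>i\<close> and \<open>x\<^sub>i\<close> to \<open>x\<^sub>i x\<^bsub>i+1\<^esub> x\<^sub>i\<^sup>-\<^sup>1\<close>.\<close>

lemma artin_automorphism:
  assumes i: "i \<in> {1..<n}"
  shows "\<exists>f\<in>auto (free_grp n). f (free_gen n i) = free_gen n (i + 1) \<and>
    f (free_gen n (i + 1)) = inv\<^bsub>free_grp n\<^esub> (free_gen n (i + 1)) \<otimes>\<^bsub>free_grp n\<^esub> free_gen n i
      \<otimes>\<^bsub>free_grp n\<^esub> free_gen n (i + 1) \<and>
    (\<forall>j\<in>{1..n} - {i, i + 1}. f (free_gen n j) = free_gen n j)"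
proof -
  interpret group "free_grp n" by (rule group_free_grp)
  let ?F = "free_grp n" and ?x = "free_gen n"
  let ?t = "\<lambda>j. if j = i then ?x (i + 1)
    else if j = i + 1 then inv\<^bsub>?F\<^esub> (?x (i + 1)) \<otimes>\<^bsub>?F\<^esub> ?x i \<otimes>\<^bsub>?F\<^esub> ?x (i + 1) else ?x j"
  let ?u = "\<lambda>j. if j = i + 1 then ?x i
    else if j = i then ?x i \<otimes>\<^bsub>?F\<^esub> ?x (i + 1) \<otimes>\<^bsub>?F\<^esub> inv\<^bsub>?F\<^esub> (?x i) else ?x j"
  have x [simp]: "?x i \<in> carrier ?F" "?x (Suc i) \<in> carrier ?F"
    using i free_gen_closed[of i n] free_gen_closed[of "Suc i" n] by auto
  have "\<exists>f\<in>hom ?F ?F. \<forall>j\<in>{1..n}. f (?x j) = ?t j"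
    by (rule free_grp_universal[OF group_free_grp]) (simp split: if_splits)
  then obtain f where f: "f \<in> hom ?F ?F" "\<forall>j\<in>{1..n}. f (?x j) = ?t j" by blast
  have "\<exists>h\<in>hom ?F ?F. \<forall>j\<in>{1..n}. h (?x j) = ?u j"
    by (rule free_grp_universal[OF group_free_grp]) (simp split: if_splits)
  then obtain h where h: "h \<in> hom ?F ?F" "\<forall>j\<in>{1..n}. h (?x j) = ?u j" by blast
  interpret f: group_hom ?F ?F f by unfold_locales (rule f)
  interpret h: group_hom ?F ?F h by unfold_locales (rule h)
  have f_x: "f (?x i) = ?x (Suc i)"
    "f (?x (Suc i)) = inv\<^bsub>?F\<^esub> (?x (Suc i)) \<otimes>\<^bsub>?F\<^esub> ?x i \<otimes>\<^bsub>?F\<^esub> ?x (Suc i)"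
    "\<And>j. j \<in> {1..n} \<Longrightarrow> j \<noteq> i \<Longrightarrow> j \<noteq> Suc i \<Longrightarrow> f (?x j) = ?x j"
    using f(2) i by auto
  have h_x: "h (?x (Suc i)) = ?x i"
    "h (?x i) = ?x i \<otimes>\<^bsub>?F\<^esub> ?x (Suc i) \<otimes>\<^bsub>?F\<^esub> inv\<^bsub>?F\<^esub> (?x i)"
    "\<And>j. j \<in> {1..n} \<Longrightarrow> j \<noteq> i \<Longrightarrow> j \<noteq> Suc i \<Longrightarrow> h (?x j) = ?x j"
    using h(2) i by auto
  have fh: "f (h y) = y" if "y \<in> carrier ?F" for y
  proof -
    have "(f \<circ> h) y = y"
    proof (rule free_grp_hom_unique[OF group_free_grp _ id_hom[OF group_free_grp] _ that])
      show "(f \<circ> h) (?x j) = ?x j" if "j \<in> {1..n}" for j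
        using that by (cases "j = i"; cases "j = Suc i") (simp_all add: f_x h_x m_assoc)
    qed (simp_all add: hom_def)
    then show ?thesis by simp
  qed
  have hf: "h (f y) = y" if "y \<in> carrier ?F" for y
  proof -
    have "(h \<circ> f) y = y"
    proof (rule free_grp_hom_unique[OF group_free_grp _ id_hom[OF group_free_grp] _ that])
      show "(h \<circ> f) (?x j) = ?x j" if "j \<in> {1..n}" for j
        using that by (cases "j = i"; cases "j = Suc i") (simp_all add: f_x h_x m_assoc)
    qed (simp_all add: hom_def)
    then show ?thesis by simp
  qed
  have "restrict f (carrier ?F) \<in> auto ?F" by (rule autoI[OF f(1) h(1) fh hf])
  then show ?thesis
    by (intro bexI[of _ "restrict f (carrier ?F)"]) (use i in \<open>auto simp: f_x\<close>)
qed

text \<open>The description on generators by which the Artin action is chosen.\<close>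

definition artin_action_spec :: "nat \<Rightarrow> (nat word set \<Rightarrow> nat word set \<Rightarrow> nat word set) \<Rightarrow> bool" where
  "artin_action_spec n \<theta> \<longleftrightarrow> \<theta> \<in> hom (braid_grp n) (AutoGroup (free_grp n)) \<and>
     (\<forall>i\<in>{1..<n}.
        \<theta> (braid_gen n i) (free_gen n i) = free_gen n (i + 1) \<and>
        \<theta> (braid_gen n i) (free_gen n (i + 1)) =
          inv\<^bsub>free_grp n\<^esub> (free_gen n (i + 1)) \<otimes>\<^bsub>free_grp n\<^esub> free_gen n i
            \<otimes>\<^bsub>free_grp n\<^esub> free_gen n (i + 1) \<and>
        (\<forall>j\<in>{1..n} - {i, i + 1}. \<theta> (braid_gen n i) (free_gen n j) = free_gen n j))"

text \<open>Automorphisms of a free group agree once they agree on the generators, so the braid relations reduce to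
  word identities in at most three (for commutation, four) moved generators.\<close>

lemma artin_action_exists: "\<exists>\<theta>. artin_action_spec n \<theta>"
proof -
  interpret group "free_grp n" by (rule group_free_grp)
  let ?F = "free_grp n" and ?x = "free_gen n"
  obtain t where t: "\<And>i. i \<in> {1..<n} \<Longrightarrow> t i \<in> auto ?F \<and> t i (?x i) = ?x (i + 1) \<and>
      t i (?x (i + 1)) = inv\<^bsub>?F\<^esub> (?x (i + 1)) \<otimes>\<^bsub>?F\<^esub> ?x i \<otimes>\<^bsub>?F\<^esub> ?x (i + 1) \<and>
      (\<forall>j\<in>{1..n} - {i, i + 1}. t i (?x j) = ?x j)"
    using artin_automorphism[of _ n] by metis
  have auto: "t i \<in> auto ?F" if "i \<in> {1..<n}" for i using t that by blast
  then have hom: "t i \<in> hom ?F ?F" if "i \<in> {1..<n}" for i using that by (auto simp: auto_def)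
  have t_x: "t i (?x i) = ?x (Suc i)"
    "t i (?x (Suc i)) = inv\<^bsub>?F\<^esub> (?x (Suc i)) \<otimes>\<^bsub>?F\<^esub> ?x i \<otimes>\<^bsub>?F\<^esub> ?x (Suc i)"
    "\<And>j. j \<in> {1..n} \<Longrightarrow> j \<noteq> i \<Longrightarrow> j \<noteq> Suc i \<Longrightarrow> t i (?x j) = ?x j" if "i \<in> {1..<n}" for i
    using t that by auto
  have mult: "t i (a \<otimes>\<^bsub>?F\<^esub> b) = t i a \<otimes>\<^bsub>?F\<^esub> t i b" if "i \<in> {1..<n}" "a \<in> carrier ?F" "b \<in> carrier ?F" for i a b
    using hom_mult[OF hom] that by auto
  have inv: "t i (inv\<^bsub>?F\<^esub> a) = inv\<^bsub>?F\<^esub> (t i a)" if "i \<in> {1..<n}" "a \<in> carrier ?F" for i a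
    using group_hom.hom_inv[of ?F ?F "t i" a] hom that
    by (simp add: group_hom_def group_hom_axioms_def group_axioms)
  have closed: "t i a \<in> carrier ?F" if "i \<in> {1..<n}" "a \<in> carrier ?F" for i a
    using hom that by (auto simp: hom_def)
  interpret A: group "AutoGroup ?F" by (rule AutoGroup)
  have Amult: "f \<otimes>\<^bsub>AutoGroup ?F\<^esub> h \<in> auto ?F" if "f \<in> auto ?F" "h \<in> auto ?F" for f h
    using A.m_closed that by (simp add: AutoGroup_carrier)
  have "\<exists>\<theta>\<in>hom (braid_grp n) (AutoGroup ?F). \<forall>i\<in>{1..<n}. \<theta> (braid_gen n i) = t i"
  proof (rule braid_grp_universal[OF AutoGroup])
    fix i assume i: "i \<in> {1..<n}" "i + 1 \<in> {1..<n}"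
    then have i': "Suc i \<in> {1..<n}" "i \<in> {1..n}" "Suc i \<in> {1..n}" "Suc (Suc i) \<in> {1..n}" by auto
    have x [simp]: "?x i \<in> carrier ?F" "?x (Suc i) \<in> carrier ?F" "?x (Suc (Suc i)) \<in> carrier ?F"
      using i'(2-4) by (simp_all only: free_gen_closed)
    show "t i \<otimes>\<^bsub>AutoGroup ?F\<^esub> t (i + 1) \<otimes>\<^bsub>AutoGroup ?F\<^esub> t i
        = t (i + 1) \<otimes>\<^bsub>AutoGroup ?F\<^esub> t i \<otimes>\<^bsub>AutoGroup ?F\<^esub> t (i + 1)"
    proof (rule auto_free_grp_eqI)
      fix j assume j: "j \<in> {1..n}"
      then have xj: "?x j \<in> carrier ?F" by simp
      have "t i (t (Suc i) (t i (?x j))) = t (Suc i) (t i (t (Suc i) (?x j)))"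
      proof -
        consider "j = i" | "j = Suc i" | "j = Suc (Suc i)"
          | "j \<noteq> i" "j \<noteq> Suc i" "j \<noteq> Suc (Suc i)" by blast
        then show ?thesis
          by cases (use i i' j in \<open>simp_all add: t_x mult inv closed inv_mult_group m_assoc
            del: One_nat_def atLeastAtMost_iff atLeastLessThan_iff\<close>)
      qed
      then show "(t i \<otimes>\<^bsub>AutoGroup ?F\<^esub> t (i + 1) \<otimes>\<^bsub>AutoGroup ?F\<^esub> t i) (?x j)
          = (t (i + 1) \<otimes>\<^bsub>AutoGroup ?F\<^esub> t i \<otimes>\<^bsub>AutoGroup ?F\<^esub> t (i + 1)) (?x j)"
        using i xj closed[of i] closed[of "Suc i"]
        by (simp add: AutoGroup_apply auto Amult)
    qed (use auto i in \<open>auto intro!: Amult\<close>)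
  next
    fix i k assume i: "i \<in> {1..<n}" "k \<in> {1..<n}" "i + 2 \<le> k"
    then have i': "i \<in> {1..n}" "Suc i \<in> {1..n}" "k \<in> {1..n}" "Suc k \<in> {1..n}" by auto
    have x [simp]: "?x i \<in> carrier ?F" "?x (Suc i) \<in> carrier ?F" "?x k \<in> carrier ?F"
      "?x (Suc k) \<in> carrier ?F"
      using i' by (simp_all only: free_gen_closed)
    show "t i \<otimes>\<^bsub>AutoGroup ?F\<^esub> t k = t k \<otimes>\<^bsub>AutoGroup ?F\<^esub> t i"
    proof (rule auto_free_grp_eqI)
      fix j assume j: "j \<in> {1..n}"
      then have xj: "?x j \<in> carrier ?F" by simp
      have "t i (t k (?x j)) = t k (t i (?x j))"
      proof -
        consider "j = i" | "j = Suc i" | "j = k" | "j = Suc k"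
          | "j \<noteq> i" "j \<noteq> Suc i" "j \<noteq> k" "j \<noteq> Suc k" by blast
        then show ?thesis
          by cases (use i i' j in \<open>simp_all add: t_x mult inv closed inv_mult_group m_assoc
            del: One_nat_def atLeastAtMost_iff atLeastLessThan_iff\<close>)
      qed
      then show "(t i \<otimes>\<^bsub>AutoGroup ?F\<^esub> t k) (?x j) = (t k \<otimes>\<^bsub>AutoGroup ?F\<^esub> t i) (?x j)"
        using i xj closed[of i] closed[of k]
        by (simp add: AutoGroup_apply auto Amult)
    qed (use auto i in \<open>auto intro!: Amult\<close>)
  qed (auto simp: AutoGroup_carrier auto)
  then obtain \<theta> where th: "\<theta> \<in> hom (braid_grp n) (AutoGroup ?F)"
    "\<forall>i\<in>{1..<n}. \<theta> (braid_gen n i) = t i" by blast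
  have "artin_action_spec n \<theta>"
    unfolding artin_action_spec_def using th t by simp
  then show ?thesis by blast
qed

lemma artin_action_spec: "artin_action_spec n (artin_action n)"
proof -
  have "artin_action n = (SOME \<theta>. artin_action_spec n \<theta>)"
    unfolding artin_action_def artin_action_spec_def ..
  then show ?thesis using artin_action_exists[of n] by (metis someI_ex)
qed

section \<open>Vector spaces and algebras over a field type\<close>

text \<open>Scalars form a type and vectors a carrier set, which matches the records \<open>vpower\<close>, \<open>quot_space\<close> and
  \<open>free_alg\<close>.\<close>

locale kspace = abelian_group M for M :: "('k::field, 'a) module" (structure) +
  assumes smult_closed [simp]: "x \<in> carrier M \<Longrightarrow> a \<odot> x \<in> carrier M"
    and smult_r_distr: "x \<in> carrier M \<Longrightarrow> y \<in> carrier M \<Longrightarrow> a \<odot> (x \<oplus> y) = a \<odot> x \<oplus> a \<odot> y"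
    and smult_l_distr: "x \<in> carrier M \<Longrightarrow> (a + b) \<odot> x = a \<odot> x \<oplus> b \<odot> x"
    and smult_assoc: "x \<in> carrier M \<Longrightarrow> (a * b) \<odot> x = a \<odot> (b \<odot> x)"
    and smult_one [simp]: "x \<in> carrier M \<Longrightarrow> 1 \<odot> x = x"
begin

lemma smult_zero_l [simp]: "x \<in> carrier M \<Longrightarrow> 0 \<odot> x = \<zero>"
  using smult_l_distr[of x 0 0] by simp

lemma smult_zero_r [simp]: "a \<odot> \<zero> = \<zero>"
  using smult_r_distr[of \<zero> \<zero> a] by simp

lemma smult_minus: "x \<in> carrier M \<Longrightarrow> (- a) \<odot> x = \<ominus> (a \<odot> x)"
  using smult_l_distr[of x "- a" a] by (intro minus_equality[symmetric]) auto

lemma smult_minus_one: "x \<in> carrier M \<Longrightarrow> (- 1) \<odot> x = \<ominus> x"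
  using smult_minus[of x 1] by simp

lemma smult_minus_r: "x \<in> carrier M \<Longrightarrow> a \<odot> (\<ominus> x) = \<ominus> (a \<odot> x)"
  using smult_assoc[of x a "-1"] smult_assoc[of x "-1" a]
  by (simp add: smult_minus_one)

lemma smult_diff: "x \<in> carrier M \<Longrightarrow> y \<in> carrier M \<Longrightarrow> a \<odot> (x \<ominus> y) = a \<odot> x \<ominus> a \<odot> y"
  by (simp add: a_minus_def smult_r_distr smult_minus_r)

end

locale kalgebra = kspace A + ring A for A :: "('k::field, 'a) module" (structure) +
  assumes smult_mult_l: "x \<in> carrier A \<Longrightarrow> y \<in> carrier A \<Longrightarrow> (a \<odot> x) \<otimes> y = a \<odot> (x \<otimes> y)"
    and smult_mult_r: "x \<in> carrier A \<Longrightarrow> y \<in> carrier A \<Longrightarrow> x \<otimes> (a \<odot> y) = a \<odot> (x \<otimes> y)"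

locale ksubspace = kspace M + additive_subgroup U M
  for U and M :: "('k::field, 'a) module" (structure) +
  assumes smult_mem: "x \<in> U \<Longrightarrow> a \<odot> x \<in> U"
begin

lemma abelian_subgroup: "abelian_subgroup U M"
  by (rule abelian_subgroupI3[OF additive_subgroup_axioms abelian_group_axioms])

end

sublocale ksubspace \<subseteq> abelian_subgroup U M
  by (rule abelian_subgroup)

context ksubspace
begin

lemma coset_eq_iff:
  assumes "x \<in> carrier M" "y \<in> carrier M"
  shows "U +> x = U +> y \<longleftrightarrow> x \<ominus> y \<in> U"
proof -
  have "U +> x = U +> y \<longleftrightarrow> x \<in> U +> y"
    using assms a_rcos_self a_repr_independence' by metis
  then show ?thesis using assms by (simp add: a_rcos_module a_minus_def)
qed

lemma cosets_cases:
  assumes "X \<in> a_rcosets U" obtains x where "x \<in> carrier M" "X = U +> x"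
  using assms by (auto simp: A_RCOSETS_def')

lemma coset_mem_diff: "x \<in> carrier M \<Longrightarrow> w \<in> U +> x \<Longrightarrow> w \<in> carrier M \<and> w \<ominus> x \<in> U"
  using a_elemrcos_carrier a_rcos_module_imp by (simp add: a_minus_def)

lemma UN_coset:
  assumes x: "x \<in> carrier M"
    and f: "\<And>w. w \<in> carrier M \<Longrightarrow> f w \<in> carrier M"
    and d: "\<And>w. w \<in> carrier M \<Longrightarrow> w \<ominus> x \<in> U \<Longrightarrow> f w \<ominus> f x \<in> U"
  shows "(\<Union>w\<in>U +> x. U +> f w) = U +> f x"
proof -
  have "U +> f w = U +> f x" if "w \<in> U +> x" for w
    using coset_mem_diff[OF x that] f d x by (simp add: coset_eq_iff)
  then show ?thesis using a_rcos_self[OF x] by blast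
qed

lemma quot_smult_coset: "x \<in> carrier M \<Longrightarrow> quot_smult M U a (U +> x) = U +> (a \<odot> x)"
  unfolding quot_smult_def
  by (rule UN_coset) (simp_all add: smult_diff[symmetric] smult_mem)

text \<open>Stated for any record with the right additive structure, so that it serves both quotient spaces and
  quotient algebras.\<close>

lemma kspace_quotient:
  fixes Q :: "('k, 'a set) module"
  assumes Q: "carrier Q = a_rcosets U" "zero Q = U" "add Q = set_add M" "module.smult Q = quot_smult M U"
  shows "kspace Q"
proof -
  have "abelian_group Q"
  proof (rule abelian_groupI)
    show "x \<oplus>\<^bsub>Q\<^esub> y \<in> carrier Q" if "x \<in> carrier Q" "y \<in> carrier Q" for x y
      using that by (auto simp: Q a_rcos_sum a_rcosetsI a_subset elim!: cosets_cases)
    show "\<zero>\<^bsub>Q\<^esub> \<in> carrier Q" by (simp add: Q a_subgroup_in_rcosets)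
    show "\<exists>y\<in>carrier Q. y \<oplus>\<^bsub>Q\<^esub> x = \<zero>\<^bsub>Q\<^esub>" if "x \<in> carrier Q" for x
    proof -
      from that obtain v where v: "v \<in> carrier M" "x = U +> v" by (auto simp: Q elim!: cosets_cases)
      then have "(U +> (\<ominus> v)) \<oplus>\<^bsub>Q\<^esub> x = \<zero>\<^bsub>Q\<^esub>" by (simp add: Q a_rcos_sum l_neg a_coset_add_zero[OF a_subset])
      then show ?thesis using v by (auto simp: Q a_rcosetsI a_subset)
    qed
    show "\<zero>\<^bsub>Q\<^esub> \<oplus>\<^bsub>Q\<^esub> x = x" if "x \<in> carrier Q" for x
      using that by (auto simp: Q rcosets_add_eq)
  qed (auto simp: Q a_rcos_sum a_ac elim!: cosets_cases)
  then interpret Q: abelian_group Q .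
  show ?thesis
    by unfold_locales
      (auto simp: Q quot_smult_coset a_rcos_sum a_rcosetsI a_subset smult_r_distr smult_l_distr
        smult_assoc elim!: cosets_cases)
qed

lemma kspace_quot_space: "kspace (quot_space M U)"
  by (rule kspace_quotient) (simp_all add: quot_space_def)

end

subsection \<open>Endomorphism algebras\<close>

lemma End_alg_carrier:
  "f \<in> carrier (End_alg M) \<longleftrightarrow> f \<in> carrier M \<rightarrow>\<^sub>E carrier M \<and>
    (\<forall>u\<in>carrier M. \<forall>v\<in>carrier M. f (u \<oplus>\<^bsub>M\<^esub> v) = f u \<oplus>\<^bsub>M\<^esub> f v) \<and>
    (\<forall>a. \<forall>v\<in>carrier M. f (a \<odot>\<^bsub>M\<^esub> v) = a \<odot>\<^bsub>M\<^esub> f v)"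
  by (simp add: End_alg_def)

lemma End_alg_eqI:
  assumes "f \<in> carrier (End_alg M)" "h \<in> carrier (End_alg M)"
    and "\<And>v. v \<in> carrier M \<Longrightarrow> f v = h v"
  shows "f = h"
  using assms by (intro extensionalityI[where A = "carrier M"]) (auto simp: End_alg_carrier PiE_iff)

lemma End_alg_apply:
  "v \<in> carrier M \<Longrightarrow> (f \<otimes>\<^bsub>End_alg M\<^esub> h) v = f (h v)"
  "v \<in> carrier M \<Longrightarrow> \<one>\<^bsub>End_alg M\<^esub> v = v"
  "v \<in> carrier M \<Longrightarrow> \<zero>\<^bsub>End_alg M\<^esub> v = \<zero>\<^bsub>M\<^esub>"
  "v \<in> carrier M \<Longrightarrow> (f \<oplus>\<^bsub>End_alg M\<^esub> h) v = f v \<oplus>\<^bsub>M\<^esub> h v"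
  "v \<in> carrier M \<Longrightarrow> (a \<odot>\<^bsub>End_alg M\<^esub> f) v = a \<odot>\<^bsub>M\<^esub> f v"
  by (simp_all add: End_alg_def compose_eq)

lemma End_alg_closed: "f \<in> carrier (End_alg M) \<Longrightarrow> v \<in> carrier M \<Longrightarrow> f v \<in> carrier M"
  by (auto simp: End_alg_carrier)

context kspace
begin

lemma End_alg_closures:
  "\<one>\<^bsub>End_alg M\<^esub> \<in> carrier (End_alg M)"
  "\<zero>\<^bsub>End_alg M\<^esub> \<in> carrier (End_alg M)"
  "f \<in> carrier (End_alg M) \<Longrightarrow> h \<in> carrier (End_alg M) \<Longrightarrow> f \<otimes>\<^bsub>End_alg M\<^esub> h \<in> carrier (End_alg M)"
  "f \<in> carrier (End_alg M) \<Longrightarrow> h \<in> carrier (End_alg M) \<Longrightarrow> f \<oplus>\<^bsub>End_alg M\<^esub> h \<in> carrier (End_alg M)"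
  "f \<in> carrier (End_alg M) \<Longrightarrow> a \<odot>\<^bsub>End_alg M\<^esub> f \<in> carrier (End_alg M)"
proof -
  show "\<one>\<^bsub>End_alg M\<^esub> \<in> carrier (End_alg M)" "\<zero>\<^bsub>End_alg M\<^esub> \<in> carrier (End_alg M)"
    by (auto simp: End_alg_def)
  assume f: "f \<in> carrier (End_alg M)"
  show "a \<odot>\<^bsub>End_alg M\<^esub> f \<in> carrier (End_alg M)"
  proof -
    have "a \<odot>\<^bsub>End_alg M\<^esub> f \<in> extensional (carrier M)" by (simp add: End_alg_def)
    then show ?thesis
      using f by (simp add: End_alg_carrier[of _ M] End_alg_apply PiE_iff smult_r_distr
        smult_assoc[symmetric] mult.commute)
  qed
  assume h: "h \<in> carrier (End_alg M)"
  have "f \<otimes>\<^bsub>End_alg M\<^esub> h \<in> extensional (carrier M)" by (simp add: End_alg_def compose_def)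
  then show "f \<otimes>\<^bsub>End_alg M\<^esub> h \<in> carrier (End_alg M)"
    using f h by (simp add: End_alg_carrier[of _ M] End_alg_apply PiE_iff)
  have "f \<oplus>\<^bsub>End_alg M\<^esub> h \<in> extensional (carrier M)" by (simp add: End_alg_def)
  then show "f \<oplus>\<^bsub>End_alg M\<^esub> h \<in> carrier (End_alg M)"
    using f h by (simp add: End_alg_carrier[of _ M] End_alg_apply PiE_iff smult_r_distr a_ac)
qed

lemma kalgebra_End_alg: "kalgebra (End_alg M)"
proof -
  let ?E = "End_alg M"
  note closed = End_alg_closures End_alg_closed
  have lin: "f (u \<oplus> v) = f u \<oplus> f v" "f (a \<odot> v) = a \<odot> f v"
    if "f \<in> carrier ?E" "u \<in> carrier M" "v \<in> carrier M" for f u v a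
    using that by (simp_all add: End_alg_carrier)
  have ab: "abelian_group ?E"
  proof (rule abelian_groupI)
    fix f assume f: "f \<in> carrier ?E"
    have "(- 1) \<odot>\<^bsub>?E\<^esub> f \<oplus>\<^bsub>?E\<^esub> f = \<zero>\<^bsub>?E\<^esub>"
      by (rule End_alg_eqI[where M = M]) (use f in \<open>simp_all add: closed End_alg_apply smult_minus_one l_neg\<close>)
    then show "\<exists>h\<in>carrier ?E. h \<oplus>\<^bsub>?E\<^esub> f = \<zero>\<^bsub>?E\<^esub>"
      using f closed by blast
  qed (auto intro!: End_alg_eqI[where M = M] simp: closed End_alg_apply a_ac)
  have ring: "ring ?E"
  proof (rule ringI[OF ab])
    show "monoid ?E"
      by (rule monoidI) (auto intro!: End_alg_eqI[where M = M] simp: closed End_alg_apply)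
  qed (auto intro!: End_alg_eqI[where M = M] simp: closed End_alg_apply lin)
  interpret ring ?E by (rule ring)
  show ?thesis
    by unfold_locales
      (auto intro!: End_alg_eqI[where M = M] simp: closed End_alg_apply lin smult_r_distr smult_l_distr smult_assoc)
qed

lemma group_GL: "group (GL M)"
proof -
  interpret E: kalgebra "End_alg M" by (rule kalgebra_End_alg)
  show ?thesis unfolding GL_def by (rule E.units_group)
qed

lemma GL_carrierI:
  assumes "f \<in> carrier (End_alg M)" "h \<in> carrier (End_alg M)"
    and "\<And>v. v \<in> carrier M \<Longrightarrow> f (h v) = v" "\<And>v. v \<in> carrier M \<Longrightarrow> h (f v) = v"
  shows "f \<in> carrier (GL M)"
proof -
  have "f \<otimes>\<^bsub>End_alg M\<^esub> h = \<one>\<^bsub>End_alg M\<^esub>" "h \<otimes>\<^bsub>End_alg M\<^esub> f = \<one>\<^bsub>End_alg M\<^esub>"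
    using assms by (auto intro!: End_alg_eqI[where M = M] simp: End_alg_closures End_alg_apply)
  then show ?thesis using assms(1,2) by (auto simp: GL_def units_of_def Units_def)
qed

end

lemma GL_mult: "f \<otimes>\<^bsub>GL M\<^esub> h = f \<otimes>\<^bsub>End_alg M\<^esub> h"
  by (simp add: GL_def units_of_def)

lemma GL_carrier_End: "f \<in> carrier (GL M) \<Longrightarrow> f \<in> carrier (End_alg M)"
  by (simp add: GL_def units_of_def Units_def)

subsection \<open>Endomorphisms induced on a quotient\<close>

text \<open>The form in which the quotient representation acts: the union is over all representatives of a coset, and
  collapses to a single coset when \<open>f\<close> preserves \<open>U\<close>.\<close>

definition induced :: "('k::field, 'a) module \<Rightarrow> 'a set \<Rightarrow> ('a \<Rightarrow> 'a) \<Rightarrow> 'a set \<Rightarrow> 'a set" where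
  "induced M U f = (\<lambda>X\<in>carrier (quot_space M U). \<Union>w\<in>X. U +>\<^bsub>M\<^esub> f w)"

context ksubspace
begin

text \<open>The endomorphisms that descend to the quotient by \<open>U\<close>.\<close>

definition preserving :: "('a \<Rightarrow> 'a) set" where
  "preserving = {f \<in> carrier (End_alg M). f ` U \<subseteq> U}"

lemma quot_space_carrier: "carrier (quot_space M U) = a_rcosets U"
  by (simp add: quot_space_def)

lemma preserving_diff:
  assumes "f \<in> preserving" "x \<in> carrier M" "y \<in> carrier M"
  shows "f (x \<ominus> y) = f x \<ominus> f y"
proof -
  have "f (\<ominus> y) = \<ominus> f y"
    using assms by (simp add: preserving_def End_alg_carrier smult_minus_one[symmetric] PiE_iff)
  then show ?thesis using assms by (simp add: preserving_def End_alg_carrier a_minus_def)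
qed

lemma induced_coset:
  assumes f: "f \<in> preserving" and x: "x \<in> carrier M"
  shows "induced M U f (U +> x) = U +> f x"
proof -
  have "(\<Union>w\<in>U +> x. U +> f w) = U +> f x"
    by (rule UN_coset[OF x])
      (use f x in \<open>auto simp: preserving_diff[symmetric] preserving_def End_alg_closed\<close>)
  then show ?thesis using x by (simp add: induced_def quot_space_carrier a_rcosetsI a_subset)
qed

lemma induced_closed:
  assumes f: "f \<in> preserving"
  shows "induced M U f \<in> carrier (End_alg (quot_space M U))"
proof -
  have ext: "induced M U f \<in> extensional (carrier (quot_space M U))" by (simp add: induced_def)
  have fc: "f x \<in> carrier M" if "x \<in> carrier M" for x
    using f that by (simp add: preserving_def End_alg_closed)
  have lin: "f (x \<oplus> y) = f x \<oplus> f y" "f (a \<odot> x) = a \<odot> f x"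
    if "x \<in> carrier M" "y \<in> carrier M" for x y a
    using f that by (simp_all add: preserving_def End_alg_carrier)
  show ?thesis
    unfolding End_alg_carrier PiE_iff using ext
    by (auto simp: quot_space_def a_rcosetsI a_subset induced_coset[OF f] fc a_rcos_sum lin
      quot_smult_coset elim!: cosets_cases)
qed

lemma End_quot_eqI:
  assumes "F \<in> carrier (End_alg (quot_space M U))" "H \<in> carrier (End_alg (quot_space M U))"
    and "\<And>x. x \<in> carrier M \<Longrightarrow> F (U +> x) = H (U +> x)"
  shows "F = H"
  using assms(3) by (intro End_alg_eqI[OF assms(1,2)]) (auto simp: quot_space_carrier elim!: cosets_cases)

end

section \<open>Algebras given by generators and relations\<close>

lemma alg_hom_simps:
  assumes "h \<in> alg_hom A B"
  shows "x \<in> carrier A \<Longrightarrow> h x \<in> carrier B"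
    and "x \<in> carrier A \<Longrightarrow> y \<in> carrier A \<Longrightarrow> h (x \<otimes>\<^bsub>A\<^esub> y) = h x \<otimes>\<^bsub>B\<^esub> h y"
    and "x \<in> carrier A \<Longrightarrow> y \<in> carrier A \<Longrightarrow> h (x \<oplus>\<^bsub>A\<^esub> y) = h x \<oplus>\<^bsub>B\<^esub> h y"
    and "h \<one>\<^bsub>A\<^esub> = \<one>\<^bsub>B\<^esub>"
    and "x \<in> carrier A \<Longrightarrow> h (a \<odot>\<^bsub>A\<^esub> x) = a \<odot>\<^bsub>B\<^esub> h x"
  using assms by (auto simp: alg_hom_def ring_hom_def)

lemma alg_hom_minus:
  assumes "kalgebra A" "kalgebra B" "h \<in> alg_hom A B"
  shows "h \<zero>\<^bsub>A\<^esub> = \<zero>\<^bsub>B\<^esub>"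
    and "x \<in> carrier A \<Longrightarrow> y \<in> carrier A \<Longrightarrow> h (x \<ominus>\<^bsub>A\<^esub> y) = h x \<ominus>\<^bsub>B\<^esub> h y"
proof -
  interpret A: kalgebra A by fact
  interpret B: kalgebra B by fact
  note h = alg_hom_simps[OF assms(3)]
  show "h \<zero>\<^bsub>A\<^esub> = \<zero>\<^bsub>B\<^esub>" using h(5)[of "\<zero>\<^bsub>A\<^esub>" 0] h(1) by simp
  show "h (x \<ominus>\<^bsub>A\<^esub> y) = h x \<ominus>\<^bsub>B\<^esub> h y" if "x \<in> carrier A" "y \<in> carrier A"
    using that by (simp add: h a_minus_def A.smult_minus_one[symmetric] B.smult_minus_one[symmetric])
qed

lemma alg_hom_comp:
  assumes f: "f \<in> alg_hom A B" and h: "h \<in> alg_hom B C"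
  shows "h \<circ> f \<in> alg_hom A C"
  unfolding alg_hom_def
  by (auto intro!: ring_hom_memI simp: alg_hom_simps[OF f] alg_hom_simps[OF h])

subsection \<open>The free algebra\<close>

lemma free_alg_simps:
  "f \<in> carrier (free_alg S) \<longleftrightarrow> finite {w. f w \<noteq> 0} \<and> (\<forall>w. f w \<noteq> 0 \<longrightarrow> w \<in> lists S)"
  "f \<otimes>\<^bsub>free_alg S\<^esub> h = (\<lambda>w. \<Sum>i\<le>length w. f (take i w) * h (drop i w))"
  "\<one>\<^bsub>free_alg S\<^esub> = (\<lambda>w. if w = [] then 1 else 0)"
  "\<zero>\<^bsub>free_alg S\<^esub> = (\<lambda>_. 0)"
  "f \<oplus>\<^bsub>free_alg S\<^esub> h = (\<lambda>w. f w + h w)"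
  "a \<odot>\<^bsub>free_alg S\<^esub> f = (\<lambda>w. a * f w)"
  by (simp_all add: free_alg_def)

lemma free_alg_mult_closed:
  assumes f: "f \<in> carrier (free_alg S)" and h: "h \<in> carrier (free_alg S)"
  shows "f \<otimes>\<^bsub>free_alg S\<^esub> h \<in> carrier (free_alg S)"
proof -
  let ?p = "f \<otimes>\<^bsub>free_alg S\<^esub> h"
  have split: "\<exists>i. f (take i w) \<noteq> 0 \<and> h (drop i w) \<noteq> 0" if "?p w \<noteq> 0" for w
  proof -
    have "(\<Sum>i\<le>length w. f (take i w) * h (drop i w)) \<noteq> 0" using that by (simp add: free_alg_simps)
    then obtain i where "f (take i w) * h (drop i w) \<noteq> 0"
      by (rule sum.not_neutral_contains_not_neutral)
    then show ?thesis by auto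
  qed
  have "{w. ?p w \<noteq> 0} \<subseteq> (\<lambda>(u, v). u @ v) ` ({w. f w \<noteq> 0} \<times> {w. h w \<noteq> 0})"
  proof
    fix w assume "w \<in> {w. ?p w \<noteq> 0}"
    then obtain i where "f (take i w) \<noteq> 0" "h (drop i w) \<noteq> 0" using split by blast
    then show "w \<in> (\<lambda>(u, v). u @ v) ` ({w. f w \<noteq> 0} \<times> {w. h w \<noteq> 0})"
      by (intro image_eqI[of _ _ "(take i w, drop i w)"]) auto
  qed
  moreover have "finite ((\<lambda>(u, v). u @ v) ` ({w. f w \<noteq> 0} \<times> {w. h w \<noteq> 0}))"
    using f h by (simp add: free_alg_simps(1))
  ultimately have "finite {w. ?p w \<noteq> 0}" by (rule finite_subset)
  moreover have "w \<in> lists S" if nz: "?p w \<noteq> 0" for w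
  proof -
    obtain i where "f (take i w) \<noteq> 0" "h (drop i w) \<noteq> 0" using split[OF nz] by blast
    then have "take i w \<in> lists S" "drop i w \<in> lists S" using f h by (auto simp: free_alg_simps(1))
    then have "take i w @ drop i w \<in> lists S" by (simp only: append_in_lists_conv)
    then show ?thesis by simp
  qed
  ultimately show ?thesis by (simp add: free_alg_simps(1))
qed

text \<open>Both sides sum over the ways of cutting a word into three pieces, indexed once by the end of the second
  piece and once by its length.\<close>

lemma free_alg_mult_assoc:
  "(f \<otimes>\<^bsub>free_alg S\<^esub> h) \<otimes>\<^bsub>free_alg S\<^esub> k = f \<otimes>\<^bsub>free_alg S\<^esub> (h \<otimes>\<^bsub>free_alg S\<^esub> k)"
proof
  fix w :: "'a list"
  let ?F = "\<lambda>j m. f (take j w) * h (take m (drop j w)) * k (drop (j + m) w)"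
  have "((f \<otimes>\<^bsub>free_alg S\<^esub> h) \<otimes>\<^bsub>free_alg S\<^esub> k) w = (\<Sum>i\<le>length w. \<Sum>j\<le>i. ?F j (i - j))"
    by (auto simp: free_alg_simps sum_distrib_right drop_take min_def intro!: sum.cong)
  also have "\<dots> = (\<Sum>(j, m)\<in>{(j, m). j + m \<le> length w}. ?F j m)"
    by (rule sum.triangle_reindex_eq[symmetric])
  also have "{(j, m). j + m \<le> length w} = (SIGMA j:{..length w}. {..length w - j})"
    by auto
  also have "(\<Sum>(j, m)\<in>\<dots>. ?F j m) = (\<Sum>j\<le>length w. \<Sum>m\<le>length w - j. ?F j m)"
    by (rule sum.Sigma[symmetric]) auto
  also have "\<dots> = (f \<otimes>\<^bsub>free_alg S\<^esub> (h \<otimes>\<^bsub>free_alg S\<^esub> k)) w"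
    by (auto simp: free_alg_simps sum_distrib_left mult.assoc add.commute intro!: sum.cong)
  finally show "((f \<otimes>\<^bsub>free_alg S\<^esub> h) \<otimes>\<^bsub>free_alg S\<^esub> k) w
    = (f \<otimes>\<^bsub>free_alg S\<^esub> (h \<otimes>\<^bsub>free_alg S\<^esub> k)) w" .
qed

definition monom_word :: "'a list \<Rightarrow> 'a list \<Rightarrow> 'k::field" where
  "monom_word u = (\<lambda>w. if w = u then 1 else 0)"

lemma free_alg_monom_mult:
  "monom_word u \<otimes>\<^bsub>free_alg S\<^esub> monom_word v = monom_word (u @ v)"
proof
  fix w
  have *: "monom_word u (take i w) * monom_word v (drop i w)
      = (if i = length u \<and> w = u @ v then 1 else (0::'b))" if "i \<le> length w" for i
  proof -
    have iff: "take i w = u \<and> drop i w = v \<longleftrightarrow> i = length u \<and> w = u @ v"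
      using that by (auto simp: append_eq_conv_conj)
    have "monom_word u (take i w) * monom_word v (drop i w)
        = (if take i w = u \<and> drop i w = v then 1 else (0::'b))" by (simp add: monom_word_def)
    then show ?thesis by (simp only: iff)
  qed
  have "(monom_word u \<otimes>\<^bsub>free_alg S\<^esub> monom_word v) w
      = (\<Sum>i\<le>length w. if i = length u \<and> w = u @ v then 1 else (0::'b))"
    unfolding free_alg_simps by (rule sum.cong) (simp_all add: *)
  also have "\<dots> = monom_word (u @ v) w"
    by (cases "w = u @ v") (simp_all add: monom_word_def)
  finally show "(monom_word u \<otimes>\<^bsub>free_alg S\<^esub> monom_word v) w = (monom_word (u @ v) w :: 'b)" .
qed

lemma free_alg_mult_one:
  "\<one>\<^bsub>free_alg S\<^esub> \<otimes>\<^bsub>free_alg S\<^esub> f = f" "f \<otimes>\<^bsub>free_alg S\<^esub> \<one>\<^bsub>free_alg S\<^esub> = f"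
proof -
  show "\<one>\<^bsub>free_alg S\<^esub> \<otimes>\<^bsub>free_alg S\<^esub> f = f"
  proof
    fix w :: "'a list"
    have "(\<one>\<^bsub>free_alg S\<^esub> \<otimes>\<^bsub>free_alg S\<^esub> f) w = (\<Sum>i\<le>length w. if i = 0 then f w else 0)"
      unfolding free_alg_simps by (rule sum.cong) auto
    then show "(\<one>\<^bsub>free_alg S\<^esub> \<otimes>\<^bsub>free_alg S\<^esub> f) w = f w" by simp
  qed
  show "f \<otimes>\<^bsub>free_alg S\<^esub> \<one>\<^bsub>free_alg S\<^esub> = f"
  proof
    fix w :: "'a list"
    have "(f \<otimes>\<^bsub>free_alg S\<^esub> \<one>\<^bsub>free_alg S\<^esub>) w = (\<Sum>i\<le>length w. if i = length w then f w else 0)"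
      unfolding free_alg_simps by (rule sum.cong) auto
    then show "(f \<otimes>\<^bsub>free_alg S\<^esub> \<one>\<^bsub>free_alg S\<^esub>) w = f w" by simp
  qed
qed

lemma free_alg_add_closed:
  assumes "f \<in> carrier (free_alg S)" "h \<in> carrier (free_alg S)"
  shows "f \<oplus>\<^bsub>free_alg S\<^esub> h \<in> carrier (free_alg S)"
proof -
  have "{w. f w + h w \<noteq> 0} \<subseteq> {w. f w \<noteq> 0} \<union> {w. h w \<noteq> 0}" by auto
  then have "finite {w. f w + h w \<noteq> 0}"
    using assms by (auto simp: free_alg_simps intro: finite_subset)
  moreover have "w \<in> lists S" if "f w + h w \<noteq> 0" for w
    using that assms unfolding free_alg_simps(1) by (metis add_0)
  ultimately show ?thesis by (simp add: free_alg_simps)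
qed

lemma free_alg_smult_closed:
  assumes "f \<in> carrier (free_alg S)" shows "a \<odot>\<^bsub>free_alg S\<^esub> f \<in> carrier (free_alg S)"
  using assms by (auto simp: free_alg_simps intro: finite_subset[of _ "{w. f w \<noteq> 0}"])

lemma kalgebra_free_alg: "kalgebra (free_alg S :: ('k::field, _) module)"
proof -
  let ?A = "free_alg S :: ('k, _) module"
  have ab: "abelian_group ?A"
  proof (rule abelian_groupI)
    fix f assume f: "f \<in> carrier ?A"
    show "\<exists>h\<in>carrier ?A. h \<oplus>\<^bsub>?A\<^esub> f = \<zero>\<^bsub>?A\<^esub>"
      by (rule bexI[OF _ free_alg_smult_closed[OF f, of "-1"]]) (simp add: free_alg_simps)
  next
    show "\<zero>\<^bsub>?A\<^esub> \<in> carrier ?A" by (simp add: free_alg_simps)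
  qed (rule free_alg_add_closed, assumption+, simp_all add: free_alg_simps(2-) algebra_simps)
  have ring: "ring ?A"
  proof (rule ringI[OF ab])
    show "monoid ?A"
      by (rule monoidI)
        (simp_all add: free_alg_mult_closed free_alg_mult_assoc free_alg_mult_one, simp add: free_alg_simps)
  qed (simp_all add: free_alg_simps(2-) algebra_simps sum.distrib)
  interpret ring ?A by (rule ring)
  show ?thesis
    by unfold_locales (rule free_alg_smult_closed, assumption,
      simp_all add: free_alg_simps(2-) algebra_simps sum_distrib_left)
qed

lemma monom_word_closed: "u \<in> lists S \<Longrightarrow> monom_word u \<in> carrier (free_alg S)"
  by (auto simp: free_alg_simps monom_word_def)

lemma free_alg_gen_closed [simp]: "a \<in> S \<Longrightarrow> free_alg_gen a \<in> carrier (free_alg S)"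
  by (auto simp: free_alg_simps free_alg_gen_def)

lemma free_alg_induct [consumes 1, case_names zero add]:
  assumes f: "f \<in> carrier (free_alg S :: ('k::field, _) module)"
    and zero: "P \<zero>\<^bsub>free_alg S :: ('k, _) module\<^esub>"
    and add: "\<And>a u f. u \<in> lists S \<Longrightarrow> f \<in> carrier (free_alg S) \<Longrightarrow> P f \<Longrightarrow>
      P (a \<odot>\<^bsub>free_alg S\<^esub> monom_word u \<oplus>\<^bsub>free_alg S\<^esub> f)"
  shows "P f"
proof -
  have "finite {w. f w \<noteq> 0}" using f by (simp add: free_alg_simps(1))
  moreover have "P f" if "finite W" "f \<in> carrier (free_alg S)" "{w. f w \<noteq> 0} \<subseteq> W" for W and f :: "'a list \<Rightarrow> 'k"
    using that
  proof (induction W arbitrary: f)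
    case empty
    then have "f = \<zero>\<^bsub>free_alg S\<^esub>" by (auto simp: free_alg_simps)
    then show ?case using zero by simp
  next
    case (insert u W)
    show ?case
    proof (cases "f u = 0")
      case True
      then have "{w. f w \<noteq> 0} \<subseteq> W" using insert.prems(2) by auto
      then show ?thesis using insert.IH insert.prems(1) by blast
    next
      case False
      let ?f = "f(u := 0)"
      have "finite {w. ?f w \<noteq> 0}"
        by (rule finite_subset[of _ "{w. f w \<noteq> 0}"]) (use insert.prems(1) in \<open>auto simp: free_alg_simps(1)\<close>)
      then have cl: "?f \<in> carrier (free_alg S)"
        using insert.prems(1) by (auto simp: free_alg_simps(1))
      moreover have "{w. ?f w \<noteq> 0} \<subseteq> W" using insert.prems(2) by auto
      ultimately have "P ?f" using insert.IH by blast
      moreover have "u \<in> lists S" using False insert.prems(1) unfolding free_alg_simps(1) by blast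
      ultimately have "P (f u \<odot>\<^bsub>free_alg S\<^esub> monom_word u \<oplus>\<^bsub>free_alg S\<^esub> ?f)" using cl by (intro add)
      moreover have "f u \<odot>\<^bsub>free_alg S\<^esub> monom_word u \<oplus>\<^bsub>free_alg S\<^esub> ?f = f"
        by (auto simp: free_alg_simps monom_word_def)
      ultimately show ?thesis by simp
    qed
  qed
  ultimately show ?thesis using f by blast
qed

definition monom_eval :: "('k, 'b) module \<Rightarrow> ('a \<Rightarrow> 'b) \<Rightarrow> 'a list \<Rightarrow> 'b" where
  "monom_eval B t w = foldr (\<lambda>a y. t a \<otimes>\<^bsub>B\<^esub> y) w \<one>\<^bsub>B\<^esub>"

definition free_alg_eval :: "('k::field, 'b) module \<Rightarrow> ('a \<Rightarrow> 'b) \<Rightarrow> ('a list \<Rightarrow> 'k) \<Rightarrow> 'b" where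
  "free_alg_eval B t f = finsum B (\<lambda>w. f w \<odot>\<^bsub>B\<^esub> monom_eval B t w) {w. f w \<noteq> 0}"

context kalgebra
begin

lemma monom_eval_closed: "\<forall>a. t a \<in> carrier A \<Longrightarrow> monom_eval A t w \<in> carrier A"
  unfolding monom_eval_def by (induction w) auto

lemma monom_eval_append:
  "\<forall>a. t a \<in> carrier A \<Longrightarrow> monom_eval A t (u @ v) = monom_eval A t u \<otimes> monom_eval A t v"
  using monom_eval_closed[of t] unfolding monom_eval_def by (induction u) (auto simp: m_assoc)

lemma free_alg_eval_eq:
  assumes "\<forall>a. t a \<in> carrier A" "finite W" "{w. f w \<noteq> 0} \<subseteq> W"
  shows "free_alg_eval A t f = finsum A (\<lambda>w. f w \<odot> monom_eval A t w) W"
  unfolding free_alg_eval_def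
  by (rule add.finprod_mono_neutral_cong_left)
    (use assms in \<open>auto simp: monom_eval_closed\<close>)

lemma free_alg_eval_closed: "\<forall>a. t a \<in> carrier A \<Longrightarrow> free_alg_eval A t f \<in> carrier A"
  unfolding free_alg_eval_def by (rule finsum_closed) (auto simp: monom_eval_closed)

lemma free_alg_eval_monom: "\<forall>a. t a \<in> carrier A \<Longrightarrow> free_alg_eval A t (monom_word u) = monom_eval A t u"
  unfolding free_alg_eval_def
  by (subst finsum_cong'[of _ "{u}" "\<lambda>w. monom_eval A t w"])
    (auto simp: monom_word_def monom_eval_closed)

lemma free_alg_eval_add:
  assumes t: "\<forall>a. t a \<in> carrier A" and f: "f \<in> carrier (free_alg S)" and h: "h \<in> carrier (free_alg S)"
  shows "free_alg_eval A t (f \<oplus>\<^bsub>free_alg S\<^esub> h) = free_alg_eval A t f \<oplus> free_alg_eval A t h"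
proof -
  let ?W = "{w. f w \<noteq> 0} \<union> {w. h w \<noteq> 0}"
  have fin: "finite ?W" using f h by (simp add: free_alg_simps(1))
  have "free_alg_eval A t (f \<oplus>\<^bsub>free_alg S\<^esub> h)
      = finsum A (\<lambda>w. f w \<odot> monom_eval A t w \<oplus> h w \<odot> monom_eval A t w) ?W"
    by (subst free_alg_eval_eq[OF t fin])
      (auto simp: free_alg_simps smult_l_distr[OF monom_eval_closed[OF t]])
  also have "\<dots> = free_alg_eval A t f \<oplus> free_alg_eval A t h"
    by (subst finsum_addf) (auto simp: monom_eval_closed[OF t] free_alg_eval_eq[OF t fin])
  finally show ?thesis .
qed

lemma finsum_smult:
  assumes "finite W" "f \<in> W \<rightarrow> carrier A"
  shows "finsum A (\<lambda>w. a \<odot> f w) W = a \<odot> finsum A f W"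
  using assms by (induction W) (auto simp: smult_r_distr Pi_iff)

lemma free_alg_eval_smult:
  assumes t: "\<forall>a. t a \<in> carrier A" and f: "f \<in> carrier (free_alg S)"
  shows "free_alg_eval A t (a \<odot>\<^bsub>free_alg S\<^esub> f) = a \<odot> free_alg_eval A t f"
proof -
  have fin: "finite {w. f w \<noteq> 0}" using f by (simp add: free_alg_simps(1))
  have "free_alg_eval A t (a \<odot>\<^bsub>free_alg S\<^esub> f)
      = finsum A (\<lambda>w. a \<odot> (f w \<odot> monom_eval A t w)) {w. f w \<noteq> 0}"
    by (subst free_alg_eval_eq[OF t fin])
      (auto simp: free_alg_simps smult_assoc[OF monom_eval_closed[OF t]])
  also have "\<dots> = a \<odot> free_alg_eval A t f"
    unfolding free_alg_eval_def by (rule finsum_smult[OF fin]) (auto simp: monom_eval_closed[OF t])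
  finally show ?thesis .
qed

lemma free_alg_eval_zero: "free_alg_eval A t \<zero>\<^bsub>free_alg S\<^esub> = \<zero>"
  by (simp add: free_alg_eval_def free_alg_simps)

text \<open>By linearity in each factor this reduces to monomials, where it is evaluation of a concatenation.\<close>

lemma free_alg_eval_mult:
  assumes t: "\<forall>a. t a \<in> carrier A" and f: "f \<in> carrier (free_alg S)" and h: "h \<in> carrier (free_alg S)"
  shows "free_alg_eval A t (f \<otimes>\<^bsub>free_alg S\<^esub> h) = free_alg_eval A t f \<otimes> free_alg_eval A t h"
proof -
  interpret F: kalgebra "free_alg S :: ('k, _) module" by (rule kalgebra_free_alg)
  note closed = free_alg_eval_closed[OF t] monom_eval_closed[OF t] monom_word_closed
  note eval = free_alg_eval_zero free_alg_eval_add[OF t, where S = S] free_alg_eval_smult[OF t, where S = S]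
    free_alg_eval_monom[OF t]
  have left: "free_alg_eval A t (monom_word u \<otimes>\<^bsub>free_alg S\<^esub> h) = monom_eval A t u \<otimes> free_alg_eval A t h"
    if u: "u \<in> lists S" for u
    using h
  proof (induction rule: free_alg_induct)
    case (add a v h)
    then show ?case using u
      by (simp add: F.r_distr F.smult_mult_r free_alg_monom_mult closed eval monom_eval_append[OF t]
        r_distr smult_mult_r)
  qed (use u in \<open>simp add: closed eval\<close>)
  from f show ?thesis
  proof (induction rule: free_alg_induct)
    case (add a u f)
    then show ?case using h
      by (simp add: F.l_distr F.smult_mult_l left closed eval l_distr smult_mult_l)
  qed (use h in \<open>simp add: closed eval\<close>)
qed

theorem free_alg_universal:
  assumes t: "\<And>a. a \<in> S \<Longrightarrow> t a \<in> carrier A"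
  shows "\<exists>h\<in>alg_hom (free_alg S) A. \<forall>a\<in>S. h (free_alg_gen a) = t a"
proof -
  define t' where "t' a = (if a \<in> S then t a else \<zero>)" for a
  have t': "\<forall>a. t' a \<in> carrier A" using t by (simp add: t'_def)
  have one: "\<one>\<^bsub>free_alg S\<^esub> = monom_word []" by (simp add: free_alg_simps monom_word_def)
  have "free_alg_eval A t' \<in> alg_hom (free_alg S) A"
    unfolding alg_hom_def
    by (auto intro!: ring_hom_memI simp: free_alg_eval_closed[OF t'] free_alg_eval_mult[OF t']
        free_alg_eval_add[OF t'] free_alg_eval_smult[OF t'] one free_alg_eval_monom[OF t']
        monom_eval_def)
  moreover have "free_alg_eval A t' (free_alg_gen a) = t a" if "a \<in> S" for a
  proof -
    have "free_alg_gen a = (monom_word [a] :: _ \<Rightarrow> 'k)"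
      by (simp add: free_alg_gen_def monom_word_def)
    then show ?thesis using that t by (simp add: free_alg_eval_monom[OF t'] monom_eval_def t'_def)
  qed
  ultimately show ?thesis by blast
qed

end

subsection \<open>Quotient algebras\<close>

lemma quot_alg_simps:
  "carrier (quot_alg A I) = a_rcosets\<^bsub>A\<^esub> I"
  "\<zero>\<^bsub>quot_alg A I\<^esub> = I"
  "add (quot_alg A I) = set_add A"
  "module.smult (quot_alg A I) = quot_smult A I"
  "\<one>\<^bsub>quot_alg A I\<^esub> = I +>\<^bsub>A\<^esub> \<one>\<^bsub>A\<^esub>"
  "monoid.mult (quot_alg A I) = rcoset_mult A I"
  by (simp_all add: quot_alg_def FactRing_def ring.extend_def module.fields_def)

locale kideal = kalgebra A + ideal I A for I and A :: "('k::field, 'a) module" (structure)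

sublocale kideal \<subseteq> ksubspace I A
proof unfold_locales
  fix x a assume "x \<in> I"
  then have "(a \<odot> \<one>) \<otimes> x \<in> I" "x \<in> carrier A" by (simp_all add: I_l_closed)
  then show "a \<odot> x \<in> I" by (simp add: smult_mult_l)
qed

context kideal
begin

lemma kalgebra_quot_alg: "kalgebra (quot_alg A I)"
proof -
  let ?Q = "quot_alg A I"
  have ks: "kspace ?Q"
    by (rule kspace_quotient) (simp_all add: quot_alg_simps)
  interpret Q: kspace ?Q by (rule ks)
  note simps = quot_alg_simps rcoset_mult_add a_rcos_sum quot_smult_coset
  have ring: "ring ?Q"
  proof (rule ringI)
    show "abelian_group ?Q" by (rule Q.abelian_group_axioms)
    show "monoid ?Q"
      by (rule monoidI)
        (auto simp: simps a_rcosetsI a_subset m_assoc elim!: cosets_cases)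
  qed (auto simp: simps l_distr r_distr elim!: cosets_cases)
  interpret Q: ring ?Q by (rule ring)
  show ?thesis
    by unfold_locales
      (auto simp: simps smult_mult_l smult_mult_r elim!: cosets_cases)
qed

lemma coset_alg_hom: "(\<lambda>x. I +> x) \<in> alg_hom A (quot_alg A I)"
  unfolding alg_hom_def
  by (auto intro!: ring_hom_memI
      simp: quot_alg_simps rcoset_mult_add a_rcos_sum quot_smult_coset a_rcosetsI a_subset)

text \<open>A homomorphism that kills \<open>I\<close> is constant on cosets, hence descends.\<close>

lemma quot_alg_lift:
  assumes B: "kalgebra B" and h: "h \<in> alg_hom A B" and I: "\<And>x. x \<in> I \<Longrightarrow> h x = \<zero>\<^bsub>B\<^esub>"
  shows "\<exists>h'\<in>alg_hom (quot_alg A I) B. \<forall>x\<in>carrier A. h' (I +> x) = h x"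
proof -
  interpret B: kalgebra B by (rule B)
  note h_simps = alg_hom_simps[OF h] alg_hom_minus[OF kalgebra_axioms B h]
  define h' where "h' X = the_elem (h ` X)" for X
  have h': "h' (I +> x) = h x" if x: "x \<in> carrier A" for x
  proof -
    have "h w = h x" if "w \<in> I +> x" for w
    proof -
      have w: "w \<in> carrier A" "w \<ominus> x \<in> I" using coset_mem_diff[OF x that] by auto
      then have "h w \<ominus>\<^bsub>B\<^esub> h x = \<zero>\<^bsub>B\<^esub>" using I x by (simp add: h_simps(7)[symmetric])
      then have "h w \<oplus>\<^bsub>B\<^esub> (\<ominus>\<^bsub>B\<^esub> h x) = \<zero>\<^bsub>B\<^esub>" by (simp add: a_minus_def)
      then have "\<ominus>\<^bsub>B\<^esub> (\<ominus>\<^bsub>B\<^esub> h x) = h w" using w x h_simps(1) by (intro B.minus_equality) auto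
      then show ?thesis using x h_simps(1) by simp
    qed
    then have "h ` (I +> x) = {h x}" using a_rcos_self[OF x] by blast
    then show ?thesis by (simp add: h'_def)
  qed
  have "h' \<in> alg_hom (quot_alg A I) B"
    unfolding alg_hom_def
    by (auto intro!: ring_hom_memI elim!: cosets_cases
        simp: quot_alg_simps rcoset_mult_add a_rcos_sum quot_smult_coset h' h_simps)
  then show ?thesis using h' by blast
qed

end

lemma (in kalgebra) kernel_kideal:
  assumes B: "kalgebra B" and h: "h \<in> alg_hom A B"
  shows "ideal {x \<in> carrier A. h x = \<zero>\<^bsub>B\<^esub>} A"
proof -
  interpret B: kalgebra B by (rule B)
  have "ring_hom_ring A B h"
    using h by (intro ring_hom_ringI2 ring_axioms B.ring_axioms) (simp add: alg_hom_def)
  from ring_hom_ring.kernel_is_ideal[OF this] show ?thesis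
    by (simp add: a_kernel_def')
qed

lemma rel_ideal_kideal:
  assumes "R \<subseteq> carrier (free_alg S) \<times> carrier (free_alg S)"
  shows "kideal (rel_ideal (free_alg S) R) (free_alg S)"
proof -
  interpret F: kalgebra "free_alg S" by (rule kalgebra_free_alg)
  show ?thesis
    unfolding rel_ideal_def
    by (intro kideal.intro kalgebra_free_alg F.genideal_ideal) (use assms in auto)
qed

text \<open>The elements killed by a homomorphism form an ideal; if it identifies both sides of each relation, that
  ideal contains the ideal the relations generate. The hypothesis \<open>rels\<close> speaks of every homomorphism with the
  given values because the one produced by the free algebra is not named.\<close>

lemma presented_alg_universal:
  assumes R: "R \<subseteq> carrier (free_alg S) \<times> carrier (free_alg S)" and B: "kalgebra B"
    and t: "\<And>a. a \<in> S \<Longrightarrow> t a \<in> carrier B"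
    and rels: "\<And>h u v. h \<in> alg_hom (free_alg S) B \<Longrightarrow> (\<And>a. a \<in> S \<Longrightarrow> h (free_alg_gen a) = t a) \<Longrightarrow>
      (u, v) \<in> R \<Longrightarrow> h u = h v"
  shows "\<exists>h\<in>alg_hom (quot_alg (free_alg S) (rel_ideal (free_alg S) R)) B.
    \<forall>a\<in>S. h (rel_ideal (free_alg S) R +>\<^bsub>free_alg S\<^esub> free_alg_gen a) = t a"
proof -
  let ?I = "rel_ideal (free_alg S) R"
  interpret kideal ?I "free_alg S" by (rule rel_ideal_kideal[OF R])
  interpret B: kalgebra B by (rule B)
  obtain h where h: "h \<in> alg_hom (free_alg S) B" "\<forall>a\<in>S. h (free_alg_gen a) = t a"
    using B.free_alg_universal[of S t] t by auto
  have "{u \<ominus>\<^bsub>free_alg S\<^esub> v | u v. (u, v) \<in> R} \<subseteq> {x \<in> carrier (free_alg S). h x = \<zero>\<^bsub>B\<^esub>}"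
  proof clarify
    fix u v assume uv: "(u, v) \<in> R"
    then have "u \<in> carrier (free_alg S)" "v \<in> carrier (free_alg S)" using R by auto
    moreover have "h u = h v" using rels[OF h(1) _ uv] h(2) by simp
    ultimately show "u \<ominus>\<^bsub>free_alg S\<^esub> v \<in> carrier (free_alg S) \<and> h (u \<ominus>\<^bsub>free_alg S\<^esub> v) = \<zero>\<^bsub>B\<^esub>"
      using alg_hom_minus(2)[OF kalgebra_axioms B h(1), of u v] alg_hom_simps(1)[OF h(1), of v]
      by (simp add: B.r_neg B.minus_eq)
  qed
  then have "?I \<subseteq> {x \<in> carrier (free_alg S). h x = \<zero>\<^bsub>B\<^esub>}"
    unfolding rel_ideal_def by (rule genideal_minimal[OF kernel_kideal[OF B h(1)]])
  then obtain h' where "h' \<in> alg_hom (quot_alg (free_alg S) ?I) B"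
    "\<forall>x\<in>carrier (free_alg S). h' (?I +>\<^bsub>free_alg S\<^esub> x) = h x"
    using quot_alg_lift[OF B h(1)] by blast
  then show ?thesis using h(2) by (intro bexI[of _ h']) auto
qed

lemma presented_alg_rel:
  assumes R: "R \<subseteq> carrier (free_alg S) \<times> carrier (free_alg S)" and uv: "(u, v) \<in> R"
  shows "rel_ideal (free_alg S) R +>\<^bsub>free_alg S\<^esub> u = rel_ideal (free_alg S) R +>\<^bsub>free_alg S\<^esub> v"
proof -
  interpret kideal "rel_ideal (free_alg S) R" "free_alg S" by (rule rel_ideal_kideal[OF R])
  have "{u \<ominus>\<^bsub>free_alg S\<^esub> v | u v. (u, v) \<in> R} \<subseteq> carrier (free_alg S)" using R by auto
  from genideal_self[OF this] have "u \<ominus>\<^bsub>free_alg S\<^esub> v \<in> rel_ideal (free_alg S) R"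
    using uv unfolding rel_ideal_def by blast
  then show ?thesis using R uv by (subst coset_eq_iff) auto
qed

subsection \<open>Hecke and Temperley--Lieb algebras\<close>

lemma ball_family:
  "(\<forall>(u, v)\<in>{(f i, h i) | i. P i}. u = v) \<longleftrightarrow> (\<forall>i. P i \<longrightarrow> f i = h i)"
  "(\<forall>(u, v)\<in>{(f' i j, h' i j) | i j. P' i j}. u = v) \<longleftrightarrow> (\<forall>i j. P' i j \<longrightarrow> f' i j = h' i j)"
  by auto

lemma hecke_rels_hold_iff:
  "(\<forall>(u, v)\<in>hecke_rels A n q t. u = v) \<longleftrightarrow>
    (\<forall>i\<in>{1..<n}. (t i \<ominus>\<^bsub>A\<^esub> \<one>\<^bsub>A\<^esub>) \<otimes>\<^bsub>A\<^esub> (t i \<oplus>\<^bsub>A\<^esub> q \<odot>\<^bsub>A\<^esub> \<one>\<^bsub>A\<^esub>) = \<zero>\<^bsub>A\<^esub>) \<and>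
    (\<forall>i\<in>{1..<n}. i + 1 \<in> {1..<n} \<longrightarrow>
      t i \<otimes>\<^bsub>A\<^esub> t (i + 1) \<otimes>\<^bsub>A\<^esub> t i = t (i + 1) \<otimes>\<^bsub>A\<^esub> t i \<otimes>\<^bsub>A\<^esub> t (i + 1)) \<and>
    (\<forall>i\<in>{1..<n}. \<forall>j\<in>{1..<n}. i + 2 \<le> j \<or> j + 2 \<le> i \<longrightarrow> t i \<otimes>\<^bsub>A\<^esub> t j = t j \<otimes>\<^bsub>A\<^esub> t i)"
  unfolding hecke_rels_def ball_Un ball_family by (auto simp only: Ball_def conj_assoc imp_conjL)

lemma tl_rels_hold_iff:
  "(\<forall>(u, v)\<in>tl_rels A n \<delta> e. u = v) \<longleftrightarrow>
    (\<forall>i\<in>{1..<n}. e i \<otimes>\<^bsub>A\<^esub> e i = \<delta> \<odot>\<^bsub>A\<^esub> e i) \<and>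
    (\<forall>i\<in>{1..<n}. \<forall>j\<in>{1..<n}. j = i + 1 \<or> i = j + 1 \<longrightarrow> e i \<otimes>\<^bsub>A\<^esub> e j \<otimes>\<^bsub>A\<^esub> e i = e i) \<and>
    (\<forall>i\<in>{1..<n}. \<forall>j\<in>{1..<n}. i + 2 \<le> j \<or> j + 2 \<le> i \<longrightarrow> e i \<otimes>\<^bsub>A\<^esub> e j = e j \<otimes>\<^bsub>A\<^esub> e i)"
  unfolding tl_rels_def ball_Un ball_family by (auto simp only: Ball_def conj_assoc imp_conjL)

lemma (in kalgebra) hecke_rels_closed:
  "\<forall>i\<in>{1..<n}. t i \<in> carrier A \<Longrightarrow> hecke_rels A n q t \<subseteq> carrier A \<times> carrier A"
  unfolding hecke_rels_def by (intro Un_least subsetI; elim CollectE exE conjE; simp)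

lemma (in kalgebra) tl_rels_closed:
  "\<forall>i\<in>{1..<n}. e i \<in> carrier A \<Longrightarrow> tl_rels A n \<delta> e \<subseteq> carrier A \<times> carrier A"
  unfolding tl_rels_def by (intro Un_least subsetI; elim CollectE exE conjE; simp)

lemma hecke_rels_natural:
  assumes A: "kalgebra A" and B: "kalgebra B" and h: "h \<in> alg_hom A B"
    and t: "\<forall>i\<in>{1..<n}. t i \<in> carrier A" "\<forall>i\<in>{1..<n}. h (t i) = t' i"
    and rels: "\<forall>(u, v)\<in>hecke_rels B n q t'. u = v" and uv: "(u, v) \<in> hecke_rels A n q t"
  shows "h u = h v"
proof -
  interpret A: kalgebra A by (rule A)
  note h_simps = alg_hom_simps[OF h] alg_hom_minus[OF A B h]
  note B_rels = rels[unfolded hecke_rels_hold_iff]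
  have c: "t i \<in> carrier A" "h (t i) = t' i" if "i \<in> {1..<n}" for i using t that by auto
  from uv show ?thesis
    unfolding hecke_rels_def
  proof (elim UnE CollectE exE conjE)
    fix i assume "(u, v) = ((t i \<ominus>\<^bsub>A\<^esub> \<one>\<^bsub>A\<^esub>) \<otimes>\<^bsub>A\<^esub> (t i \<oplus>\<^bsub>A\<^esub> q \<odot>\<^bsub>A\<^esub> \<one>\<^bsub>A\<^esub>), \<zero>\<^bsub>A\<^esub>)"
      and i: "i \<in> {1..<n}"
    then show ?thesis using B_rels i by (simp add: c[OF i] h_simps)
  next
    fix i assume "(u, v) = (t i \<otimes>\<^bsub>A\<^esub> t (i + 1) \<otimes>\<^bsub>A\<^esub> t i, t (i + 1) \<otimes>\<^bsub>A\<^esub> t i \<otimes>\<^bsub>A\<^esub> t (i + 1))"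
      and i: "i \<in> {1..<n}" "i + 1 \<in> {1..<n}"
    moreover have "t' i \<otimes>\<^bsub>B\<^esub> t' (i + 1) \<otimes>\<^bsub>B\<^esub> t' i = t' (i + 1) \<otimes>\<^bsub>B\<^esub> t' i \<otimes>\<^bsub>B\<^esub> t' (i + 1)"
      using B_rels i by blast
    ultimately show ?thesis using c[OF i(1)] c[OF i(2)] by (simp add: h_simps)
  next
    fix i j assume "(u, v) = (t i \<otimes>\<^bsub>A\<^esub> t j, t j \<otimes>\<^bsub>A\<^esub> t i)"
      and i: "i \<in> {1..<n}" "j \<in> {1..<n}" "i + 2 \<le> j \<or> j + 2 \<le> i"
    moreover have "t' i \<otimes>\<^bsub>B\<^esub> t' j = t' j \<otimes>\<^bsub>B\<^esub> t' i" using B_rels i by blast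
    ultimately show ?thesis using c[OF i(1)] c[OF i(2)] by (simp add: h_simps)
  qed
qed

lemma tl_rels_natural:
  assumes A: "kalgebra A" and B: "kalgebra B" and h: "h \<in> alg_hom A B"
    and e: "\<forall>i\<in>{1..<n}. e i \<in> carrier A" "\<forall>i\<in>{1..<n}. h (e i) = e' i"
    and rels: "\<forall>(u, v)\<in>tl_rels B n \<delta> e'. u = v" and uv: "(u, v) \<in> tl_rels A n \<delta> e"
  shows "h u = h v"
proof -
  interpret A: kalgebra A by (rule A)
  note h_simps = alg_hom_simps[OF h]
  note B_rels = rels[unfolded tl_rels_hold_iff]
  have c: "e i \<in> carrier A" "h (e i) = e' i" if "i \<in> {1..<n}" for i using e that by auto
  from uv show ?thesis
    unfolding tl_rels_def
  proof (elim UnE CollectE exE conjE)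
    fix i assume "(u, v) = (e i \<otimes>\<^bsub>A\<^esub> e i, \<delta> \<odot>\<^bsub>A\<^esub> e i)" and i: "i \<in> {1..<n}"
    then show ?thesis using B_rels i by (simp add: c[OF i] h_simps)
  next
    fix i j assume "(u, v) = (e i \<otimes>\<^bsub>A\<^esub> e j \<otimes>\<^bsub>A\<^esub> e i, e i)"
      and i: "i \<in> {1..<n}" "j \<in> {1..<n}" "j = i + 1 \<or> i = j + 1"
    moreover have "e' i \<otimes>\<^bsub>B\<^esub> e' j \<otimes>\<^bsub>B\<^esub> e' i = e' i" using B_rels i by blast
    ultimately show ?thesis using c[OF i(1)] c[OF i(2)] by (simp add: h_simps)
  next
    fix i j assume "(u, v) = (e i \<otimes>\<^bsub>A\<^esub> e j, e j \<otimes>\<^bsub>A\<^esub> e i)"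
      and i: "i \<in> {1..<n}" "j \<in> {1..<n}" "i + 2 \<le> j \<or> j + 2 \<le> i"
    moreover have "e' i \<otimes>\<^bsub>B\<^esub> e' j = e' j \<otimes>\<^bsub>B\<^esub> e' i" using B_rels i by blast
    ultimately show ?thesis using c[OF i(1)] c[OF i(2)] by (simp add: h_simps)
  qed
qed

lemma hecke_alg_universal:
  assumes B: "kalgebra B" and t: "\<forall>i\<in>{1..<n}. t i \<in> carrier B"
    and rels: "\<forall>(u, v)\<in>hecke_rels B n q t. u = v"
  shows "\<exists>h\<in>alg_hom (hecke_alg n q) B. \<forall>i\<in>{1..<n}. h (hecke_gen n q i) = t i"
proof -
  interpret F: kalgebra "free_alg {1..<n}" by (rule kalgebra_free_alg)
  have "hecke_rels (free_alg {1..<n}) n q free_alg_gen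
      \<subseteq> carrier (free_alg {1..<n}) \<times> carrier (free_alg {1..<n})"
    by (rule F.hecke_rels_closed) simp
  from presented_alg_universal[OF this B] t show ?thesis
    unfolding hecke_alg_def hecke_gen_def hecke_ideal_def
    using hecke_rels_natural[OF kalgebra_free_alg B _ _ _ rels, where t = free_alg_gen]
    by simp
qed

lemma tl_alg_universal:
  assumes B: "kalgebra B" and e: "\<forall>i\<in>{1..<n}. e i \<in> carrier B"
    and rels: "\<forall>(u, v)\<in>tl_rels B n \<delta> e. u = v"
  shows "\<exists>h\<in>alg_hom (tl_alg n \<delta>) B. \<forall>i\<in>{1..<n}. h (tl_gen n \<delta> i) = e i"
proof -
  interpret F: kalgebra "free_alg {1..<n}" by (rule kalgebra_free_alg)
  have "tl_rels (free_alg {1..<n}) n \<delta> free_alg_gen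
      \<subseteq> carrier (free_alg {1..<n}) \<times> carrier (free_alg {1..<n})"
    by (rule F.tl_rels_closed) simp
  from presented_alg_universal[OF this B] e show ?thesis
    unfolding tl_alg_def tl_gen_def tl_ideal_def
    using tl_rels_natural[OF kalgebra_free_alg B _ _ _ rels, where e = free_alg_gen]
    by simp
qed

lemma tl_alg_facts:
  fixes \<delta> :: "'k::field"
  shows kalgebra_tl_alg: "kalgebra (tl_alg n \<delta>)"
    and tl_gen_closed: "i \<in> {1..<n} \<Longrightarrow> tl_gen n \<delta> i \<in> carrier (tl_alg n \<delta>)"
    and tl_alg_rels: "\<forall>(u, v)\<in>tl_rels (tl_alg n \<delta>) n \<delta> (tl_gen n \<delta>). u = v"
proof -
  let ?F = "free_alg {1..<n} :: ('k, _) module"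
  let ?R = "tl_rels ?F n \<delta> free_alg_gen"
  interpret F: kalgebra ?F by (rule kalgebra_free_alg)
  have R: "?R \<subseteq> carrier ?F \<times> carrier ?F" by (rule F.tl_rels_closed) simp
  interpret I: kideal "rel_ideal ?F ?R" ?F by (rule rel_ideal_kideal[OF R])
  show "kalgebra (tl_alg n \<delta>)"
    unfolding tl_alg_def tl_ideal_def by (rule I.kalgebra_quot_alg)
  define c where "c x = rel_ideal ?F ?R +>\<^bsub>?F\<^esub> x" for x
  have c: "c \<in> alg_hom ?F (tl_alg n \<delta>)"
    unfolding c_def tl_alg_def tl_ideal_def by (rule I.coset_alg_hom)
  have gen: "tl_gen n \<delta> i = c (free_alg_gen i)" for i
    by (simp add: c_def tl_gen_def tl_ideal_def)
  have free: "free_alg_gen i \<in> carrier ?F" if "i \<in> {1..<n}" for i using that by simp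
  have rel: "c u = c v" if "(u, v) \<in> ?R" for u v
    unfolding c_def by (rule presented_alg_rel[OF R that])
  note c_simps = alg_hom_simps[OF c]
  show "tl_gen n \<delta> i \<in> carrier (tl_alg n \<delta>)" if "i \<in> {1..<n}" for i
    unfolding gen by (rule c_simps(1)[OF free[OF that]])
  show "\<forall>(u, v)\<in>tl_rels (tl_alg n \<delta>) n \<delta> (tl_gen n \<delta>). u = v"
    unfolding tl_rels_hold_iff
  proof (intro conjI ballI impI)
    fix i assume i: "i \<in> {1..<n}"
    then have "(free_alg_gen i \<otimes>\<^bsub>?F\<^esub> free_alg_gen i, \<delta> \<odot>\<^bsub>?F\<^esub> free_alg_gen i) \<in> ?R"
      unfolding tl_rels_def by blast
    from rel[OF this]
    show "tl_gen n \<delta> i \<otimes>\<^bsub>tl_alg n \<delta>\<^esub> tl_gen n \<delta> i = \<delta> \<odot>\<^bsub>tl_alg n \<delta>\<^esub> tl_gen n \<delta> i"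
      by (simp add: gen c_simps free[OF i] del: One_nat_def)
    fix j assume j: "j \<in> {1..<n}"
    show "tl_gen n \<delta> i \<otimes>\<^bsub>tl_alg n \<delta>\<^esub> tl_gen n \<delta> j \<otimes>\<^bsub>tl_alg n \<delta>\<^esub> tl_gen n \<delta> i = tl_gen n \<delta> i"
      if "j = i + 1 \<or> i = j + 1"
    proof -
      have "(free_alg_gen i \<otimes>\<^bsub>?F\<^esub> free_alg_gen j \<otimes>\<^bsub>?F\<^esub> free_alg_gen i, free_alg_gen i) \<in> ?R"
        unfolding tl_rels_def using i j that by blast
      from rel[OF this] show ?thesis by (simp add: gen c_simps free[OF i] free[OF j] del: One_nat_def)
    qed
    show "tl_gen n \<delta> i \<otimes>\<^bsub>tl_alg n \<delta>\<^esub> tl_gen n \<delta> j = tl_gen n \<delta> j \<otimes>\<^bsub>tl_alg n \<delta>\<^esub> tl_gen n \<delta> i"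
      if "i + 2 \<le> j \<or> j + 2 \<le> i"
    proof -
      have "(free_alg_gen i \<otimes>\<^bsub>?F\<^esub> free_alg_gen j, free_alg_gen j \<otimes>\<^bsub>?F\<^esub> free_alg_gen i) \<in> ?R"
        unfolding tl_rels_def using i j that by blast
      from rel[OF this] show ?thesis by (simp add: gen c_simps free[OF i] free[OF j] del: One_nat_def)
    qed
  qed
qed

context kalgebra
begin

text \<open>In the expansion \<open>1 - y - 2 x + x y + y x + x\<^sup>2 - x y x\<close> the last two terms contribute \<open>s x - m x = x\<close>,
  which makes it symmetric in \<open>x\<close> and \<open>y\<close>.\<close>

lemma one_minus_braid:
  assumes x: "x \<in> carrier A" and y: "y \<in> carrier A"
    and xx: "x \<otimes> x = s \<odot> x" and yy: "y \<otimes> y = s \<odot> y"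
    and xyx: "x \<otimes> y \<otimes> x = m \<odot> x" and yxy: "y \<otimes> x \<otimes> y = m \<odot> y" and s: "s = 1 + m"
  shows "(\<one> \<ominus> x) \<otimes> (\<one> \<ominus> y) \<otimes> (\<one> \<ominus> x) = (\<one> \<ominus> y) \<otimes> (\<one> \<ominus> x) \<otimes> (\<one> \<ominus> y)"
proof -
  have expand: "(\<one> \<ominus> a) \<otimes> (\<one> \<ominus> b) \<otimes> (\<one> \<ominus> a)
      = \<one> \<ominus> b \<ominus> a \<oplus> (a \<otimes> b \<oplus> b \<otimes> a) \<oplus> (a \<otimes> a \<ominus> a \<otimes> b \<otimes> a \<ominus> a)"
    if "a \<in> carrier A" "b \<in> carrier A" for a b
    using that by (simp add: a_minus_def l_distr r_distr l_minus r_minus minus_add a_ac m_assoc)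
  have cancel: "s \<odot> a \<ominus> m \<odot> a \<ominus> a = \<zero>" if "a \<in> carrier A" for a
  proof -
    have "s \<odot> a = a \<oplus> m \<odot> a" using that by (simp add: s smult_l_distr)
    then show ?thesis using that smult_closed[OF that, of m] by algebra
  qed
  have "\<one> \<ominus> y \<ominus> x \<oplus> (x \<otimes> y \<oplus> y \<otimes> x) \<oplus> \<zero> = \<one> \<ominus> x \<ominus> y \<oplus> (y \<otimes> x \<oplus> x \<otimes> y) \<oplus> \<zero>"
    using x y by algebra
  then show ?thesis using x y by (simp add: expand xx yy xyx yxy cancel)
qed

lemma one_minus_commute:
  assumes "x \<in> carrier A" "y \<in> carrier A" "x \<otimes> y = y \<otimes> x"
  shows "(\<one> \<ominus> x) \<otimes> (\<one> \<ominus> y) = (\<one> \<ominus> y) \<otimes> (\<one> \<ominus> x)"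
proof -
  have expand: "(\<one> \<ominus> a) \<otimes> (\<one> \<ominus> b) = \<one> \<ominus> a \<ominus> b \<oplus> a \<otimes> b"
    if "a \<in> carrier A" "b \<in> carrier A" for a b
    using that by (simp add: a_minus_def l_distr r_distr l_minus r_minus minus_add a_ac)
  show ?thesis unfolding expand[OF assms(1,2)] expand[OF assms(2,1)] assms(3)
    using assms(1,2) by algebra
qed

lemma one_minus_quadratic:
  assumes x: "x \<in> carrier A" and xx: "x \<otimes> x = (1 + m) \<odot> x"
  shows "(\<one> \<ominus> x \<ominus> \<one>) \<otimes> (\<one> \<ominus> x \<oplus> m \<odot> \<one>) = \<zero>"
proof -
  let ?m = "m \<odot> \<one>"
  have m: "?m \<in> carrier A" by simp
  have "(\<one> \<ominus> x \<ominus> \<one>) \<otimes> (\<one> \<ominus> x \<oplus> ?m) = x \<otimes> x \<ominus> (x \<oplus> x \<otimes> ?m)"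
  proof -
    have "\<one> \<ominus> x \<ominus> \<one> = \<ominus> x" using x by algebra
    then show ?thesis
      using x m by (simp add: a_minus_def r_distr l_minus r_minus minus_add a_ac del: smult_closed)
  qed
  also have "x \<oplus> x \<otimes> ?m = x \<otimes> x"
    using x by (simp add: smult_mult_r xx smult_l_distr)
  finally show ?thesis using x by (simp add: a_minus_def r_neg)
qed

text \<open>Put \<open>x\<^sub>i = r e\<^sub>i\<close>. Since \<open>r (r + r\<^sup>-\<^sup>1) = 1 + r\<^sup>2\<close>, the Temperley--Lieb relations read
  \<open>x\<^sub>i\<^sup>2 = (1 + r\<^sup>2) x\<^sub>i\<close> and \<open>x\<^sub>i x\<^sub>j x\<^sub>i = r\<^sup>2 x\<^sub>i\<close>, which is what the preceding lemmas require with
  \<open>m = r\<^sup>2\<close>.\<close>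

lemma tl_rels_imp_hecke_rels:
  assumes r: "r \<noteq> 0" and e: "\<forall>i\<in>{1..<n}. e i \<in> carrier A"
    and rels: "\<forall>(u, v)\<in>tl_rels A n (r + inverse r) e. u = v"
  shows "\<forall>(u, v)\<in>hecke_rels A n (r ^ 2) (\<lambda>i. \<one> \<ominus> r \<odot> e i). u = v"
proof -
  note tl = rels[unfolded tl_rels_hold_iff]
  have closed: "r \<odot> e i \<in> carrier A" if "i \<in> {1..<n}" for i using e that by simp
  have sq: "(r \<odot> e i) \<otimes> (r \<odot> e i) = (1 + r ^ 2) \<odot> (r \<odot> e i)" if "i \<in> {1..<n}" for i
  proof -
    have "e i \<otimes> e i = (r + inverse r) \<odot> e i" "e i \<in> carrier A" using tl e that by blast+
    moreover have eq: "r * (r * (r + inverse r)) = (1 + r ^ 2) * r"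
      using r by (simp add: field_simps power2_eq_square)
    ultimately have "(r \<odot> e i) \<otimes> (r \<odot> e i) = (r * (r * (r + inverse r))) \<odot> e i"
      by (simp add: smult_mult_l smult_mult_r smult_assoc)
    then show ?thesis unfolding eq using \<open>e i \<in> carrier A\<close> by (simp add: smult_assoc)
  qed
  have tri: "(r \<odot> e i) \<otimes> (r \<odot> e j) \<otimes> (r \<odot> e i) = r ^ 2 \<odot> (r \<odot> e i)"
    if "i \<in> {1..<n}" "j \<in> {1..<n}" "j = i + 1 \<or> i = j + 1" for i j
  proof -
    have "e i \<otimes> e j \<otimes> e i = e i" "e i \<in> carrier A" "e j \<in> carrier A" using tl e that by blast+
    then show ?thesis
      by (simp add: smult_mult_l smult_mult_r smult_assoc[symmetric] power2_eq_square mult.assoc)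
  qed
  have com: "(r \<odot> e i) \<otimes> (r \<odot> e j) = (r \<odot> e j) \<otimes> (r \<odot> e i)"
    if "i \<in> {1..<n}" "j \<in> {1..<n}" "i + 2 \<le> j \<or> j + 2 \<le> i" for i j
  proof -
    have "e i \<otimes> e j = e j \<otimes> e i" using tl that by blast
    then show ?thesis using e that by (simp add: smult_mult_l smult_mult_r)
  qed
  show ?thesis
    unfolding hecke_rels_hold_iff
  proof (intro conjI ballI impI)
    fix i assume i: "i \<in> {1..<n}"
    show "(\<one> \<ominus> r \<odot> e i \<ominus> \<one>) \<otimes> (\<one> \<ominus> r \<odot> e i \<oplus> r ^ 2 \<odot> \<one>) = \<zero>"
      by (rule one_minus_quadratic[OF closed[OF i] sq[OF i]])
    show "(\<one> \<ominus> r \<odot> e i) \<otimes> (\<one> \<ominus> r \<odot> e (i + 1)) \<otimes> (\<one> \<ominus> r \<odot> e i)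
      = (\<one> \<ominus> r \<odot> e (i + 1)) \<otimes> (\<one> \<ominus> r \<odot> e i) \<otimes> (\<one> \<ominus> r \<odot> e (i + 1))" if "i + 1 \<in> {1..<n}"
      by (rule one_minus_braid[OF closed[OF i] closed[OF that] sq[OF i] sq[OF that]
        tri[OF i that] tri[OF that i]]) simp_all
    show "(\<one> \<ominus> r \<odot> e i) \<otimes> (\<one> \<ominus> r \<odot> e j) = (\<one> \<ominus> r \<odot> e j) \<otimes> (\<one> \<ominus> r \<odot> e i)"
      if "j \<in> {1..<n}" "i + 2 \<le> j \<or> j + 2 \<le> i" for j
      by (rule one_minus_commute[OF closed[OF i] closed[OF that(1)] com[OF i that]])
  qed
qed

theorem hecke_factors_through_tl:
  assumes r: "r \<noteq> 0" and e: "\<forall>i\<in>{1..<n}. e i \<in> carrier A"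
    and rels: "\<forall>(u, v)\<in>tl_rels A n (r + inverse r) e. u = v"
    and H: "H = hecke_alg n (r ^ 2)" and TL: "TL = tl_alg n (r + inverse r)"
  shows "\<exists>\<Phi>\<in>alg_hom H A. \<exists>\<pi>\<in>alg_hom H TL. \<exists>\<phi>\<in>alg_hom TL A.
    (\<forall>i\<in>{1..<n}. \<Phi> (hecke_gen n (r ^ 2) i) = \<one> \<ominus> r \<odot> e i) \<and>
    (\<forall>i\<in>{1..<n}. \<pi> (hecke_gen n (r ^ 2) i)
      = \<one>\<^bsub>TL\<^esub> \<ominus>\<^bsub>TL\<^esub> (r \<odot>\<^bsub>TL\<^esub> tl_gen n (r + inverse r) i)) \<and>
    (\<forall>i\<in>{1..<n}. \<phi> (tl_gen n (r + inverse r) i) = e i) \<and>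
    (\<forall>h\<in>carrier H. \<Phi> h = \<phi> (\<pi> h))"
proof -
  let ?g = "tl_gen n (r + inverse r)"
  interpret TL: kalgebra TL unfolding TL by (rule kalgebra_tl_alg)
  have g: "\<forall>i\<in>{1..<n}. ?g i \<in> carrier TL" by (simp add: TL tl_gen_closed)
  have "\<forall>(u, v)\<in>hecke_rels TL n (r ^ 2) (\<lambda>i. \<one>\<^bsub>TL\<^esub> \<ominus>\<^bsub>TL\<^esub> r \<odot>\<^bsub>TL\<^esub> ?g i). u = v"
    by (rule TL.tl_rels_imp_hecke_rels[OF r g]) (use tl_alg_rels[of n "r + inverse r"] TL in simp)
  from hecke_alg_universal[OF TL.kalgebra_axioms _ this] g
  obtain \<pi> where \<pi>: "\<pi> \<in> alg_hom H TL"
    "\<forall>i\<in>{1..<n}. \<pi> (hecke_gen n (r ^ 2) i) = \<one>\<^bsub>TL\<^esub> \<ominus>\<^bsub>TL\<^esub> (r \<odot>\<^bsub>TL\<^esub> ?g i)"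
    unfolding H by (metis TL.minus_closed TL.one_closed TL.smult_closed)
  obtain \<phi> where \<phi>: "\<phi> \<in> alg_hom TL A" "\<forall>i\<in>{1..<n}. \<phi> (?g i) = e i"
    using tl_alg_universal[OF kalgebra_axioms e rels] unfolding TL by blast
  have "\<phi> \<circ> \<pi> \<in> alg_hom H A" by (rule alg_hom_comp[OF \<pi>(1) \<phi>(1)])
  moreover have "\<forall>i\<in>{1..<n}. (\<phi> \<circ> \<pi>) (hecke_gen n (r ^ 2) i) = \<one> \<ominus> r \<odot> e i"
    using \<pi>(2) \<phi>(2) g
    by (simp add: alg_hom_simps[OF \<phi>(1)] alg_hom_minus[OF TL.kalgebra_axioms kalgebra_axioms \<phi>(1)])
  ultimately show ?thesis using \<pi> \<phi> by (intro bexI[of _ "\<phi> \<circ> \<pi>"] bexI[of _ \<pi>] bexI[of _ \<phi>]) auto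
qed

end

section \<open>Representations of the semidirect product\<close>

lemma braid_grp_induct [consumes 1, case_names one gen inv]:
  assumes "s \<in> carrier (braid_grp n)"
    and "P \<one>\<^bsub>braid_grp n\<^esub>"
    and "\<And>i t. i \<in> {1..<n} \<Longrightarrow> t \<in> carrier (braid_grp n) \<Longrightarrow> P t \<Longrightarrow>
      P (braid_gen n i \<otimes>\<^bsub>braid_grp n\<^esub> t)"
    and "\<And>i t. i \<in> {1..<n} \<Longrightarrow> t \<in> carrier (braid_grp n) \<Longrightarrow> P t \<Longrightarrow>
      P (inv\<^bsub>braid_grp n\<^esub> (braid_gen n i) \<otimes>\<^bsub>braid_grp n\<^esub> t)"
  shows "P s"
  using assms unfolding braid_grp_def braid_gen_def by (rule pres_group_induct)

context
  fixes n :: nat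
begin

interpretation F: group "free_grp n" by (rule group_free_grp)
interpretation B: group "braid_grp n" by (rule group_braid_grp)
interpretation A: group "AutoGroup (free_grp n)" by (rule F.AutoGroup)
interpretation action: group_hom "braid_grp n" "AutoGroup (free_grp n)" "artin_action n"
  using artin_action_spec by unfold_locales (simp add: artin_action_spec_def)

lemma artin_action_auto: "s \<in> carrier (braid_grp n) \<Longrightarrow> artin_action n s \<in> auto (free_grp n)"
  using action.hom_closed by (simp add: F.AutoGroup_carrier)

lemma artin_action_closed:
  "s \<in> carrier (braid_grp n) \<Longrightarrow> b \<in> carrier (free_grp n) \<Longrightarrow>
    artin_action n s b \<in> carrier (free_grp n)"
  using artin_action_auto[of s] by (auto simp: auto_def hom_def)

lemma artin_action_mult:
  "s \<in> carrier (braid_grp n) \<Longrightarrow> t \<in> carrier (braid_grp n) \<Longrightarrow> b \<in> carrier (free_grp n) \<Longrightarrow>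
    artin_action n (s \<otimes>\<^bsub>braid_grp n\<^esub> t) b = artin_action n s (artin_action n t b)"
  by (simp add: F.AutoGroup_apply artin_action_auto)

lemma artin_action_one:
  "b \<in> carrier (free_grp n) \<Longrightarrow> artin_action n \<one>\<^bsub>braid_grp n\<^esub> b = b"
  unfolding action.hom_one by (simp add: AutoGroup_def BijGroup_def)

declare action.hom_one [simp del] action.hom_mult [simp del] action.hom_inv [simp del]

text \<open>The hypotheses \<open>mix1\<close> and \<open>mix2\<close> are the Artin action in a form free of inverses: given \<open>mix1\<close>, the rule
  for \<open>x\<^bsub>i+1\<^esub>\<close> is equivalent to \<open>s\<^sub>i\<close> commuting with \<open>x\<^sub>i x\<^bsub>i+1\<^esub>\<close>. On generators of the braid
  group compatibility with the action follows by comparing two homomorphisms on the free group; it then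
  passes to all braids by induction on words.\<close>

theorem FB_universal:
  assumes G: "group G"
    and x: "\<And>j. j \<in> {1..n} \<Longrightarrow> x j \<in> carrier G"
    and s: "\<And>i. i \<in> {1..<n} \<Longrightarrow> s i \<in> carrier G"
    and braid: "\<And>i. i \<in> {1..<n} \<Longrightarrow> i + 1 \<in> {1..<n} \<Longrightarrow>
      s i \<otimes>\<^bsub>G\<^esub> s (i + 1) \<otimes>\<^bsub>G\<^esub> s i = s (i + 1) \<otimes>\<^bsub>G\<^esub> s i \<otimes>\<^bsub>G\<^esub> s (i + 1)"
    and comm: "\<And>i j. i \<in> {1..<n} \<Longrightarrow> j \<in> {1..<n} \<Longrightarrow> i + 2 \<le> j \<Longrightarrow>
      s i \<otimes>\<^bsub>G\<^esub> s j = s j \<otimes>\<^bsub>G\<^esub> s i"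
    and mix1: "\<And>i. i \<in> {1..<n} \<Longrightarrow> s i \<otimes>\<^bsub>G\<^esub> x i = x (i + 1) \<otimes>\<^bsub>G\<^esub> s i"
    and mix2: "\<And>i. i \<in> {1..<n} \<Longrightarrow>
      s i \<otimes>\<^bsub>G\<^esub> (x i \<otimes>\<^bsub>G\<^esub> x (i + 1)) = (x i \<otimes>\<^bsub>G\<^esub> x (i + 1)) \<otimes>\<^bsub>G\<^esub> s i"
    and mix3: "\<And>i j. i \<in> {1..<n} \<Longrightarrow> j \<in> {1..n} - {i, i + 1} \<Longrightarrow>
      s i \<otimes>\<^bsub>G\<^esub> x j = x j \<otimes>\<^bsub>G\<^esub> s i"
  shows "\<exists>h\<in>hom (FB n) G. (\<forall>j\<in>{1..n}. h (FB_x n j) = x j) \<and> (\<forall>i\<in>{1..<n}. h (FB_sigma n i) = s i)"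
proof -
  interpret G: group G by (rule G)
  obtain p where p: "p \<in> hom (free_grp n) G" "\<forall>j\<in>{1..n}. p (free_gen n j) = x j"
    using free_grp_universal[OF G, of n x] x by blast
  obtain r where r: "r \<in> hom (braid_grp n) G" "\<forall>i\<in>{1..<n}. r (braid_gen n i) = s i"
    using braid_grp_universal[OF G, of n s] s braid comm by blast
  interpret p: group_hom "free_grp n" G p by unfold_locales (rule p)
  interpret r: group_hom "braid_grp n" G r by unfold_locales (rule r)
  let ?t = "artin_action n"
  have gen_compat: "s i \<otimes>\<^bsub>G\<^esub> p b = p (?t (braid_gen n i) b) \<otimes>\<^bsub>G\<^esub> s i"
    if i: "i \<in> {1..<n}" and b: "b \<in> carrier (free_grp n)" for i b
  proof -
    let ?th = "?t (braid_gen n i)"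
    have si: "s i \<in> carrier G" by (rule s[OF i])
    have th: "?th \<in> hom (free_grp n) (free_grp n)"
      using artin_action_auto[of "braid_gen n i"] i by (simp add: auto_def)
    have th_x: "?th (free_gen n i) = free_gen n (i + 1)"
      "?th (free_gen n (i + 1)) = inv\<^bsub>free_grp n\<^esub> (free_gen n (i + 1)) \<otimes>\<^bsub>free_grp n\<^esub> free_gen n i
            \<otimes>\<^bsub>free_grp n\<^esub> free_gen n (i + 1)"
      "\<And>j. j \<in> {1..n} - {i, i + 1} \<Longrightarrow> ?th (free_gen n j) = free_gen n j"
      using artin_action_spec[of n] i unfolding artin_action_spec_def by blast+
    have conj: "(\<lambda>b. s i \<otimes>\<^bsub>G\<^esub> p b \<otimes>\<^bsub>G\<^esub> inv\<^bsub>G\<^esub> s i) \<in> hom (free_grp n) G"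
      by (rule homI) (use si in \<open>simp_all add: G.m_assoc\<close>)
    have "(p \<circ> ?th) b = s i \<otimes>\<^bsub>G\<^esub> p b \<otimes>\<^bsub>G\<^esub> inv\<^bsub>G\<^esub> s i"
    proof (rule free_grp_hom_unique[OF G _ conj _ b])
      show "p \<circ> ?th \<in> hom (free_grp n) G" 
        by (rule homI) (simp_all add: hom_in_carrier[OF th] hom_mult[OF th])
      fix j assume j: "j \<in> {1..n}"
      have i': "i \<in> {1..n}" "i + 1 \<in> {1..n}" using i by auto
      have xs: "x i \<in> carrier G" "x (i + 1) \<in> carrier G" using x i' by blast+
      consider "j = i" | "j = i + 1" | "j \<in> {1..n} - {i, i + 1}" using j by blast
      then show "(p \<circ> ?th) (free_gen n j) = s i \<otimes>\<^bsub>G\<^esub> p (free_gen n j) \<otimes>\<^bsub>G\<^esub> inv\<^bsub>G\<^esub> s i"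
      proof cases
        case 1
        then have "(p \<circ> ?th) (free_gen n j) = x (i + 1)" "p (free_gen n j) = x i"
          using th_x p(2) i' by simp_all
        then show ?thesis using mix1[OF i] si xs by (simp add: G.m_assoc)
      next
        case 2
        have fg: "free_gen n i \<in> carrier (free_grp n)" "free_gen n (i + 1) \<in> carrier (free_grp n)"
          using i' free_gen_closed by blast+
        have "(p \<circ> ?th) (free_gen n j) = inv\<^bsub>G\<^esub> x (i + 1) \<otimes>\<^bsub>G\<^esub> x i \<otimes>\<^bsub>G\<^esub> x (i + 1)"
          using 2 th_x(2) p(2) i' fg by simp
        moreover have "p (free_gen n j) = x (i + 1)" using 2 p(2) i' by simp
        moreover have "x i \<otimes>\<^bsub>G\<^esub> x (i + 1) = x (i + 1) \<otimes>\<^bsub>G\<^esub> (s i \<otimes>\<^bsub>G\<^esub> x (i + 1) \<otimes>\<^bsub>G\<^esub> inv\<^bsub>G\<^esub> s i)"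
        proof -
          have "x i \<otimes>\<^bsub>G\<^esub> x (i + 1) = (x i \<otimes>\<^bsub>G\<^esub> x (i + 1)) \<otimes>\<^bsub>G\<^esub> s i \<otimes>\<^bsub>G\<^esub> inv\<^bsub>G\<^esub> s i"
            using si xs by (simp add: G.m_assoc)
          also have "\<dots> = (s i \<otimes>\<^bsub>G\<^esub> x i) \<otimes>\<^bsub>G\<^esub> x (i + 1) \<otimes>\<^bsub>G\<^esub> inv\<^bsub>G\<^esub> s i"
            unfolding mix2[OF i, symmetric] using si xs by (simp add: G.m_assoc)
          finally show ?thesis unfolding mix1[OF i] using si xs by (simp add: G.m_assoc)
        qed
        ultimately show ?thesis using si xs by (simp add: G.m_assoc)
      next
        case 3
        then have "(p \<circ> ?th) (free_gen n j) = x j" "p (free_gen n j) = x j"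
          using th_x(3) p(2) by simp_all
        then show ?thesis using mix3[OF i 3] si x[OF j] by (simp add: G.m_assoc)
      qed
    qed
    moreover have "p (?th b) \<in> carrier G" using artin_action_closed i b by simp
    ultimately show ?thesis using si b by (simp add: G.m_assoc)
  qed
  have compat: "\<forall>b\<in>carrier (free_grp n). r u \<otimes>\<^bsub>G\<^esub> p b = p (?t u b) \<otimes>\<^bsub>G\<^esub> r u"
    if "u \<in> carrier (braid_grp n)" for u
    using that
  proof (induction rule: braid_grp_induct)
    case one
    then show ?case by (simp add: artin_action_one)
  next
    case (gen i t)
    have si: "s i \<in> carrier G" "r (braid_gen n i) = s i" using s r(2) gen.hyps by auto
    show ?case
    proof
      fix b assume b: "b \<in> carrier (free_grp n)"
      have tb: "?t t b \<in> carrier (free_grp n)" using artin_action_closed gen.hyps b by simp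
      have ttb: "?t (braid_gen n i) (?t t b) \<in> carrier (free_grp n)"
        using artin_action_closed gen.hyps tb by simp
      have "r (braid_gen n i \<otimes>\<^bsub>braid_grp n\<^esub> t) \<otimes>\<^bsub>G\<^esub> p b = s i \<otimes>\<^bsub>G\<^esub> (r t \<otimes>\<^bsub>G\<^esub> p b)"
        using si gen.hyps b by (simp add: G.m_assoc)
      also have "\<dots> = (s i \<otimes>\<^bsub>G\<^esub> p (?t t b)) \<otimes>\<^bsub>G\<^esub> r t"
        using gen.IH b si gen.hyps tb by (simp add: G.m_assoc)
      also have "\<dots> = p (?t (braid_gen n i) (?t t b)) \<otimes>\<^bsub>G\<^esub> (s i \<otimes>\<^bsub>G\<^esub> r t)"
        unfolding gen_compat[OF gen.hyps(1) tb]
        using si gen.hyps ttb by (simp add: G.m_assoc)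
      finally show "r (braid_gen n i \<otimes>\<^bsub>braid_grp n\<^esub> t) \<otimes>\<^bsub>G\<^esub> p b
          = p (?t (braid_gen n i \<otimes>\<^bsub>braid_grp n\<^esub> t) b) \<otimes>\<^bsub>G\<^esub> r (braid_gen n i \<otimes>\<^bsub>braid_grp n\<^esub> t)"
        using si gen.hyps b by (simp add: artin_action_mult)
    qed
  next
    case (inv i t)
    let ?u = "inv\<^bsub>braid_grp n\<^esub> (braid_gen n i)"
    have si: "s i \<in> carrier G" "r (braid_gen n i) = s i" using s r(2) inv.hyps by auto
    have u: "?u \<in> carrier (braid_grp n)" "braid_gen n i \<in> carrier (braid_grp n)" using inv.hyps by auto
    show ?case
    proof
      fix b assume b: "b \<in> carrier (free_grp n)"
      let ?b = "?t t b" and ?b' = "?t ?u (?t t b)"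
      have tb: "?b \<in> carrier (free_grp n)" using artin_action_closed inv.hyps b by simp
      have ttb: "?b' \<in> carrier (free_grp n)" using artin_action_closed u tb by simp
      have "?t (braid_gen n i) ?b' = ?b"
        using artin_action_mult[of "braid_gen n i" ?u ?b] u tb by (simp add: artin_action_one)
      then have "s i \<otimes>\<^bsub>G\<^esub> p ?b' = p ?b \<otimes>\<^bsub>G\<^esub> s i"
        using gen_compat[OF inv.hyps(1) ttb] by simp
      then have "inv\<^bsub>G\<^esub> s i \<otimes>\<^bsub>G\<^esub> (s i \<otimes>\<^bsub>G\<^esub> p ?b' \<otimes>\<^bsub>G\<^esub> inv\<^bsub>G\<^esub> s i)
          = inv\<^bsub>G\<^esub> s i \<otimes>\<^bsub>G\<^esub> (p ?b \<otimes>\<^bsub>G\<^esub> s i \<otimes>\<^bsub>G\<^esub> inv\<^bsub>G\<^esub> s i)" by simp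
      then have swap: "inv\<^bsub>G\<^esub> s i \<otimes>\<^bsub>G\<^esub> p ?b = p ?b' \<otimes>\<^bsub>G\<^esub> inv\<^bsub>G\<^esub> s i"
        using si tb ttb by (simp add: G.m_assoc)
      have "r (?u \<otimes>\<^bsub>braid_grp n\<^esub> t) \<otimes>\<^bsub>G\<^esub> p b = inv\<^bsub>G\<^esub> s i \<otimes>\<^bsub>G\<^esub> (r t \<otimes>\<^bsub>G\<^esub> p b)"
        using si inv.hyps u b by (simp add: G.m_assoc)
      also have "\<dots> = (inv\<^bsub>G\<^esub> s i \<otimes>\<^bsub>G\<^esub> p ?b) \<otimes>\<^bsub>G\<^esub> r t"
        using inv.IH b si inv.hyps tb by (simp add: G.m_assoc)
      also have "\<dots> = p ?b' \<otimes>\<^bsub>G\<^esub> (inv\<^bsub>G\<^esub> s i \<otimes>\<^bsub>G\<^esub> r t)"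
        unfolding swap using si inv.hyps ttb by (simp add: G.m_assoc)
      finally show "r (?u \<otimes>\<^bsub>braid_grp n\<^esub> t) \<otimes>\<^bsub>G\<^esub> p b
          = p (?t (?u \<otimes>\<^bsub>braid_grp n\<^esub> t) b) \<otimes>\<^bsub>G\<^esub> r (?u \<otimes>\<^bsub>braid_grp n\<^esub> t)"
        using si inv.hyps u b by (simp add: artin_action_mult)
    qed
  qed
  define h where "h = (\<lambda>(a, u). p a \<otimes>\<^bsub>G\<^esub> r u)"
  have "h \<in> hom (FB n) G"
  proof (rule homI)
    fix y z assume "y \<in> carrier (FB n)" "z \<in> carrier (FB n)"
    then obtain a u b v where yz: "y = (a, u)" "z = (b, v)"
      and c: "a \<in> carrier (free_grp n)" "b \<in> carrier (free_grp n)"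
        "u \<in> carrier (braid_grp n)" "v \<in> carrier (braid_grp n)"
      by (auto simp: FB_def semidirect_def)
    have tb: "?t u b \<in> carrier (free_grp n)" using artin_action_closed c by simp
    have "h (y \<otimes>\<^bsub>FB n\<^esub> z) = p a \<otimes>\<^bsub>G\<^esub> (p (?t u b) \<otimes>\<^bsub>G\<^esub> r u) \<otimes>\<^bsub>G\<^esub> r v"
      using c tb by (simp add: yz h_def FB_def semidirect_def G.m_assoc)
    also have "p (?t u b) \<otimes>\<^bsub>G\<^esub> r u = r u \<otimes>\<^bsub>G\<^esub> p b" using compat[OF c(3)] c(2) by simp
    finally show "h (y \<otimes>\<^bsub>FB n\<^esub> z) = h y \<otimes>\<^bsub>G\<^esub> h z"
      using c by (simp add: yz h_def G.m_assoc)
  qed (auto simp: h_def FB_def semidirect_def)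
  moreover have "\<forall>j\<in>{1..n}. h (FB_x n j) = x j"
    using p(2) x by (simp add: h_def FB_x_def)
  moreover have "\<forall>i\<in>{1..<n}. h (FB_sigma n i) = s i"
    using r(2) s by (simp add: h_def FB_sigma_def)
  ultimately show ?thesis by blast
qed

end

section \<open>The Long--Moody representation of a scalar representation\<close>

lemma vpower_simps:
  "carrier (vpower n sc) = {w. \<forall>j. j \<notin> {1..n} \<longrightarrow> w j = 0}"
  "u \<oplus>\<^bsub>vpower n sc\<^esub> v = u + v"
  "\<zero>\<^bsub>vpower n sc\<^esub> = 0"
  "a \<odot>\<^bsub>vpower n sc\<^esub> v = (\<lambda>j. sc a (v j))"
  by (simp_all add: vpower_def plus_fun_def zero_fun_def)

lemma (in vector_space) kspace_vpower: "kspace (vpower n scale)"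
proof -
  have "abelian_group (vpower n scale)"
  proof (rule abelian_groupI)
    fix w assume "w \<in> carrier (vpower n scale)"
    then show "\<exists>v\<in>carrier (vpower n scale). v \<oplus>\<^bsub>vpower n scale\<^esub> w = \<zero>\<^bsub>vpower n scale\<^esub>"
      by (intro bexI[of _ "- w"]) (simp_all add: vpower_simps)
  qed (simp_all add: vpower_simps add_ac)
  then interpret abelian_group "vpower n scale" .
  show ?thesis
    by unfold_locales
      (auto simp: vpower_simps scale_right_distrib scale_left_distrib)
qed

text \<open>Linearity of the inverse comes for free, so only \<open>f\<close> has to be checked. Working with operators on all
  families, restricted at the end, lets the computations use the pointwise group structure of
  \<open>nat \<Rightarrow> 'v\<close>.\<close>

lemma (in vector_space) GL_vpowerI:
  assumes add: "\<And>u v. f (u + v) = f u + f v"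
    and sc: "\<And>a v. f (\<lambda>j. scale a (v j)) = (\<lambda>j. scale a (f v j))"
    and f: "\<And>w. w \<in> carrier (vpower n scale) \<Longrightarrow> f w \<in> carrier (vpower n scale)"
    and h: "\<And>w. w \<in> carrier (vpower n scale) \<Longrightarrow> h w \<in> carrier (vpower n scale)"
    and fh: "\<And>w. f (h w) = w" and hf: "\<And>w. h (f w) = w"
  shows "restrict f (carrier (vpower n scale)) \<in> carrier (GL (vpower n scale))"
proof -
  interpret W: kspace "vpower n scale" by (rule kspace_vpower)
  have h_add: "h (u + v) = h u + h v" for u v
    using hf[of "h u + h v"] by (simp add: add fh)
  have h_sc: "h (\<lambda>j. scale a (v j)) = (\<lambda>j. scale a (h v j))" for a v
    using hf[of "\<lambda>j. scale a (h v j)"] by (simp add: sc fh)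
  show ?thesis
  proof (rule W.GL_carrierI)
    show "restrict f (carrier (vpower n scale)) \<in> carrier (End_alg (vpower n scale))"
      unfolding End_alg_carrier
      using f W.a_closed W.smult_closed by (auto simp: add sc vpower_simps(2-))
    show "restrict h (carrier (vpower n scale)) \<in> carrier (End_alg (vpower n scale))"
      unfolding End_alg_carrier
      using h W.a_closed W.smult_closed by (auto simp: h_add h_sc vpower_simps(2-))
  qed (use f h in \<open>simp_all add: fh hf\<close>)
qed

text \<open>The operators of the Long--Moody construction when all the \<open>x\<^sub>j\<close> act by \<open>g\<close>, with inverse \<open>g'\<close>, and all the
  \<open>\<sigma>\<^sub>i\<close> by the scalar \<open>c\<close>.\<close>

locale scalar_lm = vector_space scale
  for scale :: "'k::field \<Rightarrow> 'v::ab_group_add \<Rightarrow> 'v" (infixr \<open>*s\<close> 75) +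
  fixes n :: nat and g g' :: "'v \<Rightarrow> 'v" and c lam :: 'k
  assumes g_add: "g (u + v) = g u + g v"
    and g_scale: "g (a *s v) = a *s g v"
    and g_g' [simp]: "g (g' v) = v" and g'_g [simp]: "g' (g v) = v"
    and c: "c \<noteq> 0" and lam: "lam \<noteq> 0"
begin

abbreviation "M \<equiv> vpower n scale"
abbreviation "W \<equiv> carrier M"

sublocale M: kspace M by (rule kspace_vpower)

lemma g_zero [simp]: "g 0 = 0"
  using g_add[of 0 0] by simp

lemma g_minus: "g (- v) = - g v"
  using g_add[of v "- v"] by (simp add: add_eq_0_iff)

lemma g_diff: "g (u - v) = g u - g v"
  using g_add[of u "- v"] by (simp add: g_minus)

definition single :: "nat \<Rightarrow> 'v \<Rightarrow> nat \<Rightarrow> 'v" where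
  "single m v = (\<lambda>j. if j = m then v else 0)"

definition psi :: "nat \<Rightarrow> (nat \<Rightarrow> 'v) \<Rightarrow> 'v" where
  "psi i w = w i - g (w (i + 1))"

definition coef :: "nat \<Rightarrow> nat \<Rightarrow> 'k" where
  "coef i l = (if l \<le> i then lam else 1)"

text \<open>The linear map with \<open>x\<^sub>i w = w + single i (phi i w)\<close>. Writing the sum over all of \<open>{1..n}\<close>, including
  \<open>l = i\<close>, turns the diagonal coefficient \<open>lam g - 1\<close> into \<open>lam (g - 1) + (lam - 1)\<close> and makes consecutive
  \<open>phi\<close> differ by the multiple of \<open>psi\<close> in \<open>phi_step\<close>.\<close>

definition phi :: "nat \<Rightarrow> (nat \<Rightarrow> 'v) \<Rightarrow> 'v" where
  "phi i w = (\<Sum>l\<in>{1..n}. coef i l *s (g (w l) - w l)) + (lam - 1) *s w i"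

definition lm_x :: "nat \<Rightarrow> (nat \<Rightarrow> 'v) \<Rightarrow> nat \<Rightarrow> 'v" where
  "lm_x i w = w + single i (phi i w)"

text \<open>This is \<open>1 - c\<^sup>-\<^sup>1 \<sigma>\<^sub>i\<close>.\<close>

definition defect :: "nat \<Rightarrow> (nat \<Rightarrow> 'v) \<Rightarrow> nat \<Rightarrow> 'v" where
  "defect i w = single i (psi i w) - single (i + 1) (psi i w)"

definition lm_sigma :: "nat \<Rightarrow> (nat \<Rightarrow> 'v) \<Rightarrow> nat \<Rightarrow> 'v" where
  "lm_sigma i w = (\<lambda>j. c *s ((w - defect i w) j))"

lemma X_closed: "i \<in> {1..n} \<Longrightarrow> w \<in> W \<Longrightarrow> lm_x i w \<in> W"
  by (auto simp: lm_x_def single_def vpower_simps)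

lemma defect_closed: "i \<in> {1..<n} \<Longrightarrow> w \<in> W \<Longrightarrow> defect i w \<in> W"
  by (auto simp: defect_def single_def vpower_simps)

lemma S_closed: "i \<in> {1..<n} \<Longrightarrow> w \<in> W \<Longrightarrow> lm_sigma i w \<in> W"
  by (auto simp: lm_sigma_def defect_def single_def vpower_simps)

lemma LM_x_op_eq:
  assumes i: "i \<in> {1..n}"
  shows "LM_x_op n scale lam (\<lambda>_. g) i = restrict (lm_x i) W"
  unfolding LM_x_op_def
proof (intro restrict_ext ext)
  fix w j
  have "{1..n} = {1..<i} \<union> insert i {i + 1..n}" using i by auto
  then have "(\<Sum>l\<in>{1..n}. coef i l *s (g (w l) - w l))
      = (\<Sum>l\<in>{1..<i}. coef i l *s (g (w l) - w l)) + (coef i i *s (g (w i) - w i)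
        + (\<Sum>l\<in>{i + 1..n}. coef i l *s (g (w l) - w l)))"
    by (simp only:) (subst sum.union_disjoint; auto)
  also have "(\<Sum>l\<in>{1..<i}. coef i l *s (g (w l) - w l)) = (\<Sum>l\<in>{1..<i}. lam *s (g (w l) - w l))"
    by (rule sum.cong) (auto simp: coef_def)
  also have "(\<Sum>l\<in>{i + 1..n}. coef i l *s (g (w l) - w l)) = (\<Sum>l\<in>{i + 1..n}. g (w l) - w l)"
    by (rule sum.cong) (auto simp: coef_def)
  finally show "(if j = i
     then (\<Sum>l\<in>{1..<i}. lam *s (g (w l) - w l)) + lam *s g (w i) + (\<Sum>l\<in>{i + 1..n}. g (w l) - w l)
     else w j) = lm_x i w j"
    by (simp add: lm_x_def phi_def single_def coef_def algebra_simps)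
qed

lemma LM_sigma_op_eq: "LM_sigma_op n scale (\<lambda>_. g) (\<lambda>_. scale c) i = restrict (lm_sigma i) W"
  unfolding LM_sigma_op_def
  by (intro restrict_ext ext) (auto simp: lm_sigma_def defect_def single_def psi_def algebra_simps)

lemma phi_add: "phi i (u + v) = phi i u + phi i v"
  by (simp add: phi_def g_add algebra_simps sum.distrib sum_subtractf)

lemma phi_diff: "phi i (u - v) = phi i u - phi i v"
  by (simp add: phi_def g_diff algebra_simps sum.distrib sum_subtractf)

lemma phi_scale: "phi i (\<lambda>j. a *s v j) = a *s phi i v"
  by (simp add: phi_def g_scale algebra_simps scale_sum_right mult.commute)

lemma phi_single:
  assumes "m \<in> {1..n}"
  shows "phi i (single m v) = coef i m *s (g v - v) + (if i = m then (lam - 1) *s v else 0)"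
proof -
  have "(\<Sum>l\<in>{1..n}. coef i l *s (g (single m v l) - single m v l))
      = (\<Sum>l\<in>{1..n}. if l = m then coef i m *s (g v - v) else 0)"
    by (rule sum.cong) (auto simp: single_def)
  also have "\<dots> = coef i m *s (g v - v)" using assms by simp
  finally show ?thesis by (simp add: phi_def single_def)
qed

lemma phi_step: "phi i w - phi (i + 1) w = (lam - 1) *s psi i w" if "i \<in> {1..<n}"
proof -
  have "(\<Sum>l\<in>{1..n}. coef (i + 1) l *s (g (w l) - w l)) - (\<Sum>l\<in>{1..n}. coef i l *s (g (w l) - w l))
      = (\<Sum>l\<in>{1..n}. if l = i + 1 then (lam - 1) *s (g (w l) - w l) else 0)"
    unfolding sum_subtractf[symmetric] by (rule sum.cong) (auto simp: coef_def algebra_simps)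
  also have "\<dots> = (lam - 1) *s (g (w (i + 1)) - w (i + 1))" using that by simp
  finally show ?thesis
    by (simp add: phi_def psi_def algebra_simps)
qed

lemma phi_defect:
  assumes i: "i \<in> {1..<n}"
  shows "phi i (defect i w) = (lam - 1) *s g (psi i w)"
    and "phi (i + 1) (defect i w) = - ((lam - 1) *s psi i w)"
    and "k \<noteq> i \<Longrightarrow> k \<noteq> i + 1 \<Longrightarrow> phi k (defect i w) = 0"
proof -
  have m: "i \<in> {1..n}" "i + 1 \<in> {1..n}" using i by auto
  show "phi i (defect i w) = (lam - 1) *s g (psi i w)"
    unfolding defect_def phi_diff phi_single[OF m(1)] phi_single[OF m(2)]
    by (simp add: coef_def algebra_simps)
  show "phi (i + 1) (defect i w) = - ((lam - 1) *s psi i w)"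
    unfolding defect_def phi_diff phi_single[OF m(1)] phi_single[OF m(2)]
    by (simp add: coef_def algebra_simps)
  show "phi k (defect i w) = 0" if "k \<noteq> i" "k \<noteq> i + 1"
    unfolding defect_def phi_diff phi_single[OF m(1)] phi_single[OF m(2)]
    using that by (auto simp: coef_def)
qed

text \<open>By \<open>phi_step\<close>, the correction that \<open>defect\<close> makes to \<open>phi\<close> is exactly the difference between neighbouring \<open>phi\<close>.\<close>

lemma phi_S:
  assumes i: "i \<in> {1..<n}"
  shows "phi i (lm_sigma i w) = c *s (phi i w - g (phi i w) + g (phi (i + 1) w))"
    and "phi (i + 1) (lm_sigma i w) = c *s phi i w"
    and "k \<noteq> i \<Longrightarrow> k \<noteq> i + 1 \<Longrightarrow> phi k (lm_sigma i w) = c *s phi k w"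
proof -
  have step: "phi i w = phi (i + 1) w + (lam - 1) *s psi i w"
    using phi_step[OF i, of w] by (simp add: algebra_simps)
  show "phi (i + 1) (lm_sigma i w) = c *s phi i w"
    unfolding lm_sigma_def phi_scale phi_diff phi_defect(2)[OF i] step by (simp add: algebra_simps)
  have g_step: "(lam - 1) *s g (psi i w) = g (phi i w) - g (phi (i + 1) w)"
    unfolding step by (simp add: g_add g_scale)
  show "phi i (lm_sigma i w) = c *s (phi i w - g (phi i w) + g (phi (i + 1) w))"
    unfolding lm_sigma_def phi_scale phi_diff phi_defect(1)[OF i] g_step by simp
  show "phi k (lm_sigma i w) = c *s phi k w" if "k \<noteq> i" "k \<noteq> i + 1"
    unfolding lm_sigma_def phi_scale phi_diff phi_defect(3)[OF i that] by simp
qed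

lemma S_add: "lm_sigma i (u + v) = lm_sigma i u + lm_sigma i v"
  by (rule ext) (simp add: lm_sigma_def defect_def single_def psi_def g_add algebra_simps)

lemma S_scale: "lm_sigma i (\<lambda>j. a *s v j) = (\<lambda>j. a *s lm_sigma i v j)"
  by (rule ext) (simp add: lm_sigma_def defect_def single_def psi_def g_scale algebra_simps mult.commute)

lemma X_add: "lm_x i (u + v) = lm_x i u + lm_x i v"
  by (rule ext) (simp add: lm_x_def single_def phi_add algebra_simps)

lemma X_scale: "lm_x i (\<lambda>j. a *s v j) = (\<lambda>j. a *s lm_x i v j)"
  by (rule ext) (simp add: lm_x_def single_def phi_scale algebra_simps)

lemma S_single:
  "lm_sigma i (single i v) = (\<lambda>j. c *s single (i + 1) v j)"
  "lm_sigma i (single (i + 1) v) = (\<lambda>j. c *s (single (i + 1) (v - g v) j + single i (g v) j))"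
  "j \<noteq> i \<Longrightarrow> j \<noteq> i + 1 \<Longrightarrow> lm_sigma i (single j v) = (\<lambda>k. c *s single j v k)"
  by (rule ext; simp add: lm_sigma_def defect_def single_def psi_def g_minus algebra_simps; fail)+

lemma S_X_next:
  assumes "i \<in> {1..<n}"
  shows "lm_sigma i (lm_x i w) = lm_x (i + 1) (lm_sigma i w)"
  unfolding lm_x_def S_add S_single phi_S(2)[OF assms]
  by (rule ext) (simp add: single_def)

lemma S_X_commute:
  assumes "i \<in> {1..<n}" "j \<noteq> i" "j \<noteq> i + 1"
  shows "lm_sigma i (lm_x j w) = lm_x j (lm_sigma i w)"
  unfolding lm_x_def S_add S_single(3)[OF assms(2,3)] phi_S(3)[OF assms]
  by (rule ext) (simp add: single_def)

lemma X_X: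
  assumes i: "i \<in> {1..<n}"
  shows "lm_x i (lm_x (i + 1) w) = w + single (i + 1) (phi (i + 1) w)
    + single i (phi i w + (g (phi (i + 1) w) - phi (i + 1) w))"
proof -
  have m: "i + 1 \<in> {1..n}" using i by auto
  show ?thesis
    unfolding lm_x_def phi_add phi_single[OF m] by (simp add: coef_def)
qed

lemma S_X_X:
  assumes i: "i \<in> {1..<n}"
  shows "lm_sigma i (lm_x i (lm_x (i + 1) w)) = lm_x i (lm_x (i + 1) (lm_sigma i w))"
  unfolding X_X[OF i] S_add S_single phi_S(1,2)[OF i]
  by (rule ext) (simp add: single_def g_scale algebra_simps)

lemma S_braid: "lm_sigma i (lm_sigma (i + 1) (lm_sigma i w)) = lm_sigma (i + 1) (lm_sigma i (lm_sigma (i + 1) w))"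
proof
  fix j
  consider "j = i" | "j = Suc i" | "j = Suc (Suc i)" | "j \<noteq> i" "j \<noteq> Suc i" "j \<noteq> Suc (Suc i)" by blast
  then show "lm_sigma i (lm_sigma (i + 1) (lm_sigma i w)) j = lm_sigma (i + 1) (lm_sigma i (lm_sigma (i + 1) w)) j"
    by cases (simp_all add: lm_sigma_def defect_def single_def psi_def g_scale g_diff g_add algebra_simps)
qed

lemma S_commute:
  assumes "i + 2 \<le> k"
  shows "lm_sigma i (lm_sigma k w) = lm_sigma k (lm_sigma i w)"
proof
  fix j
  consider "j = i" | "j = Suc i" | "j = k" | "j = Suc k" | "j \<noteq> i" "j \<noteq> Suc i" "j \<noteq> k" "j \<noteq> Suc k" by blast
  then show "lm_sigma i (lm_sigma k w) j = lm_sigma k (lm_sigma i w) j"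
    by cases (use assms in \<open>simp_all add: lm_sigma_def defect_def single_def psi_def g_scale g_diff g_add algebra_simps\<close>)
qed

text \<open>Only entry \<open>i\<close> changes, and the terms of its new value other than \<open>lam g (w\<^sub>i)\<close> do not depend on entry \<open>i\<close>, so
  the equation for the \<open>i\<close>-th entry can be solved.\<close>

lemma X_GL:
  assumes i: "i \<in> {1..n}"
  shows "restrict (lm_x i) W \<in> carrier (GL M)"
proof -
  define rest where "rest w = (\<Sum>l\<in>{1..n} - {i}. coef i l *s (g (w l) - w l))" for w
  have rest: "rest (w(i := v)) = rest w" for w v
    unfolding rest_def by (rule sum.cong) auto
  have lm_x: "lm_x i w = w(i := lam *s g (w i) + rest w)" for w
  proof
    fix j
    have "(\<Sum>l\<in>{1..n}. coef i l *s (g (w l) - w l)) = lam *s (g (w i) - w i) + rest w"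
      using sum.remove[OF finite_atLeastAtMost i, of "\<lambda>l. coef i l *s (g (w l) - w l)"]
      by (simp only: rest_def) (simp add: coef_def)
    then show "lm_x i w j = (w(i := lam *s g (w i) + rest w)) j"
      by (simp add: lm_x_def single_def phi_def algebra_simps)
  qed
  show ?thesis
  proof (rule GL_vpowerI[where h = "\<lambda>w. w(i := g' (inverse lam *s (w i - rest w)))"])
    show "lm_x i (w(i := g' (inverse lam *s (w i - rest w)))) = w" for w
      using lam by (simp add: lm_x rest)
    show "(lm_x i w)(i := g' (inverse lam *s (lm_x i w i - rest (lm_x i w)))) = w" for w
      using lam by (simp add: lm_x rest)
    show "w(i := g' (inverse lam *s (w i - rest w))) \<in> W" if "w \<in> W" for w
      using that i by (auto simp: vpower_simps)
  qed (simp_all add: X_add X_scale X_closed[OF i])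
qed

lemma S_GL:
  assumes i: "i \<in> {1..<n}"
  shows "restrict (lm_sigma i) W \<in> carrier (GL M)"
proof (rule GL_vpowerI[where h = "\<lambda>w j. inverse c *s
    (if j = i then w (i + 1) - g' (w i) + w i else if j = i + 1 then g' (w i) else w j)"])
  have g'_scale: "g' (a *s v) = a *s g' v" for a v
    using g'_g[of "a *s g' v"] by (simp add: g_scale del: g'_g)
  let ?h = "\<lambda>w j. inverse c *s
    (if j = i then w (i + 1) - g' (w i) + w i else if j = i + 1 then g' (w i) else w j)"
  show "lm_sigma i (?h w) = w" for w
    by (rule ext) (use c in \<open>simp add: lm_sigma_def defect_def single_def psi_def g_scale g_diff algebra_simps\<close>)
  show "?h (lm_sigma i w) = w" for w
    by (rule ext) (use c in \<open>simp add: lm_sigma_def defect_def single_def psi_def g'_scale algebra_simps\<close>)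
  show "?h w \<in> W" if "w \<in> W" for w
    using that i by (auto simp: vpower_simps)
qed (simp_all add: S_add S_scale S_closed[OF i])

theorem LM_rep_exists:
  "\<exists>h\<in>hom (FB n) (GL M). (\<forall>j\<in>{1..n}. h (FB_x n j) = restrict (lm_x j) W) \<and>
    (\<forall>i\<in>{1..<n}. h (FB_sigma n i) = restrict (lm_sigma i) W)"
proof -
  have End: "restrict (lm_x j) W \<in> carrier (End_alg M)" if "j \<in> {1..n}" for j
    by (rule GL_carrier_End[OF X_GL[OF that]])
  have End': "restrict (lm_sigma i) W \<in> carrier (End_alg M)" if "i \<in> {1..<n}" for i
    by (rule GL_carrier_End[OF S_GL[OF that]])
  have nx: "i \<in> {1..n}" "i + 1 \<in> {1..n}" if "i \<in> {1..<n}" for i using that by auto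
  note simps = GL_mult M.End_alg_closures End End' End_alg_apply S_closed X_closed nx
  show ?thesis
  proof (rule FB_universal[OF M.group_GL X_GL S_GL], assumption, assumption)
    fix i assume i: "i \<in> {1..<n}"
    note i' = nx[OF i]
    show "restrict (lm_sigma i) W \<otimes>\<^bsub>GL M\<^esub> restrict (lm_x i) W = restrict (lm_x (i + 1)) W \<otimes>\<^bsub>GL M\<^esub> restrict (lm_sigma i) W"
      by (rule End_alg_eqI[where M = M])
        (use i i' S_X_next[OF i] in \<open>simp_all add: simps del: One_nat_def add_Suc_right atLeastAtMost_iff atLeastLessThan_iff\<close>)
    show "restrict (lm_sigma i) W \<otimes>\<^bsub>GL M\<^esub> (restrict (lm_x i) W \<otimes>\<^bsub>GL M\<^esub> restrict (lm_x (i + 1)) W)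
        = restrict (lm_x i) W \<otimes>\<^bsub>GL M\<^esub> restrict (lm_x (i + 1)) W \<otimes>\<^bsub>GL M\<^esub> restrict (lm_sigma i) W"
      by (rule End_alg_eqI[where M = M])
        (use i i' S_X_X[OF i] in \<open>simp_all add: simps del: One_nat_def add_Suc_right atLeastAtMost_iff atLeastLessThan_iff\<close>)
    show "restrict (lm_sigma i) W \<otimes>\<^bsub>GL M\<^esub> restrict (lm_x j) W = restrict (lm_x j) W \<otimes>\<^bsub>GL M\<^esub> restrict (lm_sigma i) W"
      if j: "j \<in> {1..n} - {i, i + 1}" for j
    proof -
      have j': "j \<in> {1..n}" "j \<noteq> i" "j \<noteq> i + 1" using j by auto
      show ?thesis
        by (rule End_alg_eqI[where M = M])
          (use i j'(1) S_X_commute[OF i j'(2,3)] in \<open>simp_all add: simps del: One_nat_def add_Suc_right atLeastAtMost_iff atLeastLessThan_iff\<close>)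
    qed
    show "restrict (lm_sigma i) W \<otimes>\<^bsub>GL M\<^esub> restrict (lm_sigma (i + 1)) W \<otimes>\<^bsub>GL M\<^esub> restrict (lm_sigma i) W
        = restrict (lm_sigma (i + 1)) W \<otimes>\<^bsub>GL M\<^esub> restrict (lm_sigma i) W \<otimes>\<^bsub>GL M\<^esub> restrict (lm_sigma (i + 1)) W"
      if "i + 1 \<in> {1..<n}"
      by (rule End_alg_eqI[where M = M])
        (use i that S_braid[of i] in \<open>simp_all add: simps del: One_nat_def add_Suc_right atLeastAtMost_iff atLeastLessThan_iff\<close>)
    show "restrict (lm_sigma i) W \<otimes>\<^bsub>GL M\<^esub> restrict (lm_sigma j) W = restrict (lm_sigma j) W \<otimes>\<^bsub>GL M\<^esub> restrict (lm_sigma i) W"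
      if "j \<in> {1..<n}" "i + 2 \<le> j" for j
      by (rule End_alg_eqI[where M = M])
        (use i that(1) S_commute[OF that(2)] in \<open>simp_all add: simps del: One_nat_def add_Suc_right atLeastAtMost_iff atLeastLessThan_iff\<close>)
  qed
qed

end

section \<open>Semisimple operators with at most two eigenvalues\<close>

context finite_dimensional_vector_space
begin

text \<open>The value \<open>p(g) w\<close>.\<close>

definition poly_act :: "('b \<Rightarrow> 'b) \<Rightarrow> 'b \<Rightarrow> 'a poly \<Rightarrow> 'b" where
  "poly_act g w p = fold_coeffs (\<lambda>a v. scale a w + g v) p 0"

context
  fixes g :: "'b \<Rightarrow> 'b" and w :: 'b
  assumes g_add: "\<And>u v. g (u + v) = g u + g v" and g_scale: "\<And>a v. g (scale a v) = scale a (g v)"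
begin

lemma poly_act_zero [simp]: "poly_act g w 0 = 0"
  by (simp add: poly_act_def)

lemma poly_act_pCons [simp]: "poly_act g w (pCons a p) = scale a w + g (poly_act g w p)"
proof (cases "a = 0 \<and> p = 0")
  case True
  have "g 0 = 0" using g_add[of 0 0] by simp
  then show ?thesis using True by simp
qed (auto simp: poly_act_def fold_coeffs_pCons_not_0_0_eq fold_coeffs_pCons_coeff_not_0_eq)

lemma poly_act_add: "poly_act g w (p + q) = poly_act g w p + poly_act g w q"
  by (induction p q rule: poly_induct2) (simp_all add: g_add scale_left_distrib)

lemma poly_act_smult: "poly_act g w (Polynomial.smult a p) = scale a (poly_act g w p)"
  by (induction p) (simp_all add: g_scale scale_right_distrib)

lemma poly_act_monom: "poly_act g w (monom 1 m) = (g ^^ m) w"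
proof (induction m)
  case 0
  have "g 0 = 0" using g_add[of 0 0] by simp
  then show ?case by (simp add: monom_0)
qed (simp add: monom_Suc)

lemma poly_act_linear_factor:
  "poly_act g w ([:- a, 1:] * q) = g (poly_act g w q) - scale a (poly_act g w q)"
proof -
  have eq: "[:- a, 1:] * q = pCons 0 q + Polynomial.smult (- a) q" by simp
  show ?thesis unfolding eq by (simp only: poly_act_add poly_act_smult poly_act_pCons) simp
qed

text \<open>The coefficient bound is what keeps \<open>X\<^sup>m - p\<close> from vanishing in \<open>exists_annihilator\<close>.\<close>

lemma span_iterates:
  assumes "v \<in> span ((\<lambda>i. (g ^^ i) w) ` {..<m})"
  shows "\<exists>p. (\<forall>i\<ge>m. coeff p i = 0) \<and> v = poly_act g w p"
  using assms
proof (induction m arbitrary: v)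
  case 0
  then show ?case by (intro exI[of _ 0]) simp
next
  case (Suc m)
  from Suc.prems obtain k where "v - scale k ((g ^^ m) w) \<in> span ((\<lambda>i. (g ^^ i) w) ` {..<m})"
    by (auto simp: lessThan_Suc span_breakdown_eq)
  then obtain p where p: "\<forall>i\<ge>m. coeff p i = 0" "v - scale k ((g ^^ m) w) = poly_act g w p"
    using Suc.IH by blast
  then show ?case
    by (intro exI[of _ "p + Polynomial.smult k (monom 1 m)"])
      (auto simp: poly_act_add poly_act_smult poly_act_monom algebra_simps)
qed

text \<open>If no iterate lay in the span of the earlier ones, the iterates would give independent sets of every finite
  size.\<close>

lemma exists_annihilator: "\<exists>p. p \<noteq> 0 \<and> poly_act g w p = 0"
proof -
  let ?f = "\<lambda>i. (g ^^ i) w"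
  have "\<exists>m. ?f m \<in> span (?f ` {..<m})"
  proof (rule ccontr)
    assume no: "\<nexists>m. ?f m \<in> span (?f ` {..<m})"
    have new: "?f m \<notin> span (?f ` {..<m})" for m by (rule notI) (rule notE[OF no], rule exI)
    have "independent (?f ` {..<m}) \<and> card (?f ` {..<m}) = m" for m
    proof (induction m)
      case (Suc m)
      have "?f m \<notin> ?f ` {..<m}" by (rule contra_subsetD[OF span_superset new])
      then show ?case using Suc new[of m] by (simp only: lessThan_Suc image_insert independent_insert) simp
    qed (simp add: independent_empty)
    then have "independent (?f ` {..<Suc dimension})" "card (?f ` {..<Suc dimension}) = Suc dimension"
      by blast+
    then show False
      using independent_card_le_dim[of "?f ` {..<Suc dimension}" UNIV] dim_subset_UNIV[of UNIV] by simp
  qed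
  then obtain m p where p: "\<forall>i\<ge>m. coeff p i = 0" "?f m = poly_act g w p"
    using span_iterates by blast
  have "poly_act g w (monom 1 m + Polynomial.smult (- 1) p) = 0"
    using p(2) by (simp only: poly_act_add poly_act_smult poly_act_monom) simp
  moreover have "coeff (monom 1 m + Polynomial.smult (- 1) p) m \<noteq> 0" using p(1) by simp
  then have "monom 1 m + Polynomial.smult (- 1) p \<noteq> 0" by (metis coeff_0)
  ultimately show ?thesis by blast
qed

end

end

text \<open>Take \<open>p\<close> of least degree with \<open>p(g) w = 0\<close> and a root \<open>a\<close>; then \<open>p = (X - a) q\<close> and \<open>q(g) w\<close> is an
  eigenvector.\<close>

lemma invariant_subspace_eigenvector:
  fixes scale :: "'k::alg_closed_field \<Rightarrow> 'v::ab_group_add \<Rightarrow> 'v"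
  assumes "finite_dimensional_vector_space scale Basis"
    and g_add: "\<And>u v. g (u + v) = g u + g v" and g_scale: "\<And>a v. g (scale a v) = scale a (g v)"
    and W: "module.subspace scale W" and inv: "g ` W \<subseteq> W" and w: "w \<in> W" "w \<noteq> 0"
  shows "\<exists>v\<in>W. v \<noteq> 0 \<and> (\<exists>a. g v = scale a v)"
proof -
  interpret finite_dimensional_vector_space scale Basis by fact
  note act = poly_act_zero[OF g_add g_scale] poly_act_pCons[OF g_add g_scale] poly_act_linear_factor[OF g_add g_scale]
  let ?P = "\<lambda>p. p \<noteq> 0 \<and> poly_act g w p = 0"
  obtain p0 where "?P p0" using exists_annihilator[OF g_add g_scale] by blast
  from ex_has_least_nat[where P = ?P and m = degree, OF this]
  obtain p where p: "?P p" and min: "\<And>q. ?P q \<Longrightarrow> degree p \<le> degree q" by blast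
  have "degree p > 0"
  proof (rule ccontr)
    assume "\<not> degree p > 0"
    then obtain k where k: "p = [:k:]" by (metis degree_eq_zeroE gr_zeroI)
    have "g 0 = 0" using g_add[of 0 0] by simp
    then show False using p w by (simp add: k act)
  qed
  then obtain a where "poly p a = 0" using alg_closed_imp_poly_has_root by blast
  then obtain q where q: "p = [:- a, 1:] * q" by (auto simp: poly_eq_0_iff_dvd dvd_def)
  then have "q \<noteq> 0" using p by auto
  then have "degree q < degree p" unfolding q by (subst degree_mult_eq) simp_all
  then have "poly_act g w q \<noteq> 0" using min[of q] \<open>q \<noteq> 0\<close> by auto
  moreover have "g (poly_act g w q) = scale a (poly_act g w q)"
    using p unfolding q act by simp
  moreover have "poly_act g w r \<in> W" for r
    by (induction r) (use inv w W in \<open>auto simp: act subspace_0 intro!: subspace_add subspace_scale\<close>)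
  ultimately show ?thesis by blast
qed

text \<open>An invariant complement of \<open>Ker (g - 1) + Ker (g - \<mu>)\<close> that is nonzero would contain an eigenvector, whose
  eigenvalue \<open>1\<close> or \<open>\<mu>\<close> puts it into that sum. So the sum is everything, and \<open>g - \<mu>\<close> maps it into
  \<open>Ker (g - 1)\<close>.\<close>

lemma semisimple_two_eigenvalues:
  fixes scale :: "'k::alg_closed_field \<Rightarrow> 'v::ab_group_add \<Rightarrow> 'v"
  assumes fin: "finite_dimensional_vector_space scale Basis"
    and g_add: "\<And>u v. g (u + v) = g u + g v" and g_scale: "\<And>a v. g (scale a v) = scale a (g v)"
    and ss: "semisimple_op scale g" and spec: "spec scale g - {1} \<subseteq> {\<mu>}"
  shows "g (g v - scale \<mu> v) = g v - scale \<mu> v"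
proof -
  interpret finite_dimensional_vector_space scale Basis by fact
  define U where "U = {u1 + u2 | u1 u2. g u1 = u1 \<and> g u2 = scale \<mu> u2}"
  have g0: "g 0 = 0" using g_add[of 0 0] by simp
  have mem: "g u1 = u1 \<Longrightarrow> g u2 = scale \<mu> u2 \<Longrightarrow> u1 + u2 \<in> U" for u1 u2
    by (auto simp: U_def)
  have U: "subspace U"
  proof (rule subspaceI)
    show "0 \<in> U" using mem[of 0 0] g0 by simp
    fix x y a assume "x \<in> U"
    then obtain x1 x2 where x: "x = x1 + x2" "g x1 = x1" "g x2 = scale \<mu> x2" by (auto simp: U_def)
    then show "scale a x \<in> U"
      using mem[of "scale a x1" "scale a x2"] by (simp add: g_scale scale_right_distrib mult.commute)
    assume "y \<in> U"
    then obtain y1 y2 where y: "y = y1 + y2" "g y1 = y1" "g y2 = scale \<mu> y2" by (auto simp: U_def)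
    then show "x + y \<in> U"
      using mem[of "x1 + y1" "x2 + y2"] x by (simp add: g_add scale_right_distrib add_ac)
  qed
  moreover have "g ` U \<subseteq> U"
  proof clarify
    fix x assume "x \<in> U"
    then obtain x1 x2 where x: "x = x1 + x2" "g x1 = x1" "g x2 = scale \<mu> x2" by (auto simp: U_def)
    then show "g x \<in> U" using mem[of x1 "scale \<mu> x2"] by (simp add: g_add g_scale)
  qed
  ultimately have "\<exists>C. subspace C \<and> g ` C \<subseteq> C \<and> U \<inter> C = {0} \<and> {u + w | u w. u \<in> U \<and> w \<in> C} = UNIV"
    using ss[unfolded semisimple_op_def, rule_format, of U] by simp
  then obtain C where C: "subspace C" "g ` C \<subseteq> C" "U \<inter> C = {0}"
    "{u + w | u w. u \<in> U \<and> w \<in> C} = UNIV"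
    by (elim exE conjE) (rule that)
  have "C \<subseteq> {0}"
  proof
    fix w assume w: "w \<in> C"
    show "w \<in> {0}"
    proof (rule ccontr)
      assume "w \<notin> {0}"
      then obtain v a where v: "v \<in> C" "v \<noteq> 0" "g v = scale a v"
        using invariant_subspace_eigenvector[OF fin g_add g_scale C(1,2) w] by auto
      then have "a \<in> spec scale g" by (auto simp: spec_def)
      then have "a = 1 \<or> a = \<mu>" using spec by auto
      then have "v \<in> U" using mem[of v 0] mem[of 0 v] v(3) g0 by auto
      then show False using v C(3) by blast
    qed
  qed
  moreover obtain u w where "v = u + w" "u \<in> U" "w \<in> C" using C(4) by blast
  ultimately have "v \<in> U" by auto
  then obtain u1 u2 where u: "v = u1 + u2" "g u1 = u1" "g u2 = scale \<mu> u2" by (auto simp: U_def)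
  have "g v - scale \<mu> v = u1 + scale (- \<mu>) u1" by (simp add: u g_add algebra_simps)
  then show ?thesis using u(2) by (simp only: g_add g_scale)
qed

section \<open>The quotient representation\<close>

lemma (in vector_space) vspace_End:
  assumes "f \<in> carrier (End_alg (vspace scale))"
  shows "f (u + v) = f u + f v" "f (scale a v) = scale a (f v)"
  using assms by (simp_all add: End_alg_carrier vspace_def)

lemma (in vector_space) vspace_GL_inverse:
  assumes "f \<in> carrier (GL (vspace scale))"
  shows "\<exists>h. (\<forall>v. f (h v) = v) \<and> (\<forall>v. h (f v) = v)"
proof -
  from assms obtain h where "h \<otimes>\<^bsub>End_alg (vspace scale)\<^esub> f = \<one>\<^bsub>End_alg (vspace scale)\<^esub>"
    "f \<otimes>\<^bsub>End_alg (vspace scale)\<^esub> h = \<one>\<^bsub>End_alg (vspace scale)\<^esub>"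
    by (auto simp: GL_def units_of_def Units_def)
  then show ?thesis
    using End_alg_apply(1,2)[of _ "vspace scale"] by (metis UNIV_I partial_object.select_convs(1) vspace_def)
qed

locale scalar_klm = scalar_lm scale n g g' c lam
  for scale :: "'k::field \<Rightarrow> 'v::ab_group_add \<Rightarrow> 'v" (infixr \<open>*s\<close> 75)
    and n g g' c lam +
  fixes \<rho> :: "fb \<Rightarrow> 'v \<Rightarrow> 'v"
  assumes rho_x: "j \<in> {1..n} \<Longrightarrow> \<rho> (FB_x n j) = g"
    and rho_sigma: "i \<in> {1..<n} \<Longrightarrow> \<rho> (FB_sigma n i) = scale c"
begin

text \<open>The representation is chosen from those with prescribed values on generators; since one exists, the
  chosen one has these values.\<close>

lemma LM_rep_gens:
  shows "j \<in> {1..n} \<Longrightarrow> LM_rep n scale lam \<rho> (FB_x n j) = restrict (lm_x j) W"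
    and "i \<in> {1..<n} \<Longrightarrow> LM_rep n scale lam \<rho> (FB_sigma n i) = restrict (lm_sigma i) W"
proof -
  let ?P = "\<lambda>h. h \<in> hom (FB n) (GL M) \<and>
     (\<forall>j\<in>{1..n}. h (FB_x n j) = LM_x_op n scale lam (\<lambda>l. \<rho> (FB_x n l)) j) \<and>
     (\<forall>i\<in>{1..<n}. h (FB_sigma n i) =
        LM_sigma_op n scale (\<lambda>l. \<rho> (FB_x n l)) (\<lambda>l. \<rho> (FB_sigma n l)) i)"
  have x: "LM_x_op n scale lam (\<lambda>l. \<rho> (FB_x n l)) j = restrict (lm_x j) W" if "j \<in> {1..n}" for j
    unfolding LM_x_op_eq[OF that, symmetric] LM_x_op_def
    by (intro restrict_ext ext) (use that in \<open>auto simp: rho_x intro!: arg_cong2[where f = "(+)"] sum.cong\<close>)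
  have s: "LM_sigma_op n scale (\<lambda>l. \<rho> (FB_x n l)) (\<lambda>l. \<rho> (FB_sigma n l)) i = restrict (lm_sigma i) W"
    if "i \<in> {1..<n}" for i
    unfolding LM_sigma_op_eq[symmetric] LM_sigma_op_def
    by (intro restrict_ext ext) (use that rho_x[of i] rho_x[of "i + 1"] in \<open>auto simp: rho_sigma\<close>)
  have "\<exists>h. ?P h" using LM_rep_exists by (auto simp: x s)
  then have P: "?P (LM_rep n scale lam \<rho>)" unfolding LM_rep_def by (rule someI_ex)
  show "j \<in> {1..n} \<Longrightarrow> LM_rep n scale lam \<rho> (FB_x n j) = restrict (lm_x j) W" using P x by simp
  show "i \<in> {1..<n} \<Longrightarrow> LM_rep n scale lam \<rho> (FB_sigma n i) = restrict (lm_sigma i) W" using P s by simp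
qed

abbreviation "K \<equiv> KLM_K n scale \<rho>"
abbreviation "L \<equiv> KLM_L n scale lam \<rho>"
abbreviation "U \<equiv> KLM_sub n scale lam \<rho>"
abbreviation "Q \<equiv> KLM_space n scale lam \<rho>"

lemma K_eq: "K = {w \<in> W. \<forall>j\<in>{1..n}. g (w j) = w j}"
  using rho_x by (auto simp: KLM_K_def)

lemma L_eq: "L = {w \<in> W. \<forall>j\<in>{1..n}. phi j w = 0}"
proof -
  have "restrict (lm_x j) W w = w \<longleftrightarrow> phi j w = 0" if "w \<in> W" for j w
    using that by (auto simp: lm_x_def single_def fun_eq_iff)
  then show ?thesis by (auto simp: KLM_L_def LM_rep_gens)
qed

lemma W_add: "u \<in> W \<Longrightarrow> v \<in> W \<Longrightarrow> u + v \<in> W"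
  using M.a_closed by (simp add: vpower_simps(2))

lemma W_scale: "u \<in> W \<Longrightarrow> (\<lambda>j. a *s u j) \<in> W"
  using M.smult_closed by (simp add: vpower_simps(4))

lemma M_minus: "u \<in> W \<Longrightarrow> \<ominus>\<^bsub>M\<^esub> u = - u"
  by (simp add: M.smult_minus_one[symmetric] vpower_simps(4) fun_eq_iff)

lemma M_diff: "u \<in> W \<Longrightarrow> v \<in> W \<Longrightarrow> u \<ominus>\<^bsub>M\<^esub> v = u - v"
  by (simp add: a_minus_def M_minus vpower_simps(2))

lemma W_zero: "0 \<in> W"
  using M.zero_closed by (simp add: vpower_simps(3))

lemma W_subgroupI:
  assumes "A \<subseteq> W" "0 \<in> A" "\<And>u v. u \<in> A \<Longrightarrow> v \<in> A \<Longrightarrow> u + v \<in> A"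
    "\<And>a u. u \<in> A \<Longrightarrow> (\<lambda>j. a *s u j) \<in> A"
  shows "additive_subgroup A M"
proof (rule additive_subgroupI, rule subgroup.intro)
  have "inv\<^bsub>add_monoid M\<^esub> u \<in> A" if "u \<in> A" for u
  proof -
    have "- u \<in> A" using assms(4)[OF that, of "-1"] by (simp add: fun_Compl_def)
    moreover have "u \<in> W" using assms(1) that by blast
    ultimately show ?thesis using M_minus by (simp add: a_inv_def)
  qed
  then show "inv\<^bsub>add_monoid M\<^esub> u \<in> A" if "u \<in> A" for u using that by blast
qed (use assms in \<open>auto simp: vpower_simps(2,3)\<close>)

lemma phi_zero: "phi i 0 = 0"
  using phi_add[of i 0 0] by simp

lemma U_eq: "U = {u + v | u v. u \<in> K \<and> v \<in> L}"
  by (auto simp: KLM_sub_def set_add_def' vpower_simps(2))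

sublocale U: ksubspace U M
proof -
  have K: "additive_subgroup K M"
    by (rule W_subgroupI) (auto simp: K_eq W_zero W_add W_scale g_add g_scale)
  have L: "additive_subgroup L M"
    by (rule W_subgroupI) (auto simp: L_eq W_zero W_add W_scale phi_add phi_scale phi_zero)
  interpret additive_subgroup U M
    unfolding KLM_sub_def by (rule M.add_additive_subgroups[OF K L])
  show "ksubspace U M"
  proof unfold_locales
    fix x a assume "x \<in> U"
    then obtain u v where uv: "x = u + v" "u \<in> K" "v \<in> L" by (auto simp: U_eq)
    then have "(\<lambda>j. a *s u j) \<in> K" "(\<lambda>j. a *s v j) \<in> L"
      by (auto simp: K_eq L_eq W_scale g_scale phi_scale)
    then have "(\<lambda>j. a *s u j) + (\<lambda>j. a *s v j) \<in> U" by (auto simp: U_eq)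
    then show "a \<odot>\<^bsub>M\<^esub> x \<in> U"
      by (simp add: uv(1) vpower_simps(4) scale_right_distrib plus_fun_def)
  qed
qed

lemma K_subset_U: "K \<subseteq> U"
proof
  fix u assume "u \<in> K"
  moreover have "0 \<in> L" by (simp add: L_eq W_zero phi_zero)
  ultimately have "u + 0 \<in> U" unfolding U_eq by blast
  then show "u \<in> U" by simp
qed

lemma S_K: "i \<in> {1..<n} \<Longrightarrow> u \<in> K \<Longrightarrow> lm_sigma i u \<in> K"
proof -
  assume i: "i \<in> {1..<n}" and u: "u \<in> K"
  have fixed: "g (u j) = u j" if "j \<in> {1..n}" for j using u that by (simp add: K_eq)
  have "g (u i) = u i" "g (u (Suc i)) = u (Suc i)" using fixed[of i] fixed[of "Suc i"] i by auto
  then have "g (lm_sigma i u j) = lm_sigma i u j" if "j \<in> {1..n}" for j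
    using fixed[OF that] by (auto simp: lm_sigma_def defect_def single_def psi_def g_scale g_diff g_add g_minus)
  then show "lm_sigma i u \<in> K" using u S_closed[OF i] by (simp add: K_eq)
qed

lemma S_L: "i \<in> {1..<n} \<Longrightarrow> u \<in> L \<Longrightarrow> lm_sigma i u \<in> L"
proof -
  assume i: "i \<in> {1..<n}" and u: "u \<in> L"
  have z: "phi j u = 0" if "j \<in> {1..n}" for j using u that by (simp add: L_eq)
  have "phi i u = 0" "phi (i + 1) u = 0" using z[of i] z[of "i + 1"] i by auto
  then have "phi j (lm_sigma i u) = 0" if "j \<in> {1..n}" for j
    using phi_S(1,2)[OF i, of u] phi_S(3)[OF i, of j u] z[OF that]
    by (cases "j = i"; cases "j = i + 1") auto
  then show "lm_sigma i u \<in> L" using u S_closed[OF i] by (simp add: L_eq)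
qed

lemma S_preserving:
  assumes i: "i \<in> {1..<n}"
  shows "restrict (lm_sigma i) W \<in> U.preserving"
proof -
  have "lm_sigma i u \<in> U \<and> u \<in> W" if "u \<in> U" for u
  proof -
    from that obtain a b where ab: "u = a + b" "a \<in> K" "b \<in> L" by (auto simp: U_eq)
    then have "lm_sigma i u = lm_sigma i a + lm_sigma i b" "lm_sigma i a \<in> K" "lm_sigma i b \<in> L" using S_K S_L i by (auto simp: S_add)
    then show ?thesis using that U.a_subset by (auto simp: U_eq)
  qed
  then show ?thesis
    unfolding U.preserving_def using GL_carrier_End[OF S_GL[OF i]] by auto
qed

abbreviation "E \<equiv> End_alg Q"

definition T :: "nat \<Rightarrow> (nat \<Rightarrow> 'v) set \<Rightarrow> (nat \<Rightarrow> 'v) set" where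
  "T i = inverse c \<odot>\<^bsub>E\<^esub> KLM_rep n scale lam \<rho> (FB_sigma n i)"

lemma kspace_Q: "kspace Q"
  unfolding KLM_space_def by (rule U.kspace_quot_space)

sublocale Q: kspace Q by (rule kspace_Q)
sublocale E: kalgebra E by (rule Q.kalgebra_End_alg)

lemma coset_closed: "w \<in> W \<Longrightarrow> U +>\<^bsub>M\<^esub> w \<in> carrier Q"
  by (simp add: KLM_space_def U.quot_space_carrier M.a_rcosetsI U.a_subset)

lemma coset_smult: "w \<in> W \<Longrightarrow> a \<odot>\<^bsub>Q\<^esub> (U +>\<^bsub>M\<^esub> w) = U +>\<^bsub>M\<^esub> (\<lambda>j. a *s w j)"
  by (simp add: KLM_space_def quot_space_def U.quot_smult_coset vpower_simps(4))

lemma coset_add: "u \<in> W \<Longrightarrow> w \<in> W \<Longrightarrow> (U +>\<^bsub>M\<^esub> u) \<oplus>\<^bsub>Q\<^esub> (U +>\<^bsub>M\<^esub> w) = U +>\<^bsub>M\<^esub> (u + w)"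
  by (simp add: KLM_space_def quot_space_def U.a_rcos_sum vpower_simps(2))

lemma KLM_rep_sigma:
  assumes i: "i \<in> {1..<n}"
  shows "KLM_rep n scale lam \<rho> (FB_sigma n i) = induced M U (restrict (lm_sigma i) W)"
  by (simp only: KLM_rep_def induced_def LM_rep_gens(2)[OF i] KLM_space_def)

lemma T_closed: "i \<in> {1..<n} \<Longrightarrow> T i \<in> carrier E"
  unfolding T_def KLM_rep_sigma
  by (intro E.smult_closed) (simp only: KLM_rep_sigma KLM_space_def U.induced_closed S_preserving)

lemma one_minus_T_coset:
  assumes i: "i \<in> {1..<n}" and w: "w \<in> W"
  shows "(\<one>\<^bsub>E\<^esub> \<ominus>\<^bsub>E\<^esub> T i) (U +>\<^bsub>M\<^esub> w) = U +>\<^bsub>M\<^esub> defect i w"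
proof -
  have lm_sigma: "(\<lambda>j. a *s lm_sigma i w j) \<in> W" for a by (rule W_scale[OF S_closed[OF i w]])
  have "KLM_rep n scale lam \<rho> (FB_sigma n i) (U +>\<^bsub>M\<^esub> w) = U +>\<^bsub>M\<^esub> lm_sigma i w"
    using U.induced_coset[OF S_preserving[OF i] w] w by (simp add: KLM_rep_sigma[OF i])
  then have T: "T i (U +>\<^bsub>M\<^esub> w) = U +>\<^bsub>M\<^esub> (\<lambda>j. inverse c *s lm_sigma i w j)"
    unfolding T_def by (simp add: End_alg_apply coset_closed coset_smult w S_closed[OF i])
  have "(\<one>\<^bsub>E\<^esub> \<ominus>\<^bsub>E\<^esub> T i) (U +>\<^bsub>M\<^esub> w) = (U +>\<^bsub>M\<^esub> w) \<oplus>\<^bsub>Q\<^esub> ((- 1) \<odot>\<^bsub>Q\<^esub> T i (U +>\<^bsub>M\<^esub> w))"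
    by (simp add: a_minus_def E.smult_minus_one[symmetric] T_closed[OF i] End_alg_apply coset_closed w)
  also have "\<dots> = U +>\<^bsub>M\<^esub> (w + (\<lambda>j. (- 1) *s inverse c *s lm_sigma i w j))"
    unfolding T coset_smult[OF lm_sigma] by (rule coset_add[OF w]) (rule W_scale[OF lm_sigma])
  also have "w + (\<lambda>j. (- 1) *s inverse c *s lm_sigma i w j) = defect i w"
    by (rule ext) (use c in \<open>simp add: lm_sigma_def algebra_simps\<close>)
  finally show ?thesis .
qed

lemma E_eqI:
  assumes "F \<in> carrier E" "H \<in> carrier E" "\<And>w. w \<in> W \<Longrightarrow> F (U +>\<^bsub>M\<^esub> w) = H (U +>\<^bsub>M\<^esub> w)"
  shows "F = H"
  using assms unfolding KLM_space_def by (rule U.End_quot_eqI)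

lemma coset_eqI: "u \<in> W \<Longrightarrow> v \<in> W \<Longrightarrow> u - v \<in> K \<Longrightarrow> U +>\<^bsub>M\<^esub> u = U +>\<^bsub>M\<^esub> v"
  using K_subset_U by (auto simp: U.coset_eq_iff M_diff)

lemma defect_eq: "defect i w = (\<lambda>j. if j = i then psi i w else if j = i + 1 then - psi i w else 0)"
  by (auto simp: defect_def single_def)

lemma psi_defect:
  "psi i (defect i w) = psi i w + g (psi i w)"
  "psi i (defect (i + 1) w) = - g (psi (i + 1) w)"
  "psi (i + 1) (defect i w) = - psi i w"
  "i + 2 \<le> k \<or> k + 2 \<le> i \<Longrightarrow> psi i (defect k w) = 0"
  using psi_def[of i "defect i w"] psi_def[of i "defect (i + 1) w"] psi_def[of "i + 1" "defect i w"]
    psi_def[of i "defect k w"]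
  by (auto simp: defect_eq g_minus)

lemma one_minus_T_far:
  assumes i: "i \<in> {1..<n}" and k: "k \<in> {1..<n}" and far: "i + 2 \<le> k \<or> k + 2 \<le> i"
  shows "(\<one>\<^bsub>E\<^esub> \<ominus>\<^bsub>E\<^esub> T i) \<otimes>\<^bsub>E\<^esub> (\<one>\<^bsub>E\<^esub> \<ominus>\<^bsub>E\<^esub> T k) = \<zero>\<^bsub>E\<^esub>"
proof (rule E_eqI)
  fix w assume w: "w \<in> W"
  have "defect i (defect k w) = (\<lambda>j. 0 *s w j)"
    unfolding defect_eq[of i] psi_defect(4)[OF far] by auto
  then have "U +>\<^bsub>M\<^esub> defect i (defect k w) = 0 \<odot>\<^bsub>Q\<^esub> (U +>\<^bsub>M\<^esub> w)" using w by (simp add: coset_smult)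
  then show "((\<one>\<^bsub>E\<^esub> \<ominus>\<^bsub>E\<^esub> T i) \<otimes>\<^bsub>E\<^esub> (\<one>\<^bsub>E\<^esub> \<ominus>\<^bsub>E\<^esub> T k)) (U +>\<^bsub>M\<^esub> w) = \<zero>\<^bsub>E\<^esub> (U +>\<^bsub>M\<^esub> w)"
    using w defect_closed[OF k w]
    by (simp add: End_alg_apply coset_closed one_minus_T_coset[OF i] one_minus_T_coset[OF k])
qed (use T_closed i k in auto)

context
  fixes \<mu> :: 'k
  assumes two_eigenvalues: "g (g v - \<mu> *s v) = g v - \<mu> *s v"
begin

text \<open>All the identities compare vectors of the form \<open>single i v - single (i + 1) v\<close>, so it is enough to compare
  \<open>v\<close> modulo the fixed vectors of \<open>g\<close>; there \<open>g\<close> may be replaced by \<open>\<mu>\<close>.\<close>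

lemma defect_congruent:
  assumes i: "i \<in> {1..<n}" and w: "w \<in> W" and u: "u \<in> W"
    and g_psi: "psi i u = b *s psi i w + g (psi i w)"
  shows "U +>\<^bsub>M\<^esub> defect i u = U +>\<^bsub>M\<^esub> (\<lambda>j. (b + \<mu>) *s defect i w j)"
proof (rule coset_eqI)
  define x where "x = g (psi i w) - \<mu> *s psi i w"
  have fixed: "g x = x" unfolding x_def by (rule two_eigenvalues)
  have eq: "defect i u - (\<lambda>j. (b + \<mu>) *s defect i w j) = single i x - single (i + 1) x"
    by (rule ext) (simp add: defect_def single_def g_psi x_def algebra_simps)
  have "single i x - single (i + 1) x \<in> W"
    using i by (auto simp: single_def vpower_simps)
  then show "defect i u - (\<lambda>j. (b + \<mu>) *s defect i w j) \<in> K"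
    unfolding eq K_eq using fixed by (auto simp: single_def g_minus)
qed (use defect_closed[OF i] w u W_scale in auto)

lemma one_minus_T_square:
  assumes i: "i \<in> {1..<n}"
  shows "(\<one>\<^bsub>E\<^esub> \<ominus>\<^bsub>E\<^esub> T i) \<otimes>\<^bsub>E\<^esub> (\<one>\<^bsub>E\<^esub> \<ominus>\<^bsub>E\<^esub> T i) = (1 + \<mu>) \<odot>\<^bsub>E\<^esub> (\<one>\<^bsub>E\<^esub> \<ominus>\<^bsub>E\<^esub> T i)"
proof (rule E_eqI)
  fix w assume w: "w \<in> W"
  note p = defect_closed[OF i w]
  have "U +>\<^bsub>M\<^esub> defect i (defect i w) = U +>\<^bsub>M\<^esub> (\<lambda>j. (1 + \<mu>) *s defect i w j)"
    by (rule defect_congruent[OF i w p]) (simp add: psi_defect)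
  then show "((\<one>\<^bsub>E\<^esub> \<ominus>\<^bsub>E\<^esub> T i) \<otimes>\<^bsub>E\<^esub> (\<one>\<^bsub>E\<^esub> \<ominus>\<^bsub>E\<^esub> T i)) (U +>\<^bsub>M\<^esub> w)
      = ((1 + \<mu>) \<odot>\<^bsub>E\<^esub> (\<one>\<^bsub>E\<^esub> \<ominus>\<^bsub>E\<^esub> T i)) (U +>\<^bsub>M\<^esub> w)"
    using w p by (simp add: End_alg_apply coset_closed one_minus_T_coset[OF i] coset_smult)
qed (use T_closed i in auto)

lemma one_minus_T_triple:
  assumes i: "i \<in> {1..<n}" and k: "k \<in> {1..<n}" and near: "k = i + 1 \<or> i = k + 1"
  shows "(\<one>\<^bsub>E\<^esub> \<ominus>\<^bsub>E\<^esub> T i) \<otimes>\<^bsub>E\<^esub> (\<one>\<^bsub>E\<^esub> \<ominus>\<^bsub>E\<^esub> T k) \<otimes>\<^bsub>E\<^esub> (\<one>\<^bsub>E\<^esub> \<ominus>\<^bsub>E\<^esub> T i)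
    = \<mu> \<odot>\<^bsub>E\<^esub> (\<one>\<^bsub>E\<^esub> \<ominus>\<^bsub>E\<^esub> T i)"
proof (rule E_eqI)
  fix w assume w: "w \<in> W"
  note p = defect_closed[OF i w] and q = defect_closed[OF k defect_closed[OF i w]]
  have "psi i (defect k (defect i w)) = g (psi i w)"
    using near psi_defect(2)[of i "defect i w"] psi_defect(3)[of i w]
      psi_defect(3)[of k "defect i w"] psi_defect(2)[of k w] by (auto simp: g_minus)
  then have "U +>\<^bsub>M\<^esub> defect i (defect k (defect i w)) = U +>\<^bsub>M\<^esub> (\<lambda>j. (0 + \<mu>) *s defect i w j)"
    by (intro defect_congruent[OF i w q]) simp
  then show "((\<one>\<^bsub>E\<^esub> \<ominus>\<^bsub>E\<^esub> T i) \<otimes>\<^bsub>E\<^esub> (\<one>\<^bsub>E\<^esub> \<ominus>\<^bsub>E\<^esub> T k) \<otimes>\<^bsub>E\<^esub> (\<one>\<^bsub>E\<^esub> \<ominus>\<^bsub>E\<^esub> T i)) (U +>\<^bsub>M\<^esub> w)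
      = (\<mu> \<odot>\<^bsub>E\<^esub> (\<one>\<^bsub>E\<^esub> \<ominus>\<^bsub>E\<^esub> T i)) (U +>\<^bsub>M\<^esub> w)"
    using w p q by (simp add: End_alg_apply coset_closed one_minus_T_coset[OF i] one_minus_T_coset[OF k] coset_smult)
qed (use T_closed i k in auto)

end

end

section \<open>The Temperley--Lieb module\<close>

lemma (in kalgebra) tl_relsI:
  assumes r: "r \<noteq> 0" and a: "\<forall>i\<in>{1..<n}. a i \<in> carrier A"
    and sq: "\<forall>i\<in>{1..<n}. a i \<otimes> a i = (1 + r ^ 2) \<odot> a i"
    and tri: "\<forall>i\<in>{1..<n}. \<forall>j\<in>{1..<n}. j = i + 1 \<or> i = j + 1 \<longrightarrow> a i \<otimes> a j \<otimes> a i = r ^ 2 \<odot> a i"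
    and far: "\<forall>i\<in>{1..<n}. \<forall>j\<in>{1..<n}. i + 2 \<le> j \<or> j + 2 \<le> i \<longrightarrow> a i \<otimes> a j = \<zero>"
  shows "\<forall>(u, v)\<in>tl_rels A n (r + inverse r) (\<lambda>i. inverse r \<odot> a i). u = v"
  unfolding tl_rels_hold_iff
proof (intro conjI ballI impI)
  have scalars: "inverse r * (inverse r * (1 + r ^ 2)) = (r + inverse r) * inverse r"
    "inverse r * (inverse r * (inverse r * r ^ 2)) = inverse r"
    using r by (simp_all add: field_simps power2_eq_square)
  fix i assume i: "i \<in> {1..<n}"
  then have ai: "a i \<in> carrier A" using a by blast
  have "(inverse r \<odot> a i) \<otimes> (inverse r \<odot> a i) = (inverse r * (inverse r * (1 + r ^ 2))) \<odot> a i"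
    using ai sq i by (simp add: smult_mult_l smult_mult_r smult_assoc)
  then show "(inverse r \<odot> a i) \<otimes> (inverse r \<odot> a i) = (r + inverse r) \<odot> (inverse r \<odot> a i)"
    unfolding scalars using ai by (simp add: smult_assoc)
  fix j assume j: "j \<in> {1..<n}"
  then have aj: "a j \<in> carrier A" using a by blast
  show "(inverse r \<odot> a i) \<otimes> (inverse r \<odot> a j) \<otimes> (inverse r \<odot> a i) = inverse r \<odot> a i"
    if "j = i + 1 \<or> i = j + 1"
  proof -
    have "a i \<otimes> a j \<otimes> a i = r ^ 2 \<odot> a i" using tri i j that by blast
    then have "(inverse r \<odot> a i) \<otimes> (inverse r \<odot> a j) \<otimes> (inverse r \<odot> a i)
        = (inverse r * (inverse r * (inverse r * r ^ 2))) \<odot> a i"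
      using ai aj by (simp add: smult_mult_l smult_mult_r smult_assoc)
    then show ?thesis unfolding scalars .
  qed
  show "(inverse r \<odot> a i) \<otimes> (inverse r \<odot> a j) = (inverse r \<odot> a j) \<otimes> (inverse r \<odot> a i)"
    if "i + 2 \<le> j \<or> j + 2 \<le> i"
  proof -
    have "a i \<otimes> a j = \<zero>" "a j \<otimes> a i = \<zero>" using far i j that by blast+
    then show ?thesis using ai aj by (simp add: smult_mult_l smult_mult_r)
  qed
qed

theorem mainTheorem7:
  fixes scale :: "'k::{alg_closed_field, field_char_0} \<Rightarrow> 'v::ab_group_add \<Rightarrow> 'v"
    and Basis :: "'v set"
    and n :: nat
    and g :: "'v \<Rightarrow> 'v"
    and c lam \<mu> :: 'k
    and \<rho> :: "fb \<Rightarrow> 'v \<Rightarrow> 'v"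
    and E :: "('k, (nat \<Rightarrow> 'v) set \<Rightarrow> (nat \<Rightarrow> 'v) set) module"
    and T :: "nat \<Rightarrow> (nat \<Rightarrow> 'v) set \<Rightarrow> (nat \<Rightarrow> 'v) set"
  assumes "finite_dimensional_vector_space scale Basis"
    and "n \<ge> 2"
    and "g \<in> carrier (GL (vspace scale))"
    and "semisimple_op scale g"
    and "c \<noteq> 0"
    and "lam \<noteq> 0" and "lam \<noteq> 1"
    and "\<rho> \<in> hom (FB n) (GL (vspace scale))"
    and "\<forall>j\<in>{1..n}. \<rho> (FB_x n j) = g"
    and "\<forall>i\<in>{1..<n}. \<rho> (FB_sigma n i) = c \<odot>\<^bsub>End_alg (vspace scale)\<^esub> \<one>\<^bsub>End_alg (vspace scale)\<^esub>"
    and "spec scale g - {1} \<subseteq> {\<mu>}"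
    and "E = End_alg (KLM_space n scale lam \<rho>)"
    and "T = (\<lambda>i. inverse c \<odot>\<^bsub>E\<^esub> KLM_rep n scale lam \<rho> (FB_sigma n i))"
  shows
    "(\<mu> \<noteq> 0 \<and> \<mu> \<noteq> 1 \<and> \<mu> \<noteq> -1 \<longrightarrow>
        (\<forall>i\<in>{1..<n}. (\<one>\<^bsub>E\<^esub> \<ominus>\<^bsub>E\<^esub> T i) [^]\<^bsub>E\<^esub> (2::nat) = (1 + \<mu>) \<odot>\<^bsub>E\<^esub> (\<one>\<^bsub>E\<^esub> \<ominus>\<^bsub>E\<^esub> T i)) \<and>
        (\<forall>i\<in>{1..<n}. \<forall>j\<in>{1..<n}. j = i + 1 \<or> i = j + 1 \<longrightarrow>
           (\<one>\<^bsub>E\<^esub> \<ominus>\<^bsub>E\<^esub> T i) \<otimes>\<^bsub>E\<^esub> (\<one>\<^bsub>E\<^esub> \<ominus>\<^bsub>E\<^esub> T j) \<otimes>\<^bsub>E\<^esub> (\<one>\<^bsub>E\<^esub> \<ominus>\<^bsub>E\<^esub> T i)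
             = \<mu> \<odot>\<^bsub>E\<^esub> (\<one>\<^bsub>E\<^esub> \<ominus>\<^bsub>E\<^esub> T i)) \<and>
        (\<forall>i\<in>{1..<n}. \<forall>j\<in>{1..<n}. i + 2 \<le> j \<or> j + 2 \<le> i \<longrightarrow>
           (\<one>\<^bsub>E\<^esub> \<ominus>\<^bsub>E\<^esub> T i) \<otimes>\<^bsub>E\<^esub> (\<one>\<^bsub>E\<^esub> \<ominus>\<^bsub>E\<^esub> T j) = \<zero>\<^bsub>E\<^esub>) \<and>
        (\<forall>r. r \<noteq> 0 \<and> r ^ 2 = \<mu> \<longrightarrow>
           (let \<delta> = r + inverse r; e = (\<lambda>i. inverse r \<odot>\<^bsub>E\<^esub> (\<one>\<^bsub>E\<^esub> \<ominus>\<^bsub>E\<^esub> T i));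
                H = hecke_alg n \<mu>; TL = tl_alg n \<delta>
            in (\<forall>(u, v)\<in>tl_rels E n \<delta> e. u = v) \<and>
               (\<exists>\<Phi>\<in>alg_hom H E. \<exists>\<pi>\<in>alg_hom H TL. \<exists>\<phi>\<in>alg_hom TL E.
                  (\<forall>i\<in>{1..<n}. \<Phi> (hecke_gen n \<mu> i) = T i) \<and>
                  (\<forall>i\<in>{1..<n}. \<pi> (hecke_gen n \<mu> i) = \<one>\<^bsub>TL\<^esub> \<ominus>\<^bsub>TL\<^esub> (r \<odot>\<^bsub>TL\<^esub> tl_gen n \<delta> i)) \<and>
                  (\<forall>i\<in>{1..<n}. \<phi> (tl_gen n \<delta> i) = e i) \<and>
                  (\<forall>h\<in>carrier H. \<Phi> h = \<phi> (\<pi> h)))))) \<and>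
     (\<mu> = -1 \<longrightarrow>
        (\<forall>i\<in>{1..<n}. (\<one>\<^bsub>E\<^esub> \<ominus>\<^bsub>E\<^esub> T i) [^]\<^bsub>E\<^esub> (2::nat) = (1 + \<mu>) \<odot>\<^bsub>E\<^esub> (\<one>\<^bsub>E\<^esub> \<ominus>\<^bsub>E\<^esub> T i)) \<and>
        (\<forall>i\<in>{1..<n}. \<forall>j\<in>{1..<n}. j = i + 1 \<or> i = j + 1 \<longrightarrow>
           (\<one>\<^bsub>E\<^esub> \<ominus>\<^bsub>E\<^esub> T i) \<otimes>\<^bsub>E\<^esub> (\<one>\<^bsub>E\<^esub> \<ominus>\<^bsub>E\<^esub> T j) \<otimes>\<^bsub>E\<^esub> (\<one>\<^bsub>E\<^esub> \<ominus>\<^bsub>E\<^esub> T i)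
             = \<mu> \<odot>\<^bsub>E\<^esub> (\<one>\<^bsub>E\<^esub> \<ominus>\<^bsub>E\<^esub> T i)) \<and>
        (\<forall>r. r ^ 2 = -1 \<longrightarrow>
           r + inverse r = 0 \<and>
           (let e = (\<lambda>i. inverse r \<odot>\<^bsub>E\<^esub> (\<one>\<^bsub>E\<^esub> \<ominus>\<^bsub>E\<^esub> T i))
            in (\<forall>(u, v)\<in>tl_rels E n 0 e. u = v) \<and>
               (\<exists>\<phi>\<in>alg_hom (tl_alg n 0) E. \<forall>i\<in>{1..<n}. \<phi> (tl_gen n 0 i) = e i))))"
proof -
  note fin = assms(1) and gl = assms(3) and ss = assms(4) and c0 = assms(5) and lam0 = assms(6)
    and rx = assms(9) and rs = assms(10) and sp = assms(11) and E = assms(12) and T = assms(13)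
  interpret V: finite_dimensional_vector_space scale Basis by (rule fin)
  note lin = V.vspace_End[OF GL_carrier_End[OF gl]]
  obtain g' where g': "\<And>v. g (g' v) = v" "\<And>v. g' (g v) = v"
    using V.vspace_GL_inverse[OF gl] by blast
  have "c \<odot>\<^bsub>End_alg (vspace scale)\<^esub> \<one>\<^bsub>End_alg (vspace scale)\<^esub> = scale c"
    by (rule ext) (simp add: End_alg_def vspace_def)
  then interpret Z: scalar_klm scale n g g' c lam \<rho>
    by unfold_locales (use lin g' c0 lam0 rx rs in auto)
  have T_eq: "T = Z.T" unfolding T E by (rule ext) (simp add: Z.T_def)
  interpret E: kalgebra E unfolding E by (rule Z.E.kalgebra_axioms)
  note mu = semisimple_two_eigenvalues[OF fin lin ss sp]
  define a where "a i = \<one>\<^bsub>E\<^esub> \<ominus>\<^bsub>E\<^esub> T i" for i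
  have T_closed: "T i \<in> carrier E" if "i \<in> {1..<n}" for i
    using Z.T_closed[OF that] by (simp add: T_eq E)
  have a_closed: "\<forall>i\<in>{1..<n}. a i \<in> carrier E" using T_closed by (simp add: a_def)
  have square: "\<forall>i\<in>{1..<n}. a i \<otimes>\<^bsub>E\<^esub> a i = (1 + \<mu>) \<odot>\<^bsub>E\<^esub> a i"
    unfolding a_def T_eq E using Z.one_minus_T_square[OF mu] by blast
  have triple: "\<forall>i\<in>{1..<n}. \<forall>j\<in>{1..<n}. j = i + 1 \<or> i = j + 1 \<longrightarrow>
      a i \<otimes>\<^bsub>E\<^esub> a j \<otimes>\<^bsub>E\<^esub> a i = \<mu> \<odot>\<^bsub>E\<^esub> a i"
    unfolding a_def T_eq E using Z.one_minus_T_triple[OF mu] by blast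
  have far: "\<forall>i\<in>{1..<n}. \<forall>j\<in>{1..<n}. i + 2 \<le> j \<or> j + 2 \<le> i \<longrightarrow> a i \<otimes>\<^bsub>E\<^esub> a j = \<zero>\<^bsub>E\<^esub>"
    unfolding a_def T_eq E using Z.one_minus_T_far by blast
  have power: "\<forall>i\<in>{1..<n}. a i [^]\<^bsub>E\<^esub> (2::nat) = (1 + \<mu>) \<odot>\<^bsub>E\<^esub> a i"
    using square a_closed by (simp add: numeral_2_eq_2)
  have rels: "\<forall>(u, v)\<in>tl_rels E n (r + inverse r) (\<lambda>i. inverse r \<odot>\<^bsub>E\<^esub> a i). u = v"
    if "r \<noteq> 0" "r ^ 2 = \<mu>" for r
    by (rule E.tl_relsI) (use that a_closed square triple far in auto)
  have e_closed: "\<forall>i\<in>{1..<n}. inverse r \<odot>\<^bsub>E\<^esub> a i \<in> carrier E" for r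
    using a_closed by simp
  have T_from_e: "\<one>\<^bsub>E\<^esub> \<ominus>\<^bsub>E\<^esub> r \<odot>\<^bsub>E\<^esub> (inverse r \<odot>\<^bsub>E\<^esub> a i) = T i"
    if "r \<noteq> 0" "i \<in> {1..<n}" for r i
  proof -
    have "r \<odot>\<^bsub>E\<^esub> (inverse r \<odot>\<^bsub>E\<^esub> a i) = a i"
      using that a_closed by (simp add: E.smult_assoc[symmetric])
    moreover have "\<one>\<^bsub>E\<^esub> \<ominus>\<^bsub>E\<^esub> (\<one>\<^bsub>E\<^esub> \<ominus>\<^bsub>E\<^esub> T i) = T i"
      using T_closed[OF that(2)] E.one_closed by algebra
    ultimately show ?thesis by (simp add: a_def)
  qed
  have factor: "\<exists>\<Phi>\<in>alg_hom (hecke_alg n \<mu>) E. \<exists>\<pi>\<in>alg_hom (hecke_alg n \<mu>) (tl_alg n (r + inverse r)).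
      \<exists>\<phi>\<in>alg_hom (tl_alg n (r + inverse r)) E.
        (\<forall>i\<in>{1..<n}. \<Phi> (hecke_gen n \<mu> i) = T i) \<and>
        (\<forall>i\<in>{1..<n}. \<pi> (hecke_gen n \<mu> i) = \<one>\<^bsub>tl_alg n (r + inverse r)\<^esub> \<ominus>\<^bsub>tl_alg n (r + inverse r)\<^esub>
          (r \<odot>\<^bsub>tl_alg n (r + inverse r)\<^esub> tl_gen n (r + inverse r) i)) \<and>
        (\<forall>i\<in>{1..<n}. \<phi> (tl_gen n (r + inverse r) i) = inverse r \<odot>\<^bsub>E\<^esub> a i) \<and>
        (\<forall>h\<in>carrier (hecke_alg n \<mu>). \<Phi> h = \<phi> (\<pi> h))" if r: "r \<noteq> 0" "r ^ 2 = \<mu>" for r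
  proof -
    from E.hecke_factors_through_tl[OF r(1) e_closed rels[OF r] HOL.refl HOL.refl]
    obtain \<Phi> \<pi> \<phi> where h: "\<Phi> \<in> alg_hom (hecke_alg n \<mu>) E"
      "\<pi> \<in> alg_hom (hecke_alg n \<mu>) (tl_alg n (r + inverse r))"
      "\<phi> \<in> alg_hom (tl_alg n (r + inverse r)) E"
      "\<forall>i\<in>{1..<n}. \<Phi> (hecke_gen n \<mu> i) = \<one>\<^bsub>E\<^esub> \<ominus>\<^bsub>E\<^esub> r \<odot>\<^bsub>E\<^esub> (inverse r \<odot>\<^bsub>E\<^esub> a i)"
      "\<forall>i\<in>{1..<n}. \<pi> (hecke_gen n \<mu> i) = \<one>\<^bsub>tl_alg n (r + inverse r)\<^esub> \<ominus>\<^bsub>tl_alg n (r + inverse r)\<^esub>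
          (r \<odot>\<^bsub>tl_alg n (r + inverse r)\<^esub> tl_gen n (r + inverse r) i)"
      "\<forall>i\<in>{1..<n}. \<phi> (tl_gen n (r + inverse r) i) = inverse r \<odot>\<^bsub>E\<^esub> a i"
      "\<forall>h\<in>carrier (hecke_alg n \<mu>). \<Phi> h = \<phi> (\<pi> h)"
      unfolding r(2) by (elim bexE conjE) (rule that; assumption)
    have "\<forall>i\<in>{1..<n}. \<Phi> (hecke_gen n \<mu> i) = T i" using h(4) T_from_e[OF r(1)] by simp
    then show ?thesis using h(5-7) by (intro bexI[OF _ h(1)] bexI[OF _ h(2)] bexI[OF _ h(3)] conjI)
  qed
  have zero: "r \<noteq> 0 \<and> r + inverse r = 0" if "r ^ 2 = - 1" for r :: 'k
  proof -
    have "r \<noteq> 0" using that by auto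
    moreover have "r * (r + inverse r) = 0"
      using \<open>r \<noteq> 0\<close> that by (simp add: distrib_left power2_eq_square)
    ultimately show ?thesis by simp
  qed
  show ?thesis
    unfolding Let_def a_def[symmetric]
  proof (intro conjI impI allI)
    fix r :: 'k assume "\<mu> = - 1" "r ^ 2 = - 1"
    then have r: "r \<noteq> 0" "r + inverse r = 0" "r ^ 2 = \<mu>" using zero by auto
    show "r + inverse r = 0" by (rule r)
    have tl: "\<forall>(u, v)\<in>tl_rels E n 0 (\<lambda>i. inverse r \<odot>\<^bsub>E\<^esub> a i). u = v" using rels[OF r(1,3)] by (simp add: r(2))
    then show "\<forall>(u, v)\<in>tl_rels E n 0 (\<lambda>i. inverse r \<odot>\<^bsub>E\<^esub> a i). u = v" .
    show "\<exists>\<phi>\<in>alg_hom (tl_alg n 0) E. \<forall>i\<in>{1..<n}. \<phi> (tl_gen n 0 i) = inverse r \<odot>\<^bsub>E\<^esub> a i"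
      by (rule tl_alg_universal[OF E.kalgebra_axioms e_closed tl])
  qed (rule power triple far | elim conjE, rule rels factor; assumption)+
qed

end
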